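(* Let both endpoints of $(a,b)$ be of lim-4 type for $\ell$. Let $L$ be a self-adjoint extension of $L_{min}$ with separated boundary conditions such that $0$ is not an eigenvalue of $L$. Let $\phi_1,\phi_2,\psi_1,\psi_2\in L^2(a,b;w)$ be solutions of $\ell y=0$ such that the boundary conditions of $L$ are $[y,\phi_1](a)=0=[y,\phi_2](a)$ and $[y,\psi_1](b)=0=[y,\psi_2](b)$. Let $a_j\searrow a$, $b_j\nearrow b$ and let $L_j$ be the regular self-adjoint operator given by $\ell$ on $[a_j,b_j]$ with boundary conditions $[y,\phi_1](a_j)=0=[y,\phi_2](a_j)$ and $[y,\psi_1](b_j)=0=[y,\psi_2](b_j)$ ($0$ is then not an eigenvalue of $L_j$). Index the eigenvalues (with multiplicity) of $L$ and of $L_j$ by nonzero integers as $$\cdots\le\lambda_{-2}\le\lambda_{-1}<0<\lambda_1\le\lambda_2\le\cdots,\qquad \cdots\le\lambda_{-2}^{(j)}\le\lambda_{-1}^{(j)}<0<\lambda_1^{(j)}\le\lambda_2^{(j)}\le\cdots$$ (there may be finitely or infinitely many negative eigenvalues of $L$). Then for every $k>0$, $\lambda_k^{(j)}\to\lambda_k$ as $j\to\infty$. Furthermore, for $k>0$, if $\lambda_{-k}$ exists, then for all sufficiently large $j$ the operator $L_j$ has an eigenvalue $\lambda_{-k}^{(j)}$, and $\lambda_{-k}^{(j)}\to\lambda_{-k}$ as $j\to\infty$.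
   Context: Let $-\infty\le a<b\le\infty$, and let $p,s,q,w$ be real-valued on $(a,b)$ with $1/p,s,q,w\in L^1_{loc}(a,b)$ and $p,w>0$ a.e. Quasi-derivatives: $y^{[0]}=y$, $y^{[1]}=y'$, $y^{[2]}=py''$, $y^{[3]}=-(py'')'+sy'$; $u_y=(y^{[0]},y^{[1]})^T$, $v_y=(y^{[3]},y^{[2]})^T$. $\ell y=\frac1w\{[(py'')'-sy']'+qy\}=\frac1w\{-(y^{[3]})'+qy\}$. $L^2(a,b;w)$ has inner product $\int_a^b f\overline g\,w\,dx$. An endpoint is of lim-$p$ type if the space of solutions of $\ell y=iy$ square integrable (with weight $w$) near that endpoint has dimension $p$. $D_{max}$: all $y$ with $y^{[0]},\dots,y^{[3]}$ locally absolutely continuous on $(a,b)$ and $y,\ell y\in L^2(a,b;w)$. $D_{min}$: closure, in the graph norm $(\|y\|^2+\|\ell y\|^2)^{1/2}$, of the set of functions in $D_{max}$ with compact support in $(a,b)$; $L_{min}y=\ell y$ on $D_{min}$. $[f,g](x)=u_f^T\overline{v_g}-v_f^T\overline{u_g}$ at $x$; for $f,g\in D_{max}$ the limits at $a$ and $b$ exist. $\phi_1,\phi_2$ are linearly independent with $[\phi_1,\phi_1]=[\phi_1,\phi_2]=[\phi_2,\phi_2]=0$ (constant forms), and likewise $\psi_1,\psi_2$; these functions may be complex-valued. $L$ has purely discrete spectrum. *)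

theory Defs
  imports "HOL-Analysis.Analysis" "HOL-Library.Function_Algebras"
begin

text \<open>
  Everything is relative to an interval \<open>S\<close> of positive length, used both for the open interval
  \<open>einterval a b\<close> with extended real end points and for the compact intervals \<open>{c..d}\<close>.
  Functions on \<open>S\<close> are represented by functions on the real line that vanish outside \<open>S\<close>,
  so that linear independence and dimension have their usual meaning.
\<close>

global_interpretation cfun: vector_space "\<lambda>(c::complex) (f::real \<Rightarrow> complex) x. c * f x"
  by standard (auto simp: fun_eq_iff algebra_simps)

definition L1_loc :: "real set \<Rightarrow> (real \<Rightarrow> real) \<Rightarrow> bool" where
  "L1_loc S f \<longleftrightarrow> (\<forall>c d. {c..d} \<subseteq> S \<longrightarrow> f absolutely_integrable_on {c..d})"

definition abs_cont_on :: "real \<Rightarrow> real \<Rightarrow> (real \<Rightarrow> complex) \<Rightarrow> bool" where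
  "abs_cont_on c d f \<longleftrightarrow>
     (\<forall>\<epsilon>>0. \<exists>\<delta>>0. \<forall>D T. D division_of T \<and> T \<subseteq> {c..d} \<and> (\<Sum>K\<in>D. Sup K - Inf K) < \<delta> \<longrightarrow>
        (\<Sum>K\<in>D. cmod (f (Sup K) - f (Inf K))) < \<epsilon>)"

definition loc_abs_cont :: "real set \<Rightarrow> (real \<Rightarrow> complex) \<Rightarrow> bool" where
  "loc_abs_cont S f \<longleftrightarrow> (\<forall>c d. {c..d} \<subseteq> S \<longrightarrow> abs_cont_on c d f)"

text \<open>
  \<open>Y k\<close> is the \<open>k\<close>-th quasi-derivative of \<open>Y 0\<close>. The functions \<open>p y''\<close> and \<open>-(p y'')' + s y'\<close> are
  only defined almost everywhere; \<open>Y 2\<close> and \<open>Y 3\<close> are their locally absolutely continuous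
  representatives, which are unique on \<open>S\<close>. The almost everywhere differentiability of \<open>Y 3\<close>
  follows from its absolute continuity and is listed only for convenience.
\<close>

definition quasi_derivs ::
  "(real \<Rightarrow> real) \<Rightarrow> (real \<Rightarrow> real) \<Rightarrow> real set \<Rightarrow> (nat \<Rightarrow> real \<Rightarrow> complex) \<Rightarrow> bool" where
  "quasi_derivs p s S Y \<longleftrightarrow>
     (\<forall>k\<le>3. loc_abs_cont S (Y k)) \<and>
     (\<forall>x\<in>S. (Y 0 has_vector_derivative Y 1 x) (at x within S)) \<and>
     (AE x in lebesgue_on S. \<exists>d. (Y 1 has_vector_derivative d) (at x within S) \<and>
        Y 2 x = complex_of_real (p x) * d) \<and>
     (AE x in lebesgue_on S. \<exists>d. (Y 2 has_vector_derivative d) (at x within S) \<and>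
        Y 3 x = - d + complex_of_real (s x) * Y 1 x) \<and>
     (AE x in lebesgue_on S. Y 3 differentiable (at x within S))"

definition qd ::
  "(real \<Rightarrow> real) \<Rightarrow> (real \<Rightarrow> real) \<Rightarrow> real set \<Rightarrow> (real \<Rightarrow> complex) \<Rightarrow> nat \<Rightarrow> real \<Rightarrow> complex" where
  "qd p s S y = (SOME Y. Y 0 = y \<and> quasi_derivs p s S Y)"

text \<open>The functions to which the differential expression applies.\<close>

definition D_ell :: "(real \<Rightarrow> real) \<Rightarrow> (real \<Rightarrow> real) \<Rightarrow> real set \<Rightarrow> (real \<Rightarrow> complex) set" where
  "D_ell p s S =
     {y. (\<forall>x. x \<notin> S \<longrightarrow> y x = 0) \<and> (\<exists>Y. Y 0 = y \<and> quasi_derivs p s S Y)}"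

definition ell ::
  "(real \<Rightarrow> real) \<Rightarrow> (real \<Rightarrow> real) \<Rightarrow> (real \<Rightarrow> real) \<Rightarrow> (real \<Rightarrow> real) \<Rightarrow> real set \<Rightarrow>
     (real \<Rightarrow> complex) \<Rightarrow> real \<Rightarrow> complex" where
  "ell p s q w S y x =
     (if x \<in> S
      then (- vector_derivative (qd p s S y 3) (at x within S) + complex_of_real (q x) * y x)
             / complex_of_real (w x)
      else 0)"

text \<open>
  The form \<open>u\<^sub>f\<^sup>T cnj v\<^sub>g - v\<^sub>f\<^sup>T cnj u\<^sub>g\<close> with \<open>u = (F 0, F 1)\<close> and \<open>v = (F 3, F 2)\<close>, as a function of the
  families of quasi-derivatives of \<open>f\<close> and \<open>g\<close>, which may belong to different intervals.
\<close>

definition bracket ::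
  "(nat \<Rightarrow> real \<Rightarrow> complex) \<Rightarrow> (nat \<Rightarrow> real \<Rightarrow> complex) \<Rightarrow> real \<Rightarrow> complex" where
  "bracket F G x =
     (F 0 x * cnj (G 3 x) + F 1 x * cnj (G 2 x)) - (F 3 x * cnj (G 0 x) + F 2 x * cnj (G 1 x))"

text \<open>
  The Hilbert space \<open>L\<^sup>2(S;w)\<close> on the level of representatives; its elements are identified when
  they agree almost everywhere on \<open>S\<close>.
\<close>

definition L2w :: "(real \<Rightarrow> real) \<Rightarrow> real set \<Rightarrow> (real \<Rightarrow> complex) set" where
  "L2w w S =
     {f. (\<forall>x. x \<notin> S \<longrightarrow> f x = 0) \<and> f \<in> borel_measurable (lebesgue_on S) \<and>
         integrable (lebesgue_on S) (\<lambda>x. (cmod (f x))\<^sup>2 * w x)}"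

definition inner_w ::
  "(real \<Rightarrow> real) \<Rightarrow> real set \<Rightarrow> (real \<Rightarrow> complex) \<Rightarrow> (real \<Rightarrow> complex) \<Rightarrow> complex" where
  "inner_w w S f g = (LINT x|lebesgue_on S. f x * cnj (g x) * complex_of_real (w x))"

definition norm_w :: "(real \<Rightarrow> real) \<Rightarrow> real set \<Rightarrow> (real \<Rightarrow> complex) \<Rightarrow> real" where
  "norm_w w S f = sqrt (LINT x|lebesgue_on S. (cmod (f x))\<^sup>2 * w x)"

definition D_max ::
  "(real \<Rightarrow> real) \<Rightarrow> (real \<Rightarrow> real) \<Rightarrow> (real \<Rightarrow> real) \<Rightarrow> (real \<Rightarrow> real) \<Rightarrow> real set \<Rightarrow>
     (real \<Rightarrow> complex) set" where
  "D_max p s q w S = {y \<in> D_ell p s S. y \<in> L2w w S \<and> ell p s q w S y \<in> L2w w S}"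

definition D_comp ::
  "(real \<Rightarrow> real) \<Rightarrow> (real \<Rightarrow> real) \<Rightarrow> (real \<Rightarrow> real) \<Rightarrow> (real \<Rightarrow> real) \<Rightarrow> real set \<Rightarrow>
     (real \<Rightarrow> complex) set" where
  "D_comp p s q w S =
     {y \<in> D_max p s q w S. compact (closure {x. y x \<noteq> 0}) \<and> closure {x. y x \<noteq> 0} \<subseteq> S}"

text \<open>The closure may be taken inside \<open>D_max\<close>, which is complete in the graph norm.\<close>

definition D_min ::
  "(real \<Rightarrow> real) \<Rightarrow> (real \<Rightarrow> real) \<Rightarrow> (real \<Rightarrow> real) \<Rightarrow> (real \<Rightarrow> real) \<Rightarrow> real set \<Rightarrow>
     (real \<Rightarrow> complex) set" where
  "D_min p s q w S =
     {y \<in> D_max p s q w S. \<forall>\<epsilon>>0. \<exists>z\<in>D_comp p s q w S.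
        sqrt ((norm_w w S (\<lambda>x. y x - z x))\<^sup>2
          + (norm_w w S (\<lambda>x. ell p s q w S y x - ell p s q w S z x))\<^sup>2) < \<epsilon>}"

text \<open>\<open>eigenspace p s q w S D \<mu>\<close> is the kernel of \<open>\<ell> - \<mu>\<close> on the domain \<open>D\<close>.\<close>

definition eigenspace ::
  "(real \<Rightarrow> real) \<Rightarrow> (real \<Rightarrow> real) \<Rightarrow> (real \<Rightarrow> real) \<Rightarrow> (real \<Rightarrow> real) \<Rightarrow> real set \<Rightarrow>
     (real \<Rightarrow> complex) set \<Rightarrow> complex \<Rightarrow> (real \<Rightarrow> complex) set" where
  "eigenspace p s q w S D \<mu> = {y \<in> D. AE x in lebesgue_on S. ell p s q w S y x = \<mu> * y x}"

abbreviation solutions ::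
  "(real \<Rightarrow> real) \<Rightarrow> (real \<Rightarrow> real) \<Rightarrow> (real \<Rightarrow> real) \<Rightarrow> (real \<Rightarrow> real) \<Rightarrow> real set \<Rightarrow>
     complex \<Rightarrow> (real \<Rightarrow> complex) set" where
  "solutions p s q w S \<equiv> eigenspace p s q w S (D_ell p s S)"

definition lim_type_left ::
  "(real \<Rightarrow> real) \<Rightarrow> (real \<Rightarrow> real) \<Rightarrow> (real \<Rightarrow> real) \<Rightarrow> (real \<Rightarrow> real) \<Rightarrow> real set \<Rightarrow> nat \<Rightarrow> bool" where
  "lim_type_left p s q w S n \<longleftrightarrow>
     cfun.dim {y \<in> solutions p s q w S \<i>.
       \<exists>c\<in>S. integrable (lebesgue_on (S \<inter> {..c})) (\<lambda>x. (cmod (y x))\<^sup>2 * w x)} = n"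

definition lim_type_right ::
  "(real \<Rightarrow> real) \<Rightarrow> (real \<Rightarrow> real) \<Rightarrow> (real \<Rightarrow> real) \<Rightarrow> (real \<Rightarrow> real) \<Rightarrow> real set \<Rightarrow> nat \<Rightarrow> bool" where
  "lim_type_right p s q w S n \<longleftrightarrow>
     cfun.dim {y \<in> solutions p s q w S \<i>.
       \<exists>c\<in>S. integrable (lebesgue_on (S \<inter> {c..})) (\<lambda>x. (cmod (y x))\<^sup>2 * w x)} = n"

text \<open>
  The operator \<open>y \<mapsto> \<ell> y\<close> with domain \<open>D\<close> is self-adjoint: \<open>D\<close> is a dense subspace, and a pair
  \<open>(g, h)\<close> belongs to the graph of the adjoint iff it belongs, up to null sets, to the graph
  of the operator.
\<close>

definition self_adjoint ::
  "(real \<Rightarrow> real) \<Rightarrow> (real \<Rightarrow> real) \<Rightarrow> (real \<Rightarrow> real) \<Rightarrow> (real \<Rightarrow> real) \<Rightarrow> real set \<Rightarrow>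
     (real \<Rightarrow> complex) set \<Rightarrow> bool" where
  "self_adjoint p s q w S D \<longleftrightarrow>
     D \<subseteq> D_max p s q w S \<and> cfun.subspace D \<and>
     (\<forall>f\<in>L2w w S. \<forall>\<epsilon>>0. \<exists>y\<in>D. norm_w w S (\<lambda>x. f x - y x) < \<epsilon>) \<and>
     (\<forall>g\<in>L2w w S. \<forall>h\<in>L2w w S.
        (\<forall>f\<in>D. inner_w w S (ell p s q w S f) g = inner_w w S f h) \<longleftrightarrow>
        (\<exists>y\<in>D. (AE x in lebesgue_on S. g x = y x) \<and>
               (AE x in lebesgue_on S. h x = ell p s q w S y x)))"

definition resolvent_set ::
  "(real \<Rightarrow> real) \<Rightarrow> (real \<Rightarrow> real) \<Rightarrow> (real \<Rightarrow> real) \<Rightarrow> (real \<Rightarrow> real) \<Rightarrow> real set \<Rightarrow>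
     (real \<Rightarrow> complex) set \<Rightarrow> complex set" where
  "resolvent_set p s q w S D =
     {z. (\<forall>f\<in>L2w w S. \<exists>y\<in>D. AE x in lebesgue_on S. ell p s q w S y x - z * y x = f x) \<and>
         (\<exists>C. \<forall>y\<in>D. norm_w w S y \<le> C * norm_w w S (\<lambda>x. ell p s q w S y x - z * y x))}"

text \<open>The spectrum consists of isolated eigenvalues of finite multiplicity.\<close>

definition purely_discrete_spectrum ::
  "(real \<Rightarrow> real) \<Rightarrow> (real \<Rightarrow> real) \<Rightarrow> (real \<Rightarrow> real) \<Rightarrow> (real \<Rightarrow> real) \<Rightarrow> real set \<Rightarrow>
     (real \<Rightarrow> complex) set \<Rightarrow> bool" where
  "purely_discrete_spectrum p s q w S D \<longleftrightarrow>
     (\<forall>z \<in> - resolvent_set p s q w S D.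
        z isolated_in (- resolvent_set p s q w S D) \<and>
        eigenspace p s q w S D z \<noteq> {0} \<and>
        (\<exists>B. finite B \<and> eigenspace p s q w S D z \<subseteq> cfun.span B))"

text \<open>
  The separated boundary conditions at the end points of \<open>(a,b)\<close>, where \<open>[y,\<phi>](a)\<close> and \<open>[y,\<psi>](b)\<close>
  are limits.
\<close>

definition sep_domain ::
  "(real \<Rightarrow> real) \<Rightarrow> (real \<Rightarrow> real) \<Rightarrow> (real \<Rightarrow> real) \<Rightarrow> (real \<Rightarrow> real) \<Rightarrow> ereal \<Rightarrow> ereal \<Rightarrow>
     (real \<Rightarrow> complex) \<Rightarrow> (real \<Rightarrow> complex) \<Rightarrow> (real \<Rightarrow> complex) \<Rightarrow> (real \<Rightarrow> complex) \<Rightarrow>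
     (real \<Rightarrow> complex) set" where
  "sep_domain p s q w a b \<phi>\<^sub>1 \<phi>\<^sub>2 \<psi>\<^sub>1 \<psi>\<^sub>2 =
     (let S = einterval a b; br = (\<lambda>y z x. bracket (qd p s S y) (qd p s S z) (real_of_ereal x)) in
      {y \<in> D_max p s q w S.
         (br y \<phi>\<^sub>1 \<longlongrightarrow> 0) (at_right a) \<and> (br y \<phi>\<^sub>2 \<longlongrightarrow> 0) (at_right a) \<and>
         (br y \<psi>\<^sub>1 \<longlongrightarrow> 0) (at_left b) \<and> (br y \<psi>\<^sub>2 \<longlongrightarrow> 0) (at_left b)})"

text \<open>
  The boundary conditions on a compact subinterval \<open>[c,d]\<close>: the quasi-derivatives of \<open>y\<close> are taken
  on \<open>[c,d]\<close>, those of the boundary functions on \<open>(a,b)\<close>.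
\<close>

definition reg_domain ::
  "(real \<Rightarrow> real) \<Rightarrow> (real \<Rightarrow> real) \<Rightarrow> (real \<Rightarrow> real) \<Rightarrow> (real \<Rightarrow> real) \<Rightarrow> ereal \<Rightarrow> ereal \<Rightarrow>
     (real \<Rightarrow> complex) \<Rightarrow> (real \<Rightarrow> complex) \<Rightarrow> (real \<Rightarrow> complex) \<Rightarrow> (real \<Rightarrow> complex) \<Rightarrow>
     real \<Rightarrow> real \<Rightarrow> (real \<Rightarrow> complex) set" where
  "reg_domain p s q w a b \<phi>\<^sub>1 \<phi>\<^sub>2 \<psi>\<^sub>1 \<psi>\<^sub>2 c d =
     (let br = (\<lambda>y z x. bracket (qd p s {c..d} y) (qd p s (einterval a b) z) x) in
      {y \<in> D_max p s q w {c..d}. br y \<phi>\<^sub>1 c = 0 \<and> br y \<phi>\<^sub>2 c = 0 \<and> br y \<psi>\<^sub>1 d = 0 \<and> br y \<psi>\<^sub>2 d = 0})"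

text \<open>
  \<open>lam\<close> lists the nonzero eigenvalues of an operator with eigenspaces \<open>E\<close>, counted with multiplicity,
  in nondecreasing order outward from \<open>0\<close>: the indices \<open>I\<close> in use are initial segments (possibly
  empty or infinite) of \<open>1, 2, \<dots>\<close> and of \<open>-1, -2, \<dots>\<close>.
\<close>

definition eigenvalue_indexing ::
  "(complex \<Rightarrow> (real \<Rightarrow> complex) set) \<Rightarrow> int set \<Rightarrow> (int \<Rightarrow> real) \<Rightarrow> bool" where
  "eigenvalue_indexing E I lam \<longleftrightarrow>
     0 \<notin> I \<and>
     (\<forall>k\<in>I. \<forall>m. 0 < m \<and> m \<le> k \<or> k \<le> m \<and> m < 0 \<longrightarrow> m \<in> I) \<and>
     (\<forall>k\<in>I. (0 < k \<longrightarrow> 0 < lam k) \<and> (k < 0 \<longrightarrow> lam k < 0)) \<and>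
     mono_on I lam \<and>
     (\<forall>\<mu>. \<mu> \<noteq> 0 \<longrightarrow> finite {k\<in>I. complex_of_real (lam k) = \<mu>} \<and>
        card {k\<in>I. complex_of_real (lam k) = \<mu>} = cfun.dim (E \<mu>))"

end

theory Submission
  imports Defs "HOL-Library.Diagonal_Subsequence"
begin

text \<open>
  Since \<open>0\<close> is not an eigenvalue, \<open>L\<close> has a bounded inverse \<open>T\<close>. The boundary conditions of \<open>L\<^sub>j\<close> are
  built from the solutions of \<open>\<ell> y = 0\<close> that define \<open>L\<close>: if \<open>f\<close> is supported in \<open>[a\<^sub>j, b\<^sub>j]\<close>, the brackets
  \<open>[T f, \<phi>\<^sub>i]\<close> are constant on \<open>(a, a\<^sub>j]\<close> and tend to \<open>0\<close> at \<open>a\<close>, and likewise at \<open>b\<close>. Therefore \<open>T f\<close> restricted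
  to \<open>[a\<^sub>j, b\<^sub>j]\<close> solves the problem for \<open>L\<^sub>j\<close>, that is, the inverse of \<open>L\<^sub>j\<close> is the compression \<open>P\<^sub>j T P\<^sub>j\<close> of \<open>T\<close>
  to \<open>L\<^sup>2(a\<^sub>j, b\<^sub>j; w)\<close>. Expanding \<open>T f\<close> in the basis \<open>\<phi>\<^sub>1, \<phi>\<^sub>2, \<psi>\<^sub>1, \<psi>\<^sub>2\<close> of square integrable solutions bounds it
  pointwise by \<open>\<parallel>f\<parallel>\<close> times a fixed square integrable function, which makes \<open>T\<close> compact. By the max-min
  principle the positive eigenvalues of a compression lie below those of \<open>T\<close>, and \<open>P\<^sub>j \<rightarrow> 1\<close> strongly gives the
  convergence; negative eigenvalues are treated by passing to \<open>-T\<close>. There are infinitely many positive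
  eigenvalues because the quadratic form of \<open>L\<close> is positive on functions supported in a short interval.
\<close>

section \<open>Compact symmetric operators and the max-min principle\<close>

text \<open>Functions are not identified modulo null sets, so the inner product is only
  semidefinite. Definiteness is replaced by a property of \<open>T\<close>: its values lie in
  \<open>D\<close> and depend only on the class of the argument, so an eigenvector of length 0 is
  the zero function. No eigenbasis is built. The max-min principle rests on one fact: if the form of
  \<open>T\<close> is positive somewhere on the orthogonal complement of given eigenvectors, a
  further eigenvector lies in that complement. Everything else is counting against the given
  indexings, which is why eigenspaces are labelled by the eigenvalues of \<open>L\<close>, the
  reciprocals of those of \<open>T\<close>. That 0 is not an eigenvalue does more than provide
  \<open>T\<close>. It makes the planes spanned by the \<phi>s and by the \<psi>s complementary for
  the bracket, so the four brackets of a function determine all its quasi-derivatives. This converts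
  boundary conditions into pointwise bounds, and also shows that the truncated operators are
  injective. Their symmetry, dense domain and self-adjointness are then all read off from the
  inverse, which is symmetric and defined on the whole space.\<close>

lemma homogeneous_system_nontrivial:
  fixes A :: "'e \<Rightarrow> 'g \<Rightarrow> complex"
  assumes "finite G" "finite B" "card G < card B"
  shows "\<exists>c. (\<exists>e\<in>B. c e \<noteq> 0) \<and> (\<forall>g\<in>G. (\<Sum>e\<in>B. c e * A e g) = 0)"
  using assms
proof (induction G arbitrary: B A rule: finite_induct)
  case empty
  then obtain e where "e \<in> B" by fastforce
  then show ?case by (intro exI[of _ "\<lambda>_. 1"]) auto
next
  case (insert g G)
  show ?case
  proof (cases "\<forall>e\<in>B. A e g = 0")
    case True
    from insert have "card G < card B" by simp
    from insert.IH[OF insert.prems(1) this, of A] True show ?thesis by auto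
  next
    case False
    then obtain e0 where e0: "e0 \<in> B" "A e0 g \<noteq> 0" by auto
    \<comment> \<open>Row reduction: equation \<open>g\<close> is solved for the unknown
      \<open>e0\<close>, and the result is substituted into the remaining equations.\<close>
    have "card G < card (B - {e0})" using insert e0 by simp
    from insert.IH[OF _ this, of "\<lambda>e h. A e h - A e g / A e0 g * A e0 h"] insert.prems
    obtain c where c: "\<exists>e\<in>B-{e0}. c e \<noteq> 0"
      "\<And>h. h \<in> G \<Longrightarrow> (\<Sum>e\<in>B-{e0}. c e * (A e h - A e g / A e0 g * A e0 h)) = 0" by auto
    define S where "S = (\<Sum>e\<in>B-{e0}. c e * A e g)"
    define d where "d = c(e0 := - S / A e0 g)"
    have sum_d: "(\<Sum>e\<in>B. d e * A e h) = (\<Sum>e\<in>B-{e0}. c e * A e h) - S / A e0 g * A e0 h" for h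
    proof -
      have "(\<Sum>e\<in>B. d e * A e h) = d e0 * A e0 h + (\<Sum>e\<in>B-{e0}. d e * A e h)"
        using e0 insert.prems by (simp add: sum.remove)
      also have "(\<Sum>e\<in>B-{e0}. d e * A e h) = (\<Sum>e\<in>B-{e0}. c e * A e h)"
        by (rule sum.cong) (auto simp: d_def)
      finally show ?thesis by (simp add: d_def)
    qed
    have "(\<Sum>e\<in>B. d e * A e h) = 0" if "h \<in> insert g G" for h
    proof (cases "h = g")
      case True
      then show ?thesis using e0 by (simp add: sum_d S_def)
    next
      case False
      then have "h \<in> G" using that by simp
      from c(2)[OF this] show ?thesis
        by (simp add: sum_d S_def algebra_simps sum_subtractf sum_distrib_left sum_divide_distrib)
    qed
    moreover have "\<exists>e\<in>B. d e \<noteq> 0" using c(1) by (auto simp: d_def)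
    ultimately show ?thesis by blast
  qed
qed

section \<open>Semi-inner product spaces\<close>

locale semi_inner = vector_space scale
  for scale :: "complex \<Rightarrow> 'v::ab_group_add \<Rightarrow> 'v" +
  fixes H :: "'v set" and ip :: "'v \<Rightarrow> 'v \<Rightarrow> complex"
  assumes H_subspace: "subspace H"
    and ip_add: "\<lbrakk>f \<in> H; g \<in> H; h \<in> H\<rbrakk> \<Longrightarrow> ip (f + g) h = ip f h + ip g h"
    and ip_scale: "\<lbrakk>f \<in> H; h \<in> H\<rbrakk> \<Longrightarrow> ip (scale c f) h = c * ip f h"
    and ip_sym: "\<lbrakk>f \<in> H; g \<in> H\<rbrakk> \<Longrightarrow> ip g f = cnj (ip f g)"
    and ip_pos: "f \<in> H \<Longrightarrow> 0 \<le> Re (ip f f)"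
begin

text \<open>Only a seminorm: the vectors will be functions rather than classes, and a function that
  vanishes almost everywhere has length 0.\<close>

definition nrm :: "'v \<Rightarrow> real" where "nrm f = sqrt (Re (ip f f))"

lemma H_add [simp]: "f \<in> H \<Longrightarrow> g \<in> H \<Longrightarrow> f + g \<in> H"
  and H_scale [simp]: "f \<in> H \<Longrightarrow> scale c f \<in> H"
  and H_diff [simp]: "f \<in> H \<Longrightarrow> g \<in> H \<Longrightarrow> f - g \<in> H"
  and H_zero [simp]: "0 \<in> H"
  using H_subspace by (auto intro: subspace_add subspace_scale subspace_diff subspace_0)

lemma H_neg [simp]: "f \<in> H \<Longrightarrow> - f \<in> H"
  using H_subspace by (rule subspace_neg)

lemma H_sum: "(\<And>e. e \<in> B \<Longrightarrow> u e \<in> H) \<Longrightarrow> sum u B \<in> H"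
  using H_subspace by (rule subspace_sum)

lemma ip_add_right: "\<lbrakk>f \<in> H; g \<in> H; h \<in> H\<rbrakk> \<Longrightarrow> ip f (g + h) = ip f g + ip f h"
  by (simp add: ip_sym[of _ f] ip_add)

lemma ip_scale_right: "\<lbrakk>f \<in> H; g \<in> H\<rbrakk> \<Longrightarrow> ip f (scale c g) = cnj c * ip f g"
  by (simp add: ip_sym[of _ f] ip_scale)

lemma ip_neg: "\<lbrakk>f \<in> H; h \<in> H\<rbrakk> \<Longrightarrow> ip (- f) h = - ip f h"
  using ip_scale[of f h "-1"] by simp

lemma ip_neg_right: "\<lbrakk>f \<in> H; h \<in> H\<rbrakk> \<Longrightarrow> ip f (- h) = - ip f h"
  using ip_scale_right[of f h "-1"] by simp

lemma ip_diff: "\<lbrakk>f \<in> H; g \<in> H; h \<in> H\<rbrakk> \<Longrightarrow> ip (f - g) h = ip f h - ip g h"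
  using ip_add[of f "- g" h] by (simp add: ip_neg)

lemma ip_diff_right: "\<lbrakk>f \<in> H; g \<in> H; h \<in> H\<rbrakk> \<Longrightarrow> ip f (g - h) = ip f g - ip f h"
  using ip_add_right[of f g "- h"] by (simp add: ip_neg_right)

lemma ip_zero [simp]: "h \<in> H \<Longrightarrow> ip 0 h = 0"
  using ip_scale[of 0 h 0] by simp

lemma ip_zero_right [simp]: "h \<in> H \<Longrightarrow> ip h 0 = 0"
  using ip_scale_right[of h 0 0] by simp

lemma ip_sum:
  assumes "\<And>e. e \<in> B \<Longrightarrow> u e \<in> H" "h \<in> H"
  shows "ip (\<Sum>e\<in>B. u e) h = (\<Sum>e\<in>B. ip (u e) h)"
  using assms
  by (induction B rule: infinite_finite_induct) (auto simp: ip_add H_sum)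

lemma ip_sum_right:
  assumes "\<And>e. e \<in> B \<Longrightarrow> u e \<in> H" "h \<in> H"
  shows "ip h (\<Sum>e\<in>B. u e) = (\<Sum>e\<in>B. ip h (u e))"
  using assms
  by (induction B rule: infinite_finite_induct) (auto simp: ip_add_right H_sum)

lemma ip_self: "f \<in> H \<Longrightarrow> ip f f = of_real ((nrm f)\<^sup>2)"
  using ip_sym[of f f] ip_pos[of f] by (simp add: nrm_def complex_eq_iff)

lemma nrm_sq: "f \<in> H \<Longrightarrow> (nrm f)\<^sup>2 = Re (ip f f)"
  by (simp add: nrm_def ip_pos)

lemma nrm_nonneg: "f \<in> H \<Longrightarrow> 0 \<le> nrm f"
  by (simp add: nrm_def ip_pos)

lemma nrm_scale: "f \<in> H \<Longrightarrow> nrm (scale c f) = cmod c * nrm f"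
proof -
  assume f: "f \<in> H"
  have "ip (scale c f) (scale c f) = of_real ((cmod c)\<^sup>2) * ip f f"
    unfolding complex_norm_square using f by (simp add: ip_scale ip_scale_right)
  then show ?thesis
    by (simp add: nrm_def real_sqrt_mult)
qed

text \<open>Expansion of the square of \<open>f - t * ip f g * g\<close> for real \<open>t\<close>.
  The squared form is kept for use with auxiliary forms, and \<open>ip g g = 0\<close> needs its own
  case because \<open>g\<close> need not be 0 then.\<close>

lemma cauchy_schwarz_sq:
  assumes f: "f \<in> H" and g: "g \<in> H"
  shows "(cmod (ip f g))\<^sup>2 \<le> Re (ip f f) * Re (ip g g)"
proof -
  define m where "m = (cmod (ip f g))\<^sup>2"
  define a where "a = Re (ip f f)"
  define b where "b = Re (ip g g)"
  have key: "0 \<le> a - 2 * t * m + t\<^sup>2 * m * b" for t :: real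
  proof -
    \<comment> \<open>The factor \<open>ip f g\<close> makes both cross terms real, each equal to
      \<open>- t * m\<close>.\<close>
    define c where "c = - of_real t * ip f g"
    have "ip (f + scale c g) (f + scale c g)
        = ip f f + cnj c * ip f g + c * cnj (ip f g) + c * cnj c * ip g g"
      using f g by (simp add: ip_add ip_add_right ip_scale ip_scale_right ip_sym[of f g] algebra_simps)
    also have "\<dots> = ip f f - of_real (2 * t * m) + of_real (t\<^sup>2 * m) * ip g g"
      unfolding c_def m_def of_real_mult complex_norm_square
      by (simp add: algebra_simps power2_eq_square)
    finally have "Re (ip (f + scale c g) (f + scale c g)) = a - 2 * t * m + t\<^sup>2 * m * b"
      by (simp add: a_def b_def)
    then show ?thesis using ip_pos[of "f + scale c g"] f g by simp
  qed
  have m: "0 \<le> m" and b: "0 \<le> b" using g ip_pos by (auto simp: m_def b_def)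
  show ?thesis
  proof (cases "b = 0")
    case True
    have "m = 0"
    proof (rule ccontr)
      assume "m \<noteq> 0"
      \<comment> \<open>For \<open>b = 0\<close> the lower bound is affine in \<open>t\<close>; this
        value of \<open>t\<close> makes it equal to -1.\<close>
      then have "a - 2 * ((a + 1) / (2 * m)) * m = -1" by (simp add: field_simps)
      with key[of "(a + 1) / (2 * m)"] True show False by simp
    qed
    then show ?thesis using True by (simp add: m_def b_def)
  next
    case False
    with b have "0 < b" by simp
    from key[of "1 / b"] have "0 \<le> a - m / b"
      using False by (simp add: power2_eq_square field_simps)
    then show ?thesis using \<open>0 < b\<close> by (simp add: field_simps m_def a_def b_def)
  qed
qed

lemma cauchy_schwarz:
  assumes "f \<in> H" "g \<in> H"
  shows "cmod (ip f g) \<le> nrm f * nrm g"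
proof -
  have "(cmod (ip f g))\<^sup>2 \<le> (nrm f * nrm g)\<^sup>2"
    using cauchy_schwarz_sq[OF assms] assms by (simp add: power_mult_distrib nrm_sq)
  then show ?thesis by (rule power2_le_imp_le) (simp add: assms nrm_nonneg)
qed

lemma nrm_triangle:
  assumes "f \<in> H" "g \<in> H"
  shows "nrm (f + g) \<le> nrm f + nrm g"
proof -
  have "(nrm (f + g))\<^sup>2 = (nrm f)\<^sup>2 + (nrm g)\<^sup>2 + 2 * Re (ip f g)"
    using assms by (simp add: nrm_sq ip_add ip_add_right ip_sym[of f g])
  also have "\<dots> \<le> (nrm f)\<^sup>2 + (nrm g)\<^sup>2 + 2 * (nrm f * nrm g)"
    using complex_Re_le_cmod[of "ip f g"] cauchy_schwarz[OF assms] by simp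
  finally have "(nrm (f + g))\<^sup>2 \<le> (nrm f + nrm g)\<^sup>2" by (simp add: power2_sum)
  then show ?thesis by (rule power2_le_imp_le) (simp add: assms nrm_nonneg)
qed

lemma nrm_neg: "f \<in> H \<Longrightarrow> nrm (- f) = nrm f"
  using nrm_scale[of f "-1"] by simp

lemma nrm_minus_commute: "f \<in> H \<Longrightarrow> g \<in> H \<Longrightarrow> nrm (f - g) = nrm (g - f)"
  using nrm_neg[of "f - g"] by simp

lemma nrm_sum:
  assumes "\<And>e. e \<in> B \<Longrightarrow> u e \<in> H"
  shows "nrm (\<Sum>e\<in>B. u e) \<le> (\<Sum>e\<in>B. nrm (u e))"
  using assms
proof (induction B rule: infinite_finite_induct)
  case (insert x F)
  then show ?case using nrm_triangle[of "u x" "sum u F"] H_sum[of F u] by auto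
qed (simp_all add: nrm_def)

lemma nrm_diff_diff:
  assumes "f \<in> H" "g \<in> H"
  shows "\<bar>nrm f - nrm g\<bar> \<le> nrm (f - g)"
  using nrm_triangle[of "f - g" g] nrm_triangle[of "g - f" f] assms nrm_minus_commute[of f g] by simp

lemma ip_tendsto_zero:
  assumes "\<And>n. f n \<in> H" "z \<in> H" "g \<in> H" "(\<lambda>n. nrm (f n - z)) \<longlonglongrightarrow> 0"
  shows "(\<lambda>n. ip (f n) g) \<longlonglongrightarrow> ip z g"
proof (rule LIM_zero_cancel, rule Lim_null_comparison)
  show "\<forall>\<^sub>F n in sequentially. norm (ip (f n) g - ip z g) \<le> nrm (f n - z) * nrm g"
    using cauchy_schwarz[of "f _ - z" g] assms by (intro always_eventually allI) (simp add: ip_diff)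
  show "(\<lambda>n. nrm (f n - z) * nrm g) \<longlonglongrightarrow> 0"
    using tendsto_mult_left_zero[OF assms(4)] .
qed

lemma nrm_tendsto:
  assumes "\<And>n. f n \<in> H" "z \<in> H" "(\<lambda>n. nrm (f n - z)) \<longlonglongrightarrow> 0"
  shows "(\<lambda>n. nrm (f n)) \<longlonglongrightarrow> nrm z"
proof (rule LIM_zero_cancel, rule Lim_null_comparison)
  show "\<forall>\<^sub>F n in sequentially. norm (nrm (f n) - nrm z) \<le> nrm (f n - z)"
    using nrm_diff_diff assms by (intro always_eventually allI) simp
qed (rule assms(3))

text \<open>Gram-Schmidt. Normalising the residual needs a positive length, which the definiteness
  assumption on \<open>span B\<close> supplies in place of a definite inner product.\<close>

lemma orthonormal_basis_exists:
  assumes "finite B" "independent B" "B \<subseteq> H"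
    and "\<And>y. y \<in> span B \<Longrightarrow> ip y y = 0 \<Longrightarrow> y = 0"
  shows "\<exists>F\<subseteq>span B. finite F \<and> card F = card B \<and> (\<forall>e\<in>F. \<forall>f\<in>F. ip e f = (if e = f then 1 else 0))"
  using assms
proof (induction B rule: finite_induct)
  case empty
  then show ?case by (intro exI[of _ "{}"]) auto
next
  case (insert b B)
  have indB: "independent B" using insert.prems(1) independent_mono by blast
  have subB: "span B \<subseteq> span (insert b B)" by (rule span_mono) auto
  obtain F where F: "F \<subseteq> span B" "finite F" "card F = card B"
    "\<And>e f. e \<in> F \<Longrightarrow> f \<in> F \<Longrightarrow> ip e f = (if e = f then 1 else 0)"
  proof -
    have "B \<subseteq> H" using insert.prems(2) by simp
    from insert.IH[OF indB this insert.prems(3)[OF subsetD[OF subB]]]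
    show ?thesis using that by blast
  qed
  have spanH: "span (insert b B) \<subseteq> H" using insert.prems(2) H_subspace span_minimal by blast
  then have FH: "F \<subseteq> H" using F(1) subB by auto
  have bH: "b \<in> H" using insert.prems by simp
  define u where "u = b - (\<Sum>e\<in>F. scale (ip b e) e)"
  have sF: "(\<Sum>e\<in>F. scale (ip b e) e) \<in> span B" using F(1) by (intro span_sum span_scale) auto
  have bspan: "b \<notin> span B" using insert.prems(1) insert.hyps(2) by (simp add: independent_insert)
  then have u0: "u \<noteq> 0" using sF by (auto simp: u_def)
  have uspan: "u \<in> span (insert b B)"
    unfolding u_def using sF subB by (intro span_diff) (auto intro: span_base)
  then have uH: "u \<in> H" using spanH by auto
  have orth: "ip u f = 0" if "f \<in> F" for f
  proof -
    have fH: "f \<in> H" using that FH by auto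
    have "ip (\<Sum>e\<in>F. scale (ip b e) e) f = (\<Sum>e\<in>F. ip b e * ip e f)"
      using FH fH by (subst ip_sum) (auto simp: ip_scale intro!: sum.cong)
    also have "\<dots> = (\<Sum>e\<in>F. if e = f then ip b e else 0)"
      using F(4) that by (intro sum.cong) auto
    also have "\<dots> = ip b f" using that F(2) by (simp add: sum.delta)
    finally show ?thesis
      using bH fH FH by (simp add: u_def ip_diff H_sum subset_iff)
  qed
  have nu: "nrm u \<noteq> 0"
    using insert.prems(3)[OF uspan] u0 ip_self[OF uH] by auto
  define v where "v = scale (of_real (1 / nrm u)) u"
  have vH: "v \<in> H" using uH by (simp add: v_def)
  have vv: "ip v v = 1"
    using uH nu by (simp add: v_def ip_self nrm_scale norm_divide nrm_nonneg)
  have vF: "ip v f = 0" "ip f v = 0" if "f \<in> F" for f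
    using orth[OF that] uH FH that ip_sym[of f v] ip_sym[of v f] vH
    by (auto simp: v_def ip_scale)
  have "v \<notin> F" using vF(1)[of v] vv by auto
  have "insert v F \<subseteq> span (insert b B)"
    using F(1) subB uspan by (auto simp: v_def intro: span_scale)
  moreover have "card (insert v F) = card (insert b B)"
    using \<open>v \<notin> F\<close> F insert.hyps by simp
  moreover have "\<forall>e\<in>insert v F. \<forall>f\<in>insert v F. ip e f = (if e = f then 1 else 0)"
    using F(4) vF vv \<open>v \<notin> F\<close> by auto
  ultimately show ?case using F(2) by (intro exI[of _ "insert v F"]) auto
qed

end

text \<open>For the inverse \<open>T\<close> of an operator this is the eigenspace of that operator
  at \<open>\<mu>\<close>; the eigenvalue of \<open>T\<close> itself is the reciprocal.\<close>

definition (in vector_space) eig :: "('b \<Rightarrow> 'b) \<Rightarrow> 'b set \<Rightarrow> 'a \<Rightarrow> 'b set" where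
  "eig T H \<mu> = {y \<in> H. scale \<mu> (T y) = y}"

text \<open>The part of an eigenvalue indexing that concerns positive eigenvalues. Finite spanning
  sets are demanded explicitly because \<open>dim\<close> is 0 by convention for a space of infinite
  dimension, so the equality of \<open>card\<close> and \<open>dim\<close> alone does not bound the
  eigenspace.\<close>

definition (in vector_space) pos_indexing :: "(real \<Rightarrow> 'b set) \<Rightarrow> int set \<Rightarrow> (int \<Rightarrow> real) \<Rightarrow> bool" where
  "pos_indexing E I lam \<longleftrightarrow>
     (\<forall>k\<in>I. \<forall>m. 0 < m \<and> m \<le> k \<longrightarrow> m \<in> I) \<and>
     (\<forall>k\<in>I. 0 < k \<longleftrightarrow> 0 < lam k) \<and> mono_on I lam \<and>
     (\<forall>\<mu>>0. finite {k\<in>I. lam k = \<mu>} \<and> card {k\<in>I. lam k = \<mu>} = dim (E \<mu>) \<and>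
       (\<exists>B. finite B \<and> E \<mu> \<subseteq> span B))"

lemma (in vector_space) finite_basis:
  assumes "finite B0" "V \<subseteq> span B0"
  obtains B where "B \<subseteq> V" "independent B" "V \<subseteq> span B" "card B = dim V" "finite B"
proof -
  obtain B where B: "B \<subseteq> V" "independent B" "V \<subseteq> span B" "card B = dim V"
    by (rule basis_exists)
  have "finite B" using independent_span_bound[OF assms(1) B(2)] B(1) assms(2) by blast
  with B show ?thesis using that by blast
qed

text \<open>Compactness is stated through sequences and the seminorm. \<open>T_null\<close> says
  that \<open>T\<close> respects equality up to null vectors and returns a definite representative;
  it turns approximate identities in the seminorm into exact ones.\<close>

locale compact_symmetric = semi_inner scale H ip
  for scale :: "complex \<Rightarrow> 'v::ab_group_add \<Rightarrow> 'v" and H :: "'v set" and ip :: "'v \<Rightarrow> 'v \<Rightarrow> complex" +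
  fixes T :: "'v \<Rightarrow> 'v"
  assumes T_in [simp]: "f \<in> H \<Longrightarrow> T f \<in> H"
    and T_add: "\<lbrakk>f \<in> H; g \<in> H\<rbrakk> \<Longrightarrow> T (f + g) = T f + T g"
    and T_scale: "f \<in> H \<Longrightarrow> T (scale c f) = scale c (T f)"
    and T_sym: "\<lbrakk>f \<in> H; g \<in> H\<rbrakk> \<Longrightarrow> ip (T f) g = ip f (T g)"
    and T_bdd: "\<exists>C\<ge>0. \<forall>f\<in>H. nrm (T f) \<le> C * nrm f"
    and T_null: "\<lbrakk>f \<in> H; ip f f = 0\<rbrakk> \<Longrightarrow> T f = 0"
    and T_compact: "\<lbrakk>\<And>n::nat. fs n \<in> H; \<And>n. nrm (fs n) \<le> B\<rbrakk> \<Longrightarrow>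
      \<exists>(r::nat\<Rightarrow>nat) z. strict_mono r \<and> z \<in> H \<and> (\<lambda>n. nrm (T (fs (r n)) - z)) \<longlonglongrightarrow> 0"
begin

lemma T_diff: "\<lbrakk>f \<in> H; g \<in> H\<rbrakk> \<Longrightarrow> T (f - g) = T f - T g"
  using T_add[of f "scale (-1) g"] T_scale[of g "-1"] by simp

lemma T_zero [simp]: "T 0 = 0"
  using T_scale[of 0 0] by simp

lemma T_sum:
  assumes "\<And>e. e \<in> B \<Longrightarrow> u e \<in> H"
  shows "T (\<Sum>e\<in>B. u e) = (\<Sum>e\<in>B. T (u e))"
  using assms
  by (induction B rule: infinite_finite_induct) (auto simp: T_add H_sum)

text \<open>\<open>T\<close> leaves the orthogonal complement of eigenvectors invariant, so the
  supremum \<open>M\<close> of its form over unit vectors of that complement can be studied there.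
  Along a maximising sequence \<open>M f - T f\<close> tends to 0, and compactness yields a limit
  \<open>z\<close>. Since \<open>T z = M z\<close> is known only up to a null vector,
  \<open>T z\<close> rather than \<open>z\<close> is the eigenvector.\<close>

lemma eigenvector_exists:
  assumes G: "\<And>g. g \<in> G \<Longrightarrow> g \<in> H \<and> (\<exists>\<nu>. T g = scale \<nu> g)"
    and v: "v \<in> H" "\<And>g. g \<in> G \<Longrightarrow> ip v g = 0" "0 < Re (ip (T v) v)"
  shows "\<exists>M y. Re (ip (T v) v) \<le> M * (nrm v)\<^sup>2 \<and> 0 < M \<and> y \<in> H \<and> (\<forall>g\<in>G. ip y g = 0) \<and>
           T y = scale (of_real M) y \<and> 0 < nrm y"
proof -
  obtain C where C: "0 \<le> C" "\<And>f. f \<in> H \<Longrightarrow> nrm (T f) \<le> C * nrm f" using T_bdd by auto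
  define K where "K = {f \<in> H. \<forall>g\<in>G. ip f g = 0}"
  have KH: "f \<in> H" if "f \<in> K" for f using that by (simp add: K_def)
  have subK: "subspace K"
    unfolding K_def using G by (auto intro!: subspaceI simp: ip_add ip_scale)
  have TK: "T f \<in> K" if "f \<in> K" for f
  proof -
    have "ip (T f) g = 0" if g: "g \<in> G" for g
    proof -
      obtain \<nu> where "T g = scale \<nu> g" using G g by blast
      then show ?thesis using \<open>f \<in> K\<close> G g by (simp add: K_def T_sym ip_scale_right)
    qed
    then show ?thesis using that by (simp add: K_def)
  qed
  have form_bound: "Re (ip (T f) f) \<le> C * (nrm f)\<^sup>2" if "f \<in> H" for f
  proof -
    have "Re (ip (T f) f) \<le> nrm (T f) * nrm f"
      using complex_Re_le_cmod cauchy_schwarz that T_in by (meson order_trans)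
    also have "\<dots> \<le> C * nrm f * nrm f" using C that by (intro mult_right_mono) (auto simp: nrm_nonneg)
    finally show ?thesis by (simp add: power2_eq_square)
  qed
  define Q where "Q = {Re (ip (T f) f) |f. f \<in> K \<and> nrm f = 1}"
  define M where "M = Sup Q"
  have vK: "v \<in> K" using v by (simp add: K_def)
  have nv: "0 < nrm v"
    using form_bound[OF v(1)] v(3) nrm_nonneg[OF v(1)] by (cases "nrm v = 0") auto
  have normalise: "Re (ip (T f) f) / (nrm f)\<^sup>2 \<in> Q" if "f \<in> K" "nrm f \<noteq> 0" for f
  proof -
    have "f \<in> H" using that KH by simp
    define u where "u = scale (of_real (1 / nrm f)) f"
    have "u \<in> K" "nrm u = 1"
      using that subK \<open>f \<in> H\<close> by (auto simp: u_def nrm_scale norm_divide nrm_nonneg intro: subspace_scale)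
    moreover have "ip (T u) u = of_real (1 / (nrm f)\<^sup>2) * ip (T f) f"
      using \<open>f \<in> H\<close> by (simp add: u_def T_scale ip_scale ip_scale_right power2_eq_square)
    then have "Re (ip (T u) u) = Re (ip (T f) f) / (nrm f)\<^sup>2" by simp
    ultimately show ?thesis unfolding Q_def by (metis (mono_tags, lifting) mem_Collect_eq)
  qed
  have bddQ: "bdd_above Q"
    unfolding Q_def using form_bound KH by (intro bdd_aboveI[of _ C]) fastforce
  have Mv: "Re (ip (T v) v) / (nrm v)\<^sup>2 \<le> M"
    unfolding M_def using normalise[OF vK] nv bddQ by (intro cSup_upper) auto
  then have Mpos: "0 < M" using v(3) nv by (meson divide_pos_pos less_le_trans zero_less_power)
  have form_le: "Re (ip (T f) f) \<le> M * (nrm f)\<^sup>2" if "f \<in> K" for f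
  proof (cases "nrm f = 0")
    case True
    then show ?thesis using form_bound[OF KH[OF that]] by simp
  next
    case False
    have "Re (ip (T f) f) / (nrm f)\<^sup>2 \<le> M"
      unfolding M_def using normalise[OF that False] bddQ by (rule cSup_upper)
    then show ?thesis using False by (simp add: field_simps)
  qed
  \<comment> \<open>Nonnegative on \<open>K\<close> because \<open>M\<close> is the supremum. Its
    own Cauchy-Schwarz inequality bounds the residual \<open>M f - T f\<close> by the defect
    \<open>B f f\<close>.\<close>
  define B where "B = (\<lambda>f g. of_real M * ip f g - ip (T f) g)"
  interpret B: semi_inner scale K B
  proof
    show "subspace K" by (rule subK)
  next
    fix f g h assume "f \<in> K" "g \<in> K" "h \<in> K"
    then show "B (f + g) h = B f h + B g h" using KH by (simp add: B_def ip_add T_add algebra_simps)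
  next
    fix f h c assume "f \<in> K" "h \<in> K"
    then show "B (scale c f) h = c * B f h" using KH by (simp add: B_def ip_scale T_scale algebra_simps)
  next
    fix f g assume fg: "f \<in> K" "g \<in> K"
    have "ip (T g) f = cnj (ip (T f) g)"
      using fg KH T_sym[of g f] ip_sym[of "T f" g] by simp
    then show "B g f = cnj (B f g)" using fg KH ip_sym[of f g] by (simp add: B_def)
  next
    fix f assume f: "f \<in> K"
    show "0 \<le> Re (B f f)" using form_le[OF f] KH[OF f] by (simp add: B_def nrm_sq)
  qed
  have resid: "(nrm (scale (of_real M) f - T f))\<^sup>2 \<le> (M + C) * Re (B f f)" if "f \<in> K" for f
  proof -
    define g where "g = scale (of_real M) f - T f"
    have fH: "f \<in> H" using that KH by simp
    have gK: "g \<in> K" using that subK TK by (auto simp: g_def intro!: subspace_diff subspace_scale)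
    then have gH: "g \<in> H" using KH by simp
    \<comment> \<open>The residual \<open>g\<close> represents \<open>f\<close> in the form
      \<open>B\<close>, so the fourth power of its length is at most \<open>B f f * B g g\<close>,
      where \<open>B g g\<close> is again at most a constant times the square of its length.\<close>
    have "B f g = ip g g" using fH gH by (simp add: B_def g_def ip_diff ip_scale)
    then have "((nrm g)\<^sup>2)\<^sup>2 \<le> Re (B f f) * Re (B g g)"
      using B.cauchy_schwarz_sq[OF that gK] gH by (simp add: ip_self norm_power nrm_nonneg)
    also have "Re (B g g) \<le> (M + C) * (nrm g)\<^sup>2"
    proof -
      have "- Re (ip (T g) g) \<le> C * (nrm g)\<^sup>2"
      proof -
        have "- Re (ip (T g) g) \<le> cmod (ip (T g) g)" using abs_Re_le_cmod[of "ip (T g) g"] by linarith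
        also have "\<dots> \<le> nrm (T g) * nrm g" using cauchy_schwarz gH by simp
        also have "\<dots> \<le> C * nrm g * nrm g" using C gH by (intro mult_right_mono) (auto simp: nrm_nonneg)
        finally show ?thesis by (simp add: power2_eq_square)
      qed
      then show ?thesis using gH by (simp add: B_def nrm_sq algebra_simps)
    qed
    then have "Re (B f f) * Re (B g g) \<le> Re (B f f) * ((M + C) * (nrm g)\<^sup>2)"
      using B.ip_pos[OF that] by (rule mult_left_mono)
    finally have *: "(nrm g)\<^sup>2 * (nrm g)\<^sup>2 \<le> ((M + C) * Re (B f f)) * (nrm g)\<^sup>2"
      by (simp add: power2_eq_square algebra_simps)
    show ?thesis
    proof (cases "nrm g = 0")
      case True
      then show ?thesis using B.ip_pos[OF that] Mpos C by (simp add: g_def[symmetric])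
    next
      case False
      then show ?thesis using mult_right_le_imp_le[OF *] by (simp add: g_def[symmetric])
    qed
  qed
  have "\<exists>f\<in>K. nrm f = 1 \<and> M - 1 / Suc n < Re (ip (T f) f)" for n
  proof -
    have "Q \<noteq> {}" using normalise[OF vK] nv by auto
    then have "\<exists>x\<in>Q. M - 1 / Suc n < x"
      unfolding M_def by (intro less_cSupD) auto
    then show ?thesis by (auto simp: Q_def)
  qed
  then obtain f where f: "\<And>n. f n \<in> K" "\<And>n. nrm (f n) = 1" "\<And>n. M - 1 / Suc n < Re (ip (T (f n)) (f n))"
    by metis
  have fH: "f n \<in> H" for n using f(1) KH by simp
  have Bf: "Re (B (f n) (f n)) \<le> 1 / Suc n" for n
    using f(2,3)[of n] nrm_sq[OF fH[of n]] by (simp add: B_def)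
  have res0: "(\<lambda>n. nrm (scale (of_real M) (f n) - T (f n))) \<longlonglongrightarrow> 0"
  proof -
    have "(\<lambda>n. (nrm (scale (of_real M) (f n) - T (f n)))\<^sup>2) \<longlonglongrightarrow> 0"
    proof (rule Lim_null_comparison)
      show "\<forall>\<^sub>F n in sequentially. norm ((nrm (scale (of_real M) (f n) - T (f n)))\<^sup>2) \<le> (M + C) * (1 / Suc n)"
      proof (intro always_eventually allI)
        fix n
        have "(nrm (scale (of_real M) (f n) - T (f n)))\<^sup>2 \<le> (M + C) * Re (B (f n) (f n))"
          using resid f(1) .
        also have "\<dots> \<le> (M + C) * (1 / Suc n)" using Bf Mpos C(1) by (intro mult_left_mono) auto
        finally show "norm ((nrm (scale (of_real M) (f n) - T (f n)))\<^sup>2) \<le> (M + C) * (1 / Suc n)" by simp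
      qed
      show "(\<lambda>n. (M + C) * (1 / Suc n)) \<longlonglongrightarrow> 0"
        by (intro tendsto_mult_right_zero lim_1_over_n[THEN LIMSEQ_Suc, unfolded o_def])
    qed
    from tendsto_real_sqrt[OF this] show ?thesis by (simp add: nrm_nonneg fH)
  qed
  obtain r z where r: "strict_mono r" "z \<in> H" "(\<lambda>n. nrm (T (f (r n)) - z)) \<longlonglongrightarrow> 0"
    using T_compact[where fs=f and B=1] fH f(2) by auto
  define u where "u = (\<lambda>n. scale (of_real M) (f (r n)))"
  have uH: "u n \<in> H" for n by (simp add: u_def fH)
  have uz: "(\<lambda>n. nrm (u n - z)) \<longlonglongrightarrow> 0"
  proof (rule Lim_null_comparison)
    show "\<forall>\<^sub>F n in sequentially. norm (nrm (u n - z)) \<le> nrm (u n - T (f (r n))) + nrm (T (f (r n)) - z)"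
    proof (intro always_eventually allI)
      fix n
      show "norm (nrm (u n - z)) \<le> nrm (u n - T (f (r n))) + nrm (T (f (r n)) - z)"
        using nrm_triangle[of "u n - T (f (r n))" "T (f (r n)) - z"] uH r(2) fH by (simp add: nrm_nonneg)
    qed
    show "(\<lambda>n. nrm (u n - T (f (r n))) + nrm (T (f (r n)) - z)) \<longlonglongrightarrow> 0"
      using tendsto_add[OF LIMSEQ_subseq_LIMSEQ[OF res0 r(1)] r(3)] by (simp add: u_def o_def)
  qed
  have zG: "ip z g = 0" if "g \<in> G" for g
  proof -
    have "(\<lambda>n. ip (u n) g) \<longlonglongrightarrow> ip z g" using ip_tendsto_zero uH r(2) G that uz by blast
    moreover have "ip (u n) g = 0" for n
      using f(1)[of "r n"] that fH G by (simp add: u_def ip_scale K_def)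
    ultimately show ?thesis by (simp add: LIMSEQ_const_iff)
  qed
  have "nrm (u n) = M" for n using f(2) fH Mpos by (simp add: u_def nrm_scale)
  then have nz: "nrm z = M" using nrm_tendsto[OF uH r(2) uz] by (simp add: LIMSEQ_const_iff)
  \<comment> \<open>\<open>d\<close> has length 0 without having to be 0; one more application of
    \<open>T\<close> removes it by \<open>T_null\<close>. The vector \<open>T z\<close> is not null
    because \<open>z\<close> has length \<open>M\<close>.\<close>
  define d where "d = T z - scale (of_real M) z"
  have dH: "d \<in> H" using r(2) by (simp add: d_def)
  have "nrm d \<le> C * nrm (u n - z) + M * nrm (T (f (r n)) - z)" for n
  proof -
    have "d = T (z - u n) + scale (of_real M) (T (f (r n)) - z)"
      using r(2) uH fH by (simp add: d_def u_def T_diff T_scale scale_right_diff_distrib)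
    then have "nrm d \<le> nrm (T (z - u n)) + nrm (scale (of_real M) (T (f (r n)) - z))"
      using nrm_triangle r(2) uH fH by simp
    also have "\<dots> \<le> C * nrm (z - u n) + M * nrm (T (f (r n)) - z)"
      using C(2) r(2) uH fH Mpos by (intro add_mono) (auto simp: nrm_scale)
    finally show ?thesis using nrm_minus_commute[OF r(2) uH[of n]] by simp
  qed
  moreover have "(\<lambda>n. C * nrm (u n - z) + M * nrm (T (f (r n)) - z)) \<longlonglongrightarrow> C * 0 + M * 0"
    by (intro tendsto_intros uz r(3))
  ultimately have "nrm d \<le> 0" using LIMSEQ_le_const[of _ "C * 0 + M * 0" "nrm d"] by auto
  then have "nrm d = 0" using nrm_nonneg[OF dH] by simp
  then have "T d = 0" using T_null[OF dH] ip_self[OF dH] by simp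
  then have eig: "T (T z) = scale (of_real M) (T z)"
    using r(2) by (simp add: d_def T_diff T_scale)
  have "nrm (T z) = M * M"
  proof -
    have "\<bar>nrm (T z) - nrm (scale (of_real M) z)\<bar> \<le> nrm d"
      unfolding d_def using r(2) by (intro nrm_diff_diff) auto
    then show ?thesis using \<open>nrm d = 0\<close> r(2) nz Mpos by (simp add: nrm_scale)
  qed
  moreover have "\<forall>g\<in>G. ip (T z) g = 0"
    using TK[of z] r(2) zG by (auto simp: K_def)
  moreover have "Re (ip (T v) v) \<le> M * (nrm v)\<^sup>2" using form_le[OF vK] .
  ultimately show ?thesis using Mpos eig r(2) by (intro exI[of _ M] exI[of _ "T z"]) auto
qed

end

lemma (in vector_space) pos_indexingD:
  assumes "pos_indexing E I lam"
  shows "\<And>i m. \<lbrakk>i \<in> I; 0 < m; m \<le> i\<rbrakk> \<Longrightarrow> m \<in> I"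
    and "\<And>i. i \<in> I \<Longrightarrow> 0 < lam i \<longleftrightarrow> 0 < i"
    and "\<And>i j. \<lbrakk>i \<in> I; j \<in> I; i \<le> j\<rbrakk> \<Longrightarrow> lam i \<le> lam j"
    and "\<And>\<mu>. 0 < \<mu> \<Longrightarrow> finite {k\<in>I. lam k = \<mu>}"
    and "\<And>\<mu>. 0 < \<mu> \<Longrightarrow> dim (E \<mu>) = card {k\<in>I. lam k = \<mu>}"
    and "\<And>\<mu>. 0 < \<mu> \<Longrightarrow> \<exists>B. finite B \<and> E \<mu> \<subseteq> span B"
  proof -
  note * = assms[unfolded pos_indexing_def]
  show "\<And>i m. \<lbrakk>i \<in> I; 0 < m; m \<le> i\<rbrakk> \<Longrightarrow> m \<in> I" using *[THEN conjunct1] by blast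
  show "\<And>i. i \<in> I \<Longrightarrow> 0 < lam i \<longleftrightarrow> 0 < i" using *[THEN conjunct2, THEN conjunct1] by blast
  show "\<And>i j. \<lbrakk>i \<in> I; j \<in> I; i \<le> j\<rbrakk> \<Longrightarrow> lam i \<le> lam j"
    using *[THEN conjunct2, THEN conjunct2, THEN conjunct1] by (rule mono_onD)
  note ** = *[THEN conjunct2, THEN conjunct2, THEN conjunct2, rule_format]
  show "\<And>\<mu>. 0 < \<mu> \<Longrightarrow> finite {k\<in>I. lam k = \<mu>}" using ** by blast
  show "\<And>\<mu>. 0 < \<mu> \<Longrightarrow> dim (E \<mu>) = card {k\<in>I. lam k = \<mu>}" using ** by metis
  show "\<And>\<mu>. 0 < \<mu> \<Longrightarrow> \<exists>B. finite B \<and> E \<mu> \<subseteq> span B" using ** by blast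
qed

context compact_symmetric
begin

text \<open>Otherwise fewer than \<open>k\<close> indices have \<open>m * lam i \<le> 1\<close>, and
  bases of the corresponding eigenspaces may serve as constraints. The test vector then forces
  another eigenvector with eigenvalue \<open>M\<close> of \<open>T\<close>,
  \<open>m \<le> M\<close>; its index is among those already counted, so it is orthogonal to the
  very basis that spans it. Positivity of the form is demanded separately, so that
  \<open>m = 0\<close> still gives the existence of the index \<open>k\<close>.\<close>

lemma courant_fischer_upper:
  assumes idx: "pos_indexing (\<lambda>\<mu>. eig T H (of_real \<mu>)) I lam"
    and k: "0 < k" and m: "0 \<le> m"
    and test: "\<And>G. \<lbrakk>finite G; G \<subseteq> H; card G < nat k\<rbrakk> \<Longrightarrow>
      \<exists>v\<in>H. (\<forall>g\<in>G. ip v g = 0) \<and> 0 < Re (ip (T v) v) \<and> m * (nrm v)\<^sup>2 \<le> Re (ip (T v) v)"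
  shows "k \<in> I \<and> m * lam k \<le> 1"
proof (rule ccontr)
  assume contra: "\<not> (k \<in> I \<and> m * lam k \<le> 1)"
  note idxD = pos_indexingD[OF idx]
  define R where "R = {i \<in> I. 0 < i \<and> m * lam i \<le> 1}"
  \<comment> \<open>An index \<open>i \<ge> k\<close> in \<open>R\<close> would put \<open>k\<close>
    into \<open>I\<close>, by the initial segment property, and give
    \<open>m * lam k \<le> 1\<close> by monotonicity.\<close>
  have "R \<subseteq> {0<..<k}"
  proof
    fix i assume i: "i \<in> R"
    show "i \<in> {0<..<k}"
    proof (rule ccontr)
      assume "i \<notin> {0<..<k}"
      then have ki: "k \<le> i" using i by (auto simp: R_def)
      then have kI: "k \<in> I" using i k idxD(1)[of i k] by (auto simp: R_def)
      then have "lam k \<le> lam i" using ki i idxD(3) by (auto simp: R_def)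
      then have "m * lam k \<le> m * lam i" using m by (rule mult_left_mono)
      then show False using kI contra i by (simp add: R_def)
    qed
  qed
  then have finR: "finite R" and cardR: "card R < nat k"
  proof -
    assume *: "R \<subseteq> {0<..<k}"
    then show "finite R" using finite_subset by blast
    have "card R \<le> card {0<..<k}" using * by (intro card_mono) auto
    then show "card R < nat k" using k by simp
  qed
  have "\<exists>B. B \<subseteq> eig T H (of_real \<mu>) \<and> eig T H (of_real \<mu>) \<subseteq> span B \<and>
      card B = card {i\<in>I. lam i = \<mu>} \<and> finite B" if "0 < \<mu>" for \<mu> :: real
  proof -
    obtain B0 where "finite B0" "eig T H (of_real \<mu>) \<subseteq> span B0" using idxD(6)[OF \<open>0 < \<mu>\<close>] by blast
    then obtain B where "B \<subseteq> eig T H (of_real \<mu>)" "eig T H (of_real \<mu>) \<subseteq> span B"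
      "card B = dim (eig T H (of_real \<mu>))" "finite B" by (rule finite_basis) blast
    then show ?thesis using idxD(5)[OF \<open>0 < \<mu>\<close>] by auto
  qed
  then have "\<forall>\<mu>::real. \<exists>B. 0 < \<mu> \<longrightarrow> B \<subseteq> eig T H (of_real \<mu>) \<and> eig T H (of_real \<mu>) \<subseteq> span B \<and>
      card B = card {i\<in>I. lam i = \<mu>} \<and> finite B" by blast
  from choice[OF this] obtain Bs where Bs: "\<And>\<mu>::real. 0 < \<mu> \<Longrightarrow> Bs \<mu> \<subseteq> eig T H (of_real \<mu>) \<and> eig T H (of_real \<mu>) \<subseteq> span (Bs \<mu>) \<and>
      card (Bs \<mu>) = card {i\<in>I. lam i = \<mu>} \<and> finite (Bs \<mu>)" by blast
  define G where "G = (\<Union>\<mu>\<in>lam ` R. Bs \<mu>)"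
  have posR: "0 < \<mu>" if "\<mu> \<in> lam ` R" for \<mu> using that idxD(2) by (auto simp: R_def)
  have finG: "finite G" unfolding G_def using finR posR Bs by blast
  have Bs_eig: "g \<in> H \<and> scale (of_real \<mu>) (T g) = g" if "\<mu> \<in> lam ` R" "g \<in> Bs \<mu>" for g \<mu>
  proof -
    have "g \<in> eig T H (of_real \<mu>)" using Bs[OF posR[OF that(1)]] that(2) by blast
    then show ?thesis by (simp add: eig_def)
  qed
  then have GH: "G \<subseteq> H" unfolding G_def by blast
  \<comment> \<open>Membership in \<open>R\<close> depends on \<open>i\<close> only through
    \<open>lam i\<close>, so each eigenvalue that occurs brings all its indices; summing the
    multiplicities over distinct values gives \<open>card R\<close>.\<close>
  have "card G \<le> (\<Sum>\<mu>\<in>lam ` R. card (Bs \<mu>))"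
    unfolding G_def using finR by (intro card_UN_le) auto
  also have "\<dots> = (\<Sum>\<mu>\<in>lam ` R. card {i \<in> R. lam i = \<mu>})"
  proof (rule sum.cong)
    fix \<mu> assume \<mu>: "\<mu> \<in> lam ` R"
    then have "{i\<in>I. lam i = \<mu>} = {i \<in> R. lam i = \<mu>}"
    proof -
      have "i \<in> R" if "i \<in> I" "lam i = \<mu>" for i
        using posR[OF \<mu>] idxD(2)[OF that(1)] that \<mu> by (auto simp: R_def)
      then show ?thesis by (auto simp: R_def)
    qed
    then show "card (Bs \<mu>) = card {i \<in> R. lam i = \<mu>}" using Bs posR[OF \<mu>] by simp
  qed simp
  also have "\<dots> = card R"
    using sum.image_gen[OF finR, of "\<lambda>_. 1::nat" lam] by simp
  finally have "card G < nat k" using cardR by simp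
  from test[OF finG GH this] obtain v where v: "v \<in> H" "\<And>g. g \<in> G \<Longrightarrow> ip v g = 0"
    "0 < Re (ip (T v) v)" "m * (nrm v)\<^sup>2 \<le> Re (ip (T v) v)" by blast
  have Geig: "g \<in> H \<and> (\<exists>\<nu>. T g = scale \<nu> g)" if gG: "g \<in> G" for g
  proof -
    obtain \<mu> where \<mu>: "\<mu> \<in> lam ` R" "g \<in> Bs \<mu>" using gG unfolding G_def by (metis UN_iff)
    then have "g \<in> H" "scale (of_real \<mu>) (T g) = g" using Bs_eig by blast+
    moreover have "scale (of_real (1/\<mu>)) (scale (of_real \<mu>) (T g)) = T g"
      using posR[OF \<mu>(1)] by simp
    ultimately show ?thesis by metis
  qed
  obtain M y where My: "Re (ip (T v) v) \<le> M * (nrm v)\<^sup>2" "0 < M" "y \<in> H" "\<And>g. g \<in> G \<Longrightarrow> ip y g = 0"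
    "T y = scale (of_real M) y" "0 < nrm y"
    using eigenvector_exists[OF Geig v(1-3)] by blast
  have yE: "y \<in> eig T H (of_real (1/M))"
    using My by (simp add: eig_def)
  have "Bs (1/M) \<noteq> {}"
  proof
    assume "Bs (1/M) = {}"
    then have "y = 0" using Bs[of "1/M"] My(2) yE by auto
    then show False using My(6) by (simp add: nrm_def)
  qed
  then have "card {i\<in>I. lam i = 1/M} \<noteq> 0" using Bs[of "1/M"] My(2) by auto
  then have "{i\<in>I. lam i = 1/M} \<noteq> {}" by (metis card.empty)
  then obtain i where i: "i \<in> I" "lam i = 1/M" by auto
  have "0 < nrm v"
    using v(3) My(1) nrm_nonneg[OF v(1)] by (cases "nrm v = 0") auto
  moreover have "m * (nrm v)\<^sup>2 \<le> M * (nrm v)\<^sup>2" using v(4) My(1) by linarith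
  ultimately have "m \<le> M" by simp
  then have "m * lam i \<le> 1" unfolding i(2) using My(2) by simp
  moreover have "0 < i" using i My(2) idxD(2)[OF i(1)] by simp
  ultimately have "i \<in> R" using i by (simp add: R_def)
  then have "Bs (1/M) \<subseteq> G" using i by (force simp: G_def)
  \<comment> \<open>The contradiction: \<open>y\<close> is in the span of vectors of
    \<open>G\<close> and orthogonal to each of them, yet has positive length.\<close>
  have "y \<in> span (Bs (1/M))" using yE Bs[of "1/M"] My(2) by auto
  moreover have "subspace {x\<in>H. ip x y = 0}"
    using My(3) by (intro subspaceI) (auto simp: ip_add ip_scale)
  moreover have "x \<in> {x\<in>H. ip x y = 0}" if "x \<in> Bs (1/M)" for x
  proof -
    have "x \<in> G" "x \<in> H" using \<open>Bs (1/M) \<subseteq> G\<close> GH that by auto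
    then show ?thesis using My(4)[of x] ip_sym[OF My(3), of x] by simp
  qed
  ultimately have "ip y y = 0" using span_minimal[of "Bs (1/M)" "{x\<in>H. ip x y = 0}"] by blast
  then show False using My(6) by (simp add: nrm_def)
qed

lemma eig_orthogonal:
  assumes "x \<in> eig T H (of_real \<mu>)" "y \<in> eig T H (of_real \<nu>)" "\<mu> \<noteq> \<nu>"
  shows "ip x y = 0"
proof -
  have H: "x \<in> H" "y \<in> H" "scale (of_real \<mu>) (T x) = x" "scale (of_real \<nu>) (T y) = y"
    using assms by (auto simp: eig_def)
  have "ip x y = of_real \<mu> * ip (T x) y" using H ip_scale[of "T x" y "of_real \<mu>"] by simp
  moreover have "ip x y = of_real \<nu> * ip (T x) y"
    using H ip_scale_right[of x "T y" "of_real \<nu>"] T_sym[of x y] by simp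
  ultimately have "of_real \<mu> * ip (T x) y = of_real \<nu> * ip (T x) y" by (rule trans[OF sym])
  then have "ip (T x) y = 0" using assms(3) by simp
  then show ?thesis using \<open>ip x y = of_real \<mu> * ip (T x) y\<close> by simp
qed

text \<open>Orthonormal bases of the eigenspaces for the values \<open>lam 1, ..., lam k\<close> are
  jointly orthonormal, as different eigenspaces are orthogonal, and contain at least
  \<open>k\<close> vectors.\<close>

lemma courant_fischer_lower:
  assumes idx: "pos_indexing (\<lambda>\<mu>. eig T H (of_real \<mu>)) I lam"
    and k: "0 < k" "k \<in> I"
  shows "\<exists>F\<subseteq>H. finite F \<and> card F = nat k \<and> (\<forall>e\<in>F. \<forall>f\<in>F. ip e f = (if e = f then 1 else 0)) \<and>
    (\<forall>e\<in>F. \<exists>\<nu>. 1 / lam k \<le> \<nu> \<and> T e = scale (of_real \<nu>) e)"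
proof -
  note idxD = pos_indexingD[OF idx]
  have ex: "\<exists>F\<subseteq>eig T H (of_real \<mu>). finite F \<and> card F = card {i\<in>I. lam i = \<mu>} \<and>
     (\<forall>e\<in>F. \<forall>f\<in>F. ip e f = (if e = f then 1 else 0))" if "0 < \<mu>" for \<mu> :: real
  proof -
    have subE: "subspace (eig T H (of_real \<mu>))"
    proof (intro subspaceI)
      fix c x assume "x \<in> eig T H (of_real \<mu>)"
      then show "scale c x \<in> eig T H (of_real \<mu>)"
        using scale_left_commute[of "of_real \<mu>" c "T x"] by (simp add: eig_def T_scale del: scale_scale)
    qed (simp_all add: eig_def T_add scale_right_distrib)
    obtain B0 where "finite B0" "eig T H (of_real \<mu>) \<subseteq> span B0" using idxD(6)[OF \<open>0 < \<mu>\<close>] by blast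
    then obtain B where B: "B \<subseteq> eig T H (of_real \<mu>)" "independent B" "card B = dim (eig T H (of_real \<mu>))" "finite B"
      by (rule finite_basis) blast
    then have sB: "span B \<subseteq> eig T H (of_real \<mu>)" using subE span_minimal by blast
    \<comment> \<open>On an eigenspace the inner product is definite: a null vector satisfies
      \<open>T y = 0\<close> by \<open>T_null\<close>, and \<open>y\<close> is a multiple of
      \<open>T y\<close>.\<close>
    have "y = 0" if "y \<in> span B" "ip y y = 0" for y
      using that sB T_null[of y] by (force simp: eig_def)
    moreover have "B \<subseteq> H" using B(1) by (auto simp: eig_def)
    ultimately obtain F where "F \<subseteq> span B" "finite F" "card F = card B"
      "\<forall>e\<in>F. \<forall>f\<in>F. ip e f = (if e = f then 1 else 0)"
      using orthonormal_basis_exists[OF B(4,2)] by blast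
    then show ?thesis using sB B(3) idxD(5)[OF \<open>0 < \<mu>\<close>] by (intro exI[of _ F]) auto
  qed
  have "\<forall>\<mu>::real. \<exists>F. 0 < \<mu> \<longrightarrow> F \<subseteq> eig T H (of_real \<mu>) \<and> finite F \<and>
     card F = card {i\<in>I. lam i = \<mu>} \<and> (\<forall>e\<in>F. \<forall>f\<in>F. ip e f = (if e = f then 1 else 0))"
  proof
    fix \<mu> :: real
    show "\<exists>F. 0 < \<mu> \<longrightarrow> F \<subseteq> eig T H (of_real \<mu>) \<and> finite F \<and>
     card F = card {i\<in>I. lam i = \<mu>} \<and> (\<forall>e\<in>F. \<forall>f\<in>F. ip e f = (if e = f then 1 else 0))"
    proof (cases "0 < \<mu>")
      case True
      from ex[OF True] obtain F where "F \<subseteq> eig T H (of_real \<mu>) \<and> finite F \<and>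
     card F = card {i\<in>I. lam i = \<mu>} \<and> (\<forall>e\<in>F. \<forall>f\<in>F. ip e f = (if e = f then 1 else 0))" ..
      then show ?thesis by (intro exI[of _ F] impI)
    qed simp
  qed
  from choice[OF this] obtain Fs where "\<forall>\<mu>::real. 0 < \<mu> \<longrightarrow> Fs \<mu> \<subseteq> eig T H (of_real \<mu>) \<and> finite (Fs \<mu>) \<and>
     card (Fs \<mu>) = card {i\<in>I. lam i = \<mu>} \<and> (\<forall>e\<in>Fs \<mu>. \<forall>f\<in>Fs \<mu>. ip e f = (if e = f then 1 else 0))" ..
  note Fs = this[THEN spec, THEN mp]
  define R where "R = {0<..k}"
  have RI: "R \<subseteq> I" using k idxD(1)[of k] by (auto simp: R_def)
  have posR: "0 < \<mu>" if "\<mu> \<in> lam ` R" for \<mu> using that idxD(2) RI by (force simp: R_def)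
  have leR: "\<mu> \<le> lam k" if "\<mu> \<in> lam ` R" for \<mu> using that idxD(3) RI k(2) by (auto simp: R_def)
  define G where "G = (\<Union>\<mu>\<in>lam ` R. Fs \<mu>)"
  have ons: "ip e f = (if e = f then 1 else 0)" if ef: "e \<in> G" "f \<in> G" for e f
  proof -
    obtain \<mu> \<nu> where \<mu>\<nu>: "\<mu> \<in> lam ` R" "e \<in> Fs \<mu>" "\<nu> \<in> lam ` R" "f \<in> Fs \<nu>"
      using ef unfolding G_def by (metis UN_iff)
    show ?thesis
    proof (cases "\<mu> = \<nu>")
      case True
      then show ?thesis using \<mu>\<nu> Fs posR by blast
    next
      case False
      have "e \<in> eig T H (of_real \<mu>)" "f \<in> eig T H (of_real \<nu>)" using \<mu>\<nu> Fs posR by blast+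
      then have "ip e f = 0" using False by (rule eig_orthogonal)
      moreover have "ip e e = 1" using Fs[OF posR[OF \<mu>\<nu>(1)]] \<mu>\<nu>(2) by auto
      then have "e \<noteq> f" using \<open>ip e f = 0\<close> by auto
      ultimately show ?thesis by simp
    qed
  qed
  have "card G = (\<Sum>\<mu>\<in>lam ` R. card (Fs \<mu>))"
    unfolding G_def
  proof (rule card_UN_disjoint)
    show "\<forall>\<mu>\<in>lam ` R. \<forall>\<nu>\<in>lam ` R. \<mu> \<noteq> \<nu> \<longrightarrow> Fs \<mu> \<inter> Fs \<nu> = {}"
    proof (intro ballI impI equals0I)
      fix \<mu> \<nu> e assume h: "\<mu> \<in> lam ` R" "\<nu> \<in> lam ` R" "\<mu> \<noteq> \<nu>" "e \<in> Fs \<mu> \<inter> Fs \<nu>"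
      have "e \<in> eig T H (of_real \<mu>)" "e \<in> eig T H (of_real \<nu>)"
        using Fs[OF posR[OF h(1)]] Fs[OF posR[OF h(2)]] h(4) by blast+
      then have "ip e e = 0" using h(3) by (rule eig_orthogonal)
      moreover have "ip e e = 1" using Fs[OF posR[OF h(1)]] h(4) by auto
      ultimately show False by simp
    qed
  qed (use Fs posR in \<open>auto simp: R_def\<close>)
  also have "\<dots> = (\<Sum>\<mu>\<in>lam ` R. card {i\<in>I. lam i = \<mu>})"
    using Fs posR by (intro sum.cong) auto
  \<comment> \<open>Only an inequality: the eigenspace of \<open>lam k\<close> may carry indices
    beyond \<open>k\<close>. Hence a subset of size exactly \<open>k\<close> is cut out
    below.\<close>
  also have "\<dots> \<ge> (\<Sum>\<mu>\<in>lam ` R. card {i \<in> R. lam i = \<mu>})"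
    using RI idxD(4) posR by (intro sum_mono card_mono) auto
  also have "(\<Sum>\<mu>\<in>lam ` R. card {i \<in> R. lam i = \<mu>}) = card R"
    using sum.image_gen[of R "\<lambda>_. 1::nat" lam] by (simp add: R_def)
  finally have "nat k \<le> card G" by (simp add: R_def)
  then obtain F where F: "F \<subseteq> G" "card F = nat k" by (meson obtain_subset_with_card_n)
  have "finite F" using F(2) k(1) by (metis card.infinite less_irrefl zero_less_nat_eq)
  have Geig: "\<exists>\<mu>. \<mu> \<in> lam ` R \<and> e \<in> eig T H (of_real \<mu>)" if eG: "e \<in> G" for e
  proof -
    obtain \<mu> where "\<mu> \<in> lam ` R" "e \<in> Fs \<mu>" using eG unfolding G_def by (metis UN_iff)
    then show ?thesis using Fs[OF posR] by blast
  qed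
  have "\<exists>\<nu>. 1 / lam k \<le> \<nu> \<and> T e = scale (of_real \<nu>) e" if e: "e \<in> F" for e
  proof -
    obtain \<mu> where \<mu>: "\<mu> \<in> lam ` R" "e \<in> eig T H (of_real \<mu>)" using Geig e F(1) by blast
    have "scale (of_real \<mu>) (T e) = e" using \<mu>(2) by (simp add: eig_def)
    moreover have "T e = scale (of_real (1/\<mu>)) (scale (of_real \<mu>) (T e))"
      using posR[OF \<mu>(1)] by simp
    ultimately have "T e = scale (of_real (1/\<mu>)) e" by (simp only:)
    moreover have "1 / lam k \<le> 1 / \<mu>" using leR[OF \<mu>(1)] posR[OF \<mu>(1)] by (intro divide_left_mono) auto
    ultimately show ?thesis by blast
  qed
  moreover have "F \<subseteq> H" using F(1) Geig unfolding eig_def by blast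
  ultimately show ?thesis
    using \<open>finite F\<close> F ons by (intro exI[of _ F]) blast
qed

lemma orthonormal_combination:
  assumes F: "finite F" "F \<subseteq> H" "\<And>e f. e \<in> F \<Longrightarrow> f \<in> F \<Longrightarrow> ip e f = (if e = f then 1 else 0)"
  shows "ip (\<Sum>e\<in>F. scale (c e) e) (\<Sum>e\<in>F. scale (d e) e) = (\<Sum>e\<in>F. c e * cnj (d e))"
proof -
  have "ip (\<Sum>e\<in>F. scale (c e) e) (\<Sum>e\<in>F. scale (d e) e)
      = (\<Sum>e\<in>F. \<Sum>f\<in>F. c e * (cnj (d f) * ip e f))"
    using F(2)
    by (subst ip_sum, simp add: subset_iff, simp add: subset_iff H_sum)
       (intro sum.cong refl, subst ip_sum_right, auto simp: subset_iff ip_scale ip_scale_right sum_distrib_left mult_ac)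
  also have "\<dots> = (\<Sum>e\<in>F. \<Sum>f\<in>F. if f = e then c e * cnj (d f) else 0)"
    by (intro sum.cong refl) (use F(3) in auto)
  also have "\<dots> = (\<Sum>e\<in>F. c e * cnj (d e))" using F(1) by (simp add: sum.delta)
  finally show ?thesis .
qed

text \<open>By orthonormality the Rayleigh quotient of a combination is a weighted mean of the
  eigenvalues of \<open>T\<close> involved, hence at least their lower bound
  \<open>m\<close>.\<close>

lemma eigen_combination:
  assumes F: "finite F" "F \<subseteq> H" "\<And>e f. e \<in> F \<Longrightarrow> f \<in> F \<Longrightarrow> ip e f = (if e = f then 1 else 0)"
    and \<nu>: "\<And>e. e \<in> F \<Longrightarrow> \<exists>\<nu>. m \<le> \<nu> \<and> T e = scale (of_real \<nu>) e"
    and v: "v = (\<Sum>e\<in>F. scale (c e) e)"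
  shows "v \<in> H" "(nrm v)\<^sup>2 = (\<Sum>e\<in>F. (cmod (c e))\<^sup>2)"
    "m * (nrm v)\<^sup>2 \<le> Re (ip (T v) v)"
proof -
  show vH: "v \<in> H" using F(2) v by (auto intro!: H_sum)
  have ip: "ip v v = of_real (\<Sum>e\<in>F. (cmod (c e))\<^sup>2)"
    unfolding v of_real_sum complex_norm_square by (rule orthonormal_combination[OF F])
  show sq: "(nrm v)\<^sup>2 = (\<Sum>e\<in>F. (cmod (c e))\<^sup>2)" using vH ip by (simp add: nrm_sq)
  obtain n where n: "\<And>e. e \<in> F \<Longrightarrow> m \<le> n e \<and> T e = scale (of_real (n e)) e" using \<nu> by metis
  have Tv: "T v = (\<Sum>e\<in>F. scale (c e * of_real (n e)) e)"
    unfolding v using F(2) n by (subst T_sum) (auto simp: T_scale subset_iff intro!: sum.cong)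
  have "Re (ip (T v) v) = (\<Sum>e\<in>F. n e * (cmod (c e))\<^sup>2)"
  proof -
    have "ip (T v) v = (\<Sum>e\<in>F. of_real (n e) * (c e * cnj (c e)))"
    proof -
      have "ip (T v) v = (\<Sum>e\<in>F. c e * of_real (n e) * cnj (c e))"
        unfolding Tv unfolding v by (rule orthonormal_combination[OF F])
      then show ?thesis by (simp add: mult_ac)
    qed
    also have "\<dots> = of_real (\<Sum>e\<in>F. n e * (cmod (c e))\<^sup>2)"
      unfolding complex_norm_square[symmetric] by simp
    finally show ?thesis by simp
  qed
  also have "\<dots> \<ge> (\<Sum>e\<in>F. m * (cmod (c e))\<^sup>2)"
    using n by (intro sum_mono mult_right_mono) auto
  finally show "m * (nrm v)\<^sup>2 \<le> Re (ip (T v) v)" by (simp add: sq sum_distrib_left)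
qed

section \<open>Compressions by orthogonal projections\<close>

definition proj :: "('v \<Rightarrow> 'v) \<Rightarrow> bool" where
  "proj P \<longleftrightarrow> (\<forall>f\<in>H. P f \<in> H \<and> P (P f) = P f) \<and> (\<forall>f\<in>H. \<forall>g\<in>H. P (f + g) = P f + P g) \<and>
     (\<forall>f\<in>H. \<forall>c. P (scale c f) = scale c (P f)) \<and> (\<forall>f\<in>H. \<forall>g\<in>H. ip (P f) g = ip f (P g))"

lemma proj_nrm_le:
  assumes "proj P" "f \<in> H"
  shows "nrm (P f) \<le> nrm f"
proof -
  have P: "P f \<in> H" using assms by (auto simp: proj_def)
  have "ip (P f) (P f) = ip f (P f)" using assms P unfolding proj_def by metis
  then have "(nrm (P f))\<^sup>2 = Re (ip f (P f))" using P by (simp add: nrm_sq)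
  also have "\<dots> \<le> nrm f * nrm (P f)"
    using cauchy_schwarz[OF assms(2) P] complex_Re_le_cmod order_trans by blast
  finally have "nrm (P f) * nrm (P f) \<le> nrm f * nrm (P f)" by (simp add: power2_eq_square)
  then show ?thesis using nrm_nonneg[OF P] nrm_nonneg[OF assms(2)]
    by (cases "nrm (P f) = 0") (auto simp: mult_le_cancel_right)
qed

lemma proj_diff: "proj P \<Longrightarrow> f \<in> H \<Longrightarrow> g \<in> H \<Longrightarrow> P (f - g) = P f - P g"
proof -
  assume h: "proj P" "f \<in> H" "g \<in> H"
  have "P (f + scale (-1) g) = P f + scale (-1) (P g)" using h unfolding proj_def by (metis H_scale)
  then show ?thesis by simp
qed

lemma compact_symmetric_compression:
  assumes P: "proj P"
  shows "compact_symmetric scale {f \<in> H. P f = f} ip (\<lambda>f. P (T f))"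
proof -
  note PD = P[unfolded proj_def]
  have P0: "P 0 = 0" using proj_diff[OF P, of 0 0] by simp
  interpret S: semi_inner scale "{f \<in> H. P f = f}" ip
    by unfold_locales (use PD P0 in \<open>auto intro!: subspaceI simp: ip_add ip_scale ip_pos intro: ip_sym\<close>)
  show ?thesis
  proof
    fix f assume f: "f \<in> {f \<in> H. P f = f}"
    then show "P (T f) \<in> {f \<in> H. P f = f}" using PD by auto
    show "P (T (scale c f)) = scale c (P (T f))" for c using f PD by (simp add: T_scale)
    show "P (T f) = 0" if "ip f f = 0" using that f T_null P0 by simp
    fix g assume g: "g \<in> {f \<in> H. P f = f}"
    show "P (T (f + g)) = P (T f) + P (T g)" using f g PD by (simp add: T_add)
    have "ip (P (T f)) g = ip (T f) (P g)" using f g PD T_in by blast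
    also have "\<dots> = ip (P f) (T g)" using f g by (simp add: T_sym)
    also have "\<dots> = ip f (P (T g))" using f g PD T_in by blast
    finally show "ip (P (T f)) g = ip f (P (T g))" .
  next
    obtain C where C: "0 \<le> C" "\<And>f. f \<in> H \<Longrightarrow> nrm (T f) \<le> C * nrm f" using T_bdd by auto
    then show "\<exists>C\<ge>0. \<forall>f\<in>{f \<in> H. P f = f}. nrm (P (T f)) \<le> C * nrm f"
      using proj_nrm_le[OF P T_in] by (intro exI[of _ C]) (auto intro: order_trans)
  next
    fix fs :: "nat \<Rightarrow> 'v" and B
    assume fs: "\<And>n. fs n \<in> {f \<in> H. P f = f}" and B: "\<And>n. nrm (fs n) \<le> B"
    have fsH: "fs n \<in> H" for n using fs by auto
    obtain r :: "nat \<Rightarrow> nat" and z where r: "strict_mono r" "z \<in> H" "(\<lambda>n. nrm (T (fs (r n)) - z)) \<longlonglongrightarrow> 0"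
      using T_compact[where fs = fs and B = B, OF fsH B] by metis
    have "(\<lambda>n. nrm (P (T (fs (r n))) - P z)) \<longlonglongrightarrow> 0"
    proof (rule Lim_null_comparison[OF _ r(3)], intro always_eventually allI)
      fix n
      show "norm (nrm (P (T (fs (r n))) - P z)) \<le> nrm (T (fs (r n)) - z)"
        using proj_nrm_le[OF P, of "T (fs (r n)) - z"] proj_diff[OF P, of "T (fs (r n))" z] r(2) fsH PD
        by (simp add: nrm_nonneg)
    qed
    then show "\<exists>(r::nat\<Rightarrow>nat) z. strict_mono r \<and> z \<in> {f \<in> H. P f = f} \<and> (\<lambda>n. nrm (P (T (fs (r n))) - z)) \<longlonglongrightarrow> 0"
      using r PD by (intro exI[of _ r] exI[of _ "P z"]) auto
  qed
qed

text \<open>The forms of \<open>T\<close> and of the compression agree on the range of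
  \<open>P\<close>, so \<open>k\<close> eigenvectors of the compression span a space of test vectors
  for \<open>T\<close>; being of dimension \<open>k\<close>, it meets any \<open>k - 1\<close>
  orthogonality constraints. In terms of reciprocals, compression moves positive eigenvalues
  upwards.\<close>

lemma compression_eigenvalue_ge:
  assumes P: "proj P"
    and idx: "pos_indexing (\<lambda>\<mu>. eig T H (of_real \<mu>)) I lam"
    and idxP: "pos_indexing (\<lambda>\<mu>. eig (\<lambda>f. P (T f)) {f \<in> H. P f = f} (of_real \<mu>)) J lamP"
    and k: "0 < k" "k \<in> J"
  shows "k \<in> I \<and> lam k \<le> lamP k"
proof -
  interpret C: compact_symmetric scale "{f \<in> H. P f = f}" ip "\<lambda>f. P (T f)"
    by (rule compact_symmetric_compression[OF P])
  have pos: "0 < lamP k" using idxP k by (auto simp: pos_indexing_def)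
  obtain F where F: "F \<subseteq> {f \<in> H. P f = f}" "finite F" "card F = nat k"
    "\<And>e f. e \<in> F \<Longrightarrow> f \<in> F \<Longrightarrow> ip e f = (if e = f then 1 else 0)"
    "\<And>e. e \<in> F \<Longrightarrow> \<exists>\<nu>. 1 / lamP k \<le> \<nu> \<and> P (T e) = scale (of_real \<nu>) e"
    using C.courant_fischer_lower[OF idxP k] by blast
  have "k \<in> I \<and> (1 / lamP k) * lam k \<le> 1"
  proof (rule courant_fischer_upper[OF idx k(1)])
    fix G assume G: "finite G" "G \<subseteq> H" "card G < nat k"
    obtain c where c: "\<exists>e\<in>F. c e \<noteq> 0" "\<And>g. g \<in> G \<Longrightarrow> (\<Sum>e\<in>F. c e * ip e g) = 0"
      using homogeneous_system_nontrivial[OF G(1) F(2), of ip] G(3) F(3) by auto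
    define v where "v = (\<Sum>e\<in>F. scale (c e) e)"
    note v = C.eigen_combination[OF F(2,1,4,5) v_def]
    have vH: "v \<in> H" "P v = v" using v(1) by auto
    have "ip (P (T v)) v = ip (T v) v" using P vH unfolding proj_def by (metis T_in)
    then have form: "1 / lamP k * (nrm v)\<^sup>2 \<le> Re (ip (T v) v)" using v(3) by simp
    moreover have "0 < (nrm v)\<^sup>2" using v(2) c(1) F(2) by (auto intro: sum_pos2)
    then have "0 < 1 / lamP k * (nrm v)\<^sup>2" using pos by simp
    then have "0 < Re (ip (T v) v)" using form by linarith
    moreover have "ip v g = 0" if "g \<in> G" for g
    proof -
      have "ip v g = (\<Sum>e\<in>F. c e * ip e g)"
        unfolding v_def using F(1) G(2) that by (subst ip_sum) (auto simp: ip_scale subset_iff intro!: sum.cong)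
      then show ?thesis using c(2)[OF that] by simp
    qed
    ultimately show "\<exists>v\<in>H. (\<forall>g\<in>G. ip v g = 0) \<and> 0 < Re (ip (T v) v) \<and> 1 / lamP k * (nrm v)\<^sup>2 \<le> Re (ip (T v) v)"
      using vH by blast
  qed (use pos in auto)
  then show ?thesis using pos by (simp add: field_simps)
qed

text \<open>The bound missing after \<open>compression_eigenvalue_ge\<close> comes from projecting
  the first \<open>k\<close> eigenvectors of \<open>T\<close>. Strong convergence on these finitely
  many vectors is uniform on the unit ball of their span, so the projected span still has Rayleigh
  quotients at least \<open>m j\<close>, which tends to \<open>1 / lam k\<close>.\<close>

lemma compression_eigenvalue_tendsto:
  assumes P: "\<And>j. proj (P j)" and conv: "\<And>f. f \<in> H \<Longrightarrow> (\<lambda>j::nat. nrm (f - P j f)) \<longlonglongrightarrow> 0"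
    and idx: "pos_indexing (\<lambda>\<mu>. eig T H (of_real \<mu>)) I lam"
    and idxP: "\<And>j. pos_indexing (\<lambda>\<mu>. eig (\<lambda>f. P j (T f)) {f \<in> H. P j f = f} (of_real \<mu>)) (J j) (lamP j)"
    and k: "0 < k" "k \<in> I"
  shows "(\<forall>\<^sub>F j in sequentially. k \<in> J j) \<and> (\<lambda>j. lamP j k) \<longlonglongrightarrow> lam k"
proof -
  have PH: "P j f \<in> H" if "f \<in> H" for j f using P[of j] that by (auto simp: proj_def)
  have pos: "0 < lam k" using idx k by (auto simp: pos_indexing_def)
  obtain C where C: "0 \<le> C" "\<And>f. f \<in> H \<Longrightarrow> nrm (T f) \<le> C * nrm f" using T_bdd by auto
  obtain F where F: "F \<subseteq> H" "finite F" "card F = nat k"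
    "\<And>e f. e \<in> F \<Longrightarrow> f \<in> F \<Longrightarrow> ip e f = (if e = f then 1 else 0)"
    "\<And>e. e \<in> F \<Longrightarrow> \<exists>\<nu>. 1 / lam k \<le> \<nu> \<and> T e = scale (of_real \<nu>) e"
    using courant_fischer_lower[OF idx k] by blast
  define \<eta> where "\<eta> = (\<lambda>j. \<Sum>e\<in>F. nrm (e - P j e))"
  have \<eta>0: "\<eta> \<longlonglongrightarrow> 0"
    unfolding \<eta>_def using conv F(1) by (intro tendsto_null_sum) auto
  \<comment> \<open>The form of \<open>T\<close> on the span of \<open>F\<close> is at least
    \<open>1 / lam k\<close>. Replacing \<open>v\<close> by \<open>P j v\<close> alters it in two
    places, each time by at most \<open>C * \<eta> j\<close> relative to the square of the length of
    \<open>v\<close>.\<close>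
  define m where "m = (\<lambda>j. 1 / lam k - 2 * C * \<eta> j)"
  have m_lim: "m \<longlonglongrightarrow> 1 / lam k"
    unfolding m_def using tendsto_diff[OF tendsto_const tendsto_mult_right_zero[OF \<eta>0, of "2 * C"]] by simp
  have ev_m: "\<forall>\<^sub>F j in sequentially. 0 < m j" using order_tendstoD(1)[OF m_lim, of 0] pos by simp
  have key: "k \<in> J j \<and> m j * lamP j k \<le> 1" if mj: "0 < m j" for j
  proof -
    interpret C: compact_symmetric scale "{f \<in> H. P j f = f}" ip "\<lambda>f. P j (T f)"
      by (rule compact_symmetric_compression[OF P])
    show ?thesis
    proof (rule C.courant_fischer_upper[OF idxP k(1)])
      fix G assume G: "finite G" "G \<subseteq> {f \<in> H. P j f = f}" "card G < nat k"
      obtain c where c: "\<exists>e\<in>F. c e \<noteq> 0" "\<And>g. g \<in> G \<Longrightarrow> (\<Sum>e\<in>F. c e * ip e g) = 0"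
        using homogeneous_system_nontrivial[OF G(1) F(2), of ip] G(3) F(3) by auto
      define v where "v = (\<Sum>e\<in>F. scale (c e) e)"
      note v = eigen_combination[OF F(2,1,4,5) v_def]
      define t where "t = nrm v"
      have t0: "0 < t"
      proof -
        have "0 < (nrm v)\<^sup>2" using v(2) c(1) F(2) by (auto intro: sum_pos2)
        then show ?thesis using nrm_nonneg[OF v(1)] by (simp add: t_def less_le)
      qed
      define u where "u = P j v"
      have uH: "u \<in> H" "P j u = u" using P[of j] v(1) by (auto simp: u_def proj_def)
      have c_le: "cmod (c e) \<le> t" if "e \<in> F" for e
      proof -
        have "(cmod (c e))\<^sup>2 \<le> t\<^sup>2"
          using v(2) member_le_sum[OF that, of "\<lambda>e. (cmod (c e))\<^sup>2"] F(2) by (simp add: t_def)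
        then show ?thesis by (rule power2_le_imp_le) (use t0 in simp)
      qed
      have Pscale: "P j (scale a e) = scale a (P j e)" if "e \<in> H" for a e
        using P[of j] that by (simp add: proj_def)
      have Psum: "P j (\<Sum>e\<in>F'. scale (c e) e) = (\<Sum>e\<in>F'. scale (c e) (P j e))" if "F' \<subseteq> F" for F'
        using finite_subset[OF that F(2)] that
      proof (induction F' rule: finite_induct)
        case empty
        then show ?case using proj_diff[OF P, of 0 0] by simp
      next
        case (insert e F')
        have "P j (scale (c e) e + (\<Sum>e\<in>F'. scale (c e) e)) = P j (scale (c e) e) + P j (\<Sum>e\<in>F'. scale (c e) e)"
        proof -
          have "(\<Sum>e\<in>F'. scale (c e) e) \<in> H" using insert.prems F(1) by (intro H_sum) auto
          moreover have "scale (c e) e \<in> H" using insert.prems F(1) by auto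
          ultimately show ?thesis using P[of j] unfolding proj_def by blast
        qed
        then show ?case using insert F(1) Pscale by auto
      qed
      have diff_le: "nrm (v - u) \<le> t * \<eta> j"
      proof -
        have "v - u = (\<Sum>e\<in>F. scale (c e) (e - P j e))"
          unfolding u_def v_def Psum[OF order_refl] by (simp add: sum_subtractf scale_right_diff_distrib)
        moreover have "scale (c e) (e - P j e) \<in> H" if "e \<in> F" for e
          using that F(1) PH by (intro H_scale H_diff) auto
        ultimately have "nrm (v - u) \<le> (\<Sum>e\<in>F. nrm (scale (c e) (e - P j e)))"
          using nrm_sum[of F "\<lambda>e. scale (c e) (e - P j e)"] by simp
        also have "\<dots> = (\<Sum>e\<in>F. cmod (c e) * nrm (e - P j e))"
          using F(1) PH by (intro sum.cong) (auto simp: nrm_scale subset_iff)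
        also have "\<dots> \<le> (\<Sum>e\<in>F. t * nrm (e - P j e))"
          using c_le F(1) PH by (intro sum_mono mult_right_mono nrm_nonneg) auto
        finally show ?thesis by (simp add: \<eta>_def sum_distrib_left)
      qed
      have nu: "nrm u \<le> t" unfolding u_def t_def using proj_nrm_le[OF P v(1)] .
      have "\<bar>Re (ip (T v) v) - Re (ip (T u) u)\<bar> \<le> 2 * C * \<eta> j * t\<^sup>2"
      proof -
        \<comment> \<open>The difference of the forms is split so that each term contains the small
          vector \<open>v - u\<close>.\<close>
        have "ip (T v) v - ip (T u) u = ip (T (v - u)) v + ip (T u) (v - u)"
          using v(1) uH by (simp add: T_diff ip_diff ip_diff_right)
        moreover have "cmod (ip (T (v - u)) v) \<le> C * (t * \<eta> j) * t"
        proof -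
          have "cmod (ip (T (v - u)) v) \<le> nrm (T (v - u)) * t"
            unfolding t_def using v(1) uH by (intro cauchy_schwarz) auto
          also have "\<dots> \<le> C * nrm (v - u) * t" using C v(1) uH t0 by (intro mult_right_mono) auto
          also have "\<dots> \<le> C * (t * \<eta> j) * t" using C t0 diff_le by (intro mult_right_mono mult_left_mono) auto
          finally show ?thesis .
        qed
        moreover have "cmod (ip (T u) (v - u)) \<le> C * t * (t * \<eta> j)"
        proof -
          have "cmod (ip (T u) (v - u)) \<le> nrm (T u) * nrm (v - u)"
            using v(1) uH by (intro cauchy_schwarz) auto
          also have "\<dots> \<le> (C * t) * (t * \<eta> j)"
          proof (rule mult_mono)
            have "nrm (T u) \<le> C * nrm u" using C uH by simp
            also have "\<dots> \<le> C * t" using nu C by (intro mult_left_mono) auto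
            finally show "nrm (T u) \<le> C * t" .
          qed (use diff_le C t0 v(1) uH in \<open>auto intro: nrm_nonneg\<close>)
          finally show ?thesis .
        qed
        ultimately have "cmod (ip (T v) v - ip (T u) u) \<le> C * (t * \<eta> j) * t + C * t * (t * \<eta> j)"
          using norm_triangle_mono by metis
        also have "\<dots> = 2 * C * \<eta> j * t\<^sup>2" by (simp add: power2_eq_square)
        finally show ?thesis using abs_Re_le_cmod[of "ip (T v) v - ip (T u) u"] by simp
      qed
      then have form: "m j * t\<^sup>2 \<le> Re (ip (T u) u)"
        using v(3) by (simp add: m_def t_def algebra_simps)
      \<comment> \<open>The test vector \<open>u\<close> may be shorter than \<open>v\<close>, which
        only helps since \<open>m j\<close> is positive.\<close>
      have "(nrm u)\<^sup>2 \<le> t\<^sup>2" using nu uH nrm_nonneg by (intro power_mono) auto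
      then have "m j * (nrm u)\<^sup>2 \<le> m j * t\<^sup>2" using mj by simp
      with form have "m j * (nrm u)\<^sup>2 \<le> Re (ip (T u) u)" by linarith
      moreover have "0 < m j * t\<^sup>2" using mj t0 by simp
      then have "0 < Re (ip (T u) u)" using form by linarith
      moreover have "ip (P j (T u)) u = ip (T u) u" using P[of j] uH unfolding proj_def by (metis T_in)
      \<comment> \<open>The constraints lie in the range of \<open>P j\<close>, so pairing with
        \<open>u\<close> or with \<open>v\<close> gives the same; the coefficients could therefore
        be chosen before projecting.\<close>
      moreover have "ip u g = 0" if "g \<in> G" for g
      proof -
        have gH: "g \<in> H" "P j g = g" using that G by auto
        then have "ip u g = ip v g" using P[of j] v(1) unfolding u_def proj_def by metis
        also have "\<dots> = (\<Sum>e\<in>F. c e * ip e g)"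
          unfolding v_def using F(1) gH by (subst ip_sum) (auto simp: ip_scale subset_iff intro!: sum.cong)
        finally show ?thesis using c(2)[OF that] by simp
      qed
      ultimately show "\<exists>v\<in>{f \<in> H. P j f = f}. (\<forall>g\<in>G. ip v g = 0) \<and> 0 < Re (ip (P j (T v)) v) \<and>
          m j * (nrm v)\<^sup>2 \<le> Re (ip (P j (T v)) v)"
        using uH by (intro bexI[of _ u]) auto
    qed (use mj in auto)
  qed
  have "(\<lambda>j. lamP j k) \<longlonglongrightarrow> lam k"
  proof (rule tendsto_sandwich)
    show "\<forall>\<^sub>F j in sequentially. lam k \<le> lamP j k"
      using ev_m by eventually_elim (use compression_eigenvalue_ge[OF P idx idxP k(1)] key in blast)
    show "\<forall>\<^sub>F j in sequentially. lamP j k \<le> 1 / m j"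
      using ev_m by eventually_elim (use key in \<open>auto simp: field_simps\<close>)
    show "(\<lambda>j. 1 / m j) \<longlonglongrightarrow> lam k"
    proof -
      have "(\<lambda>j. 1 / m j) \<longlonglongrightarrow> 1 / (1 / lam k)"
        by (intro tendsto_divide tendsto_const m_lim) (use pos in auto)
      then show ?thesis by simp
    qed
  qed simp
  moreover have "\<forall>\<^sub>F j in sequentially. k \<in> J j"
    using ev_m by eventually_elim (use key in blast)
  ultimately show ?thesis by blast
qed

end

section \<open>Absolutely continuous functions\<close>

lemma abs_cont_onD:
  assumes "abs_cont_on c d f" "0 < \<epsilon>"
  obtains \<delta> where "0 < \<delta>" "\<And>D T. \<lbrakk>D division_of T; T \<subseteq> {c..d}; (\<Sum>K\<in>D. Sup K - Inf K) < \<delta>\<rbrakk> \<Longrightarrow>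
    (\<Sum>K\<in>D. cmod (f (Sup K) - f (Inf K))) < \<epsilon>"
  using assms unfolding abs_cont_on_def by meson

lemma abs_cont_on_continuous:
  assumes "abs_cont_on c d f"
  shows "continuous_on {c..d} f"
  unfolding continuous_on_iff
proof (intro ballI allI impI)
  fix x \<epsilon> :: real assume x: "x \<in> {c..d}" and "0 < \<epsilon>"
  obtain \<delta> where \<delta>: "0 < \<delta>" "\<And>D T. \<lbrakk>D division_of T; T \<subseteq> {c..d}; (\<Sum>K\<in>D. Sup K - Inf K) < \<delta>\<rbrakk> \<Longrightarrow>
    (\<Sum>K\<in>D. cmod (f (Sup K) - f (Inf K))) < \<epsilon>" by (fact abs_cont_onD[OF assms \<open>0 < \<epsilon>\<close>])
  have key: "cmod (f v - f u) < \<epsilon>" if "u \<in> {c..d}" "v \<in> {c..d}" "u \<le> v" "v - u < \<delta>" for u v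
  proof -
    have "{{u..v}} division_of {u..v}" using that division_of_self[of u v] by simp
    then have "(\<Sum>K\<in>{{u..v}}. cmod (f (Sup K) - f (Inf K))) < \<epsilon>"
      by (rule \<delta>(2)) (use that in auto)
    then show ?thesis using that by simp
  qed
  show "\<exists>\<delta>>0. \<forall>x'\<in>{c..d}. dist x' x < \<delta> \<longrightarrow> dist (f x') (f x) < \<epsilon>"
  proof (intro exI[of _ \<delta>] conjI ballI impI)
    fix x' assume "x' \<in> {c..d}" "dist x' x < \<delta>"
    then show "dist (f x') (f x) < \<epsilon>"
      using key[of x x'] key[of x' x] x by (cases "x \<le> x'") (auto simp: dist_norm norm_minus_commute)
  qed (rule \<delta>(1))
qed

text \<open>A single estimate of increments serves sums, multiples, products and changes of the
  function outside the interval.\<close>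

lemma abs_cont_on_dominated:
  assumes f: "abs_cont_on c d f" and g: "abs_cont_on c d g" and "0 \<le> M"
    and h: "\<And>u v. u \<in> {c..d} \<Longrightarrow> v \<in> {c..d} \<Longrightarrow> cmod (h v - h u) \<le> M * (cmod (f v - f u) + cmod (g v - g u))"
  shows "abs_cont_on c d h"
  unfolding abs_cont_on_def
proof (intro allI impI)
  fix \<epsilon> :: real assume "0 < \<epsilon>"
  \<comment> \<open>\<open>M + 1\<close> in place of \<open>M\<close> keeps the final inequality
    strict when \<open>M = 0\<close>.\<close>
  define \<epsilon>' where "\<epsilon>' = \<epsilon> / 2 / (M + 1)"
  have \<epsilon>': "0 < \<epsilon>'" using \<open>0 < \<epsilon>\<close> \<open>0 \<le> M\<close> by (simp add: \<epsilon>'_def)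
  obtain \<delta>1 where \<delta>1: "0 < \<delta>1" "\<And>D T. \<lbrakk>D division_of T; T \<subseteq> {c..d}; (\<Sum>K\<in>D. Sup K - Inf K) < \<delta>1\<rbrakk> \<Longrightarrow>
    (\<Sum>K\<in>D. cmod (f (Sup K) - f (Inf K))) < \<epsilon>'" by (fact abs_cont_onD[OF f \<epsilon>'])
  obtain \<delta>2 where \<delta>2: "0 < \<delta>2" "\<And>D T. \<lbrakk>D division_of T; T \<subseteq> {c..d}; (\<Sum>K\<in>D. Sup K - Inf K) < \<delta>2\<rbrakk> \<Longrightarrow>
    (\<Sum>K\<in>D. cmod (g (Sup K) - g (Inf K))) < \<epsilon>'" by (fact abs_cont_onD[OF g \<epsilon>'])
  show "\<exists>\<delta>>0. \<forall>D T. D division_of T \<and> T \<subseteq> {c..d} \<and> (\<Sum>K\<in>D. Sup K - Inf K) < \<delta> \<longrightarrow>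
        (\<Sum>K\<in>D. cmod (h (Sup K) - h (Inf K))) < \<epsilon>"
  proof (intro exI[of _ "min \<delta>1 \<delta>2"] conjI allI impI)
    fix D T assume D: "D division_of T \<and> T \<subseteq> {c..d} \<and> (\<Sum>K\<in>D. Sup K - Inf K) < min \<delta>1 \<delta>2"
    have "(\<Sum>K\<in>D. cmod (h (Sup K) - h (Inf K)))
        \<le> (\<Sum>K\<in>D. M * (cmod (f (Sup K) - f (Inf K)) + cmod (g (Sup K) - g (Inf K))))"
    proof (rule sum_mono)
      fix K assume K: "K \<in> D"
      then obtain u v where uv: "K = cbox u v" "K \<noteq> {}" "K \<subseteq> T"
        using D division_ofD by (metis (no_types))
      then have "u \<le> v" "Inf K = u" "Sup K = v" "u \<in> K" "v \<in> K" by auto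
      then have "Inf K \<in> {c..d}" "Sup K \<in> {c..d}" using D uv(3) by blast+
      then show "cmod (h (Sup K) - h (Inf K)) \<le> M * (cmod (f (Sup K) - f (Inf K)) + cmod (g (Sup K) - g (Inf K)))"
        by (intro h)
    qed
    also have "\<dots> = M * ((\<Sum>K\<in>D. cmod (f (Sup K) - f (Inf K))) + (\<Sum>K\<in>D. cmod (g (Sup K) - g (Inf K))))"
      by (simp add: sum.distrib flip: sum_distrib_left)
    also have "\<dots> \<le> M * (\<epsilon>' + \<epsilon>')"
      using \<open>0 \<le> M\<close> D \<delta>1(2)[of D T] \<delta>2(2)[of D T] by (intro mult_left_mono add_mono) auto
    also have "\<dots> < (M + 1) * (\<epsilon>' + \<epsilon>')" using \<epsilon>' by (intro mult_strict_right_mono) auto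
    also have "\<dots> = \<epsilon>"
    proof -
      have "\<epsilon>' + \<epsilon>' = \<epsilon> / (M + 1)" unfolding \<epsilon>'_def add_divide_distrib[symmetric] by simp
      then show ?thesis using \<open>0 \<le> M\<close> by simp
    qed
    finally show "(\<Sum>K\<in>D. cmod (h (Sup K) - h (Inf K))) < \<epsilon>" .
  qed (use \<delta>1 \<delta>2 in auto)
qed

lemma abs_cont_on_add:
  assumes "abs_cont_on c d f" "abs_cont_on c d g"
  shows "abs_cont_on c d (\<lambda>x. f x + g x)"
proof (rule abs_cont_on_dominated[OF assms, of 1])
  fix u v
  show "cmod (f v + g v - (f u + g u)) \<le> 1 * (cmod (f v - f u) + cmod (g v - g u))"
    using norm_triangle_ineq[of "f v - f u" "g v - g u"] by (simp add: algebra_simps)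
qed auto

lemma abs_cont_on_cmult:
  assumes "abs_cont_on c d f"
  shows "abs_cont_on c d (\<lambda>x. k * f x)"
proof (rule abs_cont_on_dominated[OF assms assms, of "cmod k"])
  fix u v
  have "cmod (k * f v - k * f u) = cmod k * cmod (f v - f u)"
    by (simp add: norm_mult[symmetric] algebra_simps)
  then show "cmod (k * f v - k * f u) \<le> cmod k * (cmod (f v - f u) + cmod (f v - f u))"
    by (simp add: mult_left_mono)
qed auto

lemma abs_cont_on_diff:
  assumes "abs_cont_on c d f" "abs_cont_on c d g"
  shows "abs_cont_on c d (\<lambda>x. f x - g x)"
  using abs_cont_on_add[OF assms(1) abs_cont_on_cmult[OF assms(2), of "-1"]] by simp

lemma abs_cont_on_cnj: "abs_cont_on c d f \<Longrightarrow> abs_cont_on c d (\<lambda>x. cnj (f x))"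
  unfolding abs_cont_on_def by (simp flip: complex_cnj_diff)

lemma abs_cont_on_mult:
  assumes f: "abs_cont_on c d f" and g: "abs_cont_on c d g"
  shows "abs_cont_on c d (\<lambda>x. f x * g x)"
proof -
  have "bounded (f ` {c..d})" "bounded (g ` {c..d})"
    using f g by (auto intro!: compact_imp_bounded compact_continuous_image abs_cont_on_continuous)
  then obtain A B where A: "\<And>x. x \<in> {c..d} \<Longrightarrow> cmod (f x) \<le> A" and B: "\<And>x. x \<in> {c..d} \<Longrightarrow> cmod (g x) \<le> B"
    unfolding bounded_iff by blast
  \<comment> \<open>The 0 covers an empty interval, where the bounds \<open>A\<close> and
    \<open>B\<close> may be negative.\<close>
  define M where "M = max 0 (max A B)"
  show ?thesis
  proof (rule abs_cont_on_dominated[OF f g, of M])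
    fix u v assume uv: "u \<in> {c..d}" "v \<in> {c..d}"
    have "f v * g v - f u * g u = f v * (g v - g u) + (f v - f u) * g u" by (simp add: algebra_simps)
    then have "cmod (f v * g v - f u * g u) \<le> cmod (f v) * cmod (g v - g u) + cmod (f v - f u) * cmod (g u)"
      by (metis norm_triangle_ineq norm_mult)
    also have "\<dots> \<le> M * cmod (g v - g u) + cmod (f v - f u) * M"
      using A[OF uv(2)] B[OF uv(1)] by (intro add_mono mult_right_mono mult_left_mono) (auto simp: M_def)
    finally show "cmod (f v * g v - f u * g u) \<le> M * (cmod (f v - f u) + cmod (g v - g u))"
      by (simp add: algebra_simps)
  qed (simp add: M_def)
qed

text \<open>The straddle lemma: as \<open>x\<close> lies between \<open>u\<close> and
  \<open>v\<close>, the errors at the two ends add up to exactly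
  \<open>\<epsilon> * (v - u)\<close>, which can be summed over a tagged division.\<close>

lemma has_vector_derivative_interval_bound:
  fixes f :: "real \<Rightarrow> complex"
  assumes "(f has_vector_derivative l) (at x within S)" "0 < \<epsilon>"
  shows "\<exists>\<delta>>0. \<forall>u v. u \<in> S \<longrightarrow> v \<in> S \<longrightarrow> u \<le> x \<longrightarrow> x \<le> v \<longrightarrow> {u..v} \<subseteq> ball x \<delta> \<longrightarrow>
     norm ((v - u) *\<^sub>R l - (f v - f u)) \<le> \<epsilon> * (v - u)"
proof -
  obtain \<delta> where \<delta>: "0 < \<delta>" "\<And>y. y \<in> S \<Longrightarrow> norm (y - x) < \<delta> \<Longrightarrow> norm (f y - f x - (y - x) *\<^sub>R l) \<le> \<epsilon> * norm (y - x)"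
    using assms unfolding has_vector_derivative_def has_derivative_within_alt by blast
  have "norm ((v - u) *\<^sub>R l - (f v - f u)) \<le> \<epsilon> * (v - u)"
    if h: "u \<in> S" "v \<in> S" "u \<le> x" "x \<le> v" "{u..v} \<subseteq> ball x \<delta>" for u v
  proof -
    have "u \<in> {u..v}" "v \<in> {u..v}" using h(3,4) by auto
    then have "u \<in> ball x \<delta>" "v \<in> ball x \<delta>" using h(5) by blast+
    then have *: "norm (u - x) < \<delta>" "norm (v - x) < \<delta>" by (auto simp: dist_norm norm_minus_commute)
    have "norm ((v - u) *\<^sub>R l - (f v - f u)) = norm (f u - f x - (u - x) *\<^sub>R l - (f v - f x - (v - x) *\<^sub>R l))"
      by (auto simp: algebra_simps)
    also have "\<dots> \<le> norm (f u - f x - (u - x) *\<^sub>R l) + norm (f v - f x - (v - x) *\<^sub>R l)"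
      by (rule norm_triangle_ineq4)
    also have "\<dots> \<le> \<epsilon> * norm (u - x) + \<epsilon> * norm (v - x)"
      using \<delta>(2)[OF h(1)] \<delta>(2)[OF h(2)] * by (intro add_mono) auto
    also have "\<dots> = \<epsilon> * (v - u)" using h by (simp add: algebra_simps)
    finally show ?thesis .
  qed
  then show ?thesis using \<delta>(1) by blast
qed

text \<open>On the exceptional null set the gauge is chosen inside an open set of small measure, so that
  absolute continuity bounds the increments over the subintervals tagged there.\<close>

lemma fundamental_theorem_abs_cont:
  assumes "c \<le> d" and ac: "abs_cont_on c d F"
    and deriv: "AE x in lebesgue. x \<in> {c..d} \<longrightarrow> (F has_vector_derivative f x) (at x within {c..d})"
  shows "(f has_integral (F d - F c)) {c..d}"
proof -
  obtain N where N: "N \<in> null_sets lebesgue"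
    "{x. \<not> (x \<in> {c..d} \<longrightarrow> (F has_vector_derivative f x) (at x within {c..d}))} \<subseteq> N"
    using deriv unfolding eventually_ae_filter by auto
  then have negN: "negligible N" by (simp add: negligible_iff_null_sets)
  define g where "g = (\<lambda>x. if x \<in> N then 0 else f x)"
  have "(g has_integral (F d - F c)) (cbox c d)"
    unfolding has_integral
  proof (intro allI impI)
    fix \<epsilon> :: real assume "0 < \<epsilon>"
    \<comment> \<open>Half of the tolerance is spread over the length of the interval; the summand 1
      allows \<open>c = d\<close>.\<close>
    define \<epsilon>1 where "\<epsilon>1 = \<epsilon> / (2 * (d - c + 1))"
    have \<epsilon>1: "0 < \<epsilon>1" "\<epsilon>1 * (d - c) \<le> \<epsilon> / 2"
      using \<open>0 < \<epsilon>\<close> \<open>c \<le> d\<close> by (auto simp: \<epsilon>1_def field_simps)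
    have half: "0 < \<epsilon> / 2" using \<open>0 < \<epsilon>\<close> by simp
    obtain \<delta> where \<delta>: "0 < \<delta>" "\<And>D T. \<lbrakk>D division_of T; T \<subseteq> {c..d}; (\<Sum>K\<in>D. Sup K - Inf K) < \<delta>\<rbrakk> \<Longrightarrow>
      (\<Sum>K\<in>D. cmod (F (Sup K) - F (Inf K))) < \<epsilon> / 2"
      by (fact abs_cont_onD[OF ac half])
    obtain U where U: "open U" "N \<subseteq> U" "U - N \<in> lmeasurable" "emeasure lebesgue (U - N) < ennreal \<delta>"
      using sets_lebesgue_outer_open[of N \<delta>] N(1) \<delta>(1) by auto
    have emU: "emeasure lebesgue U < ennreal \<delta>"
    proof -
      have "emeasure lebesgue ((U - N) \<union> N) = emeasure lebesgue (U - N)"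
        using N(1) U(3) by (intro emeasure_Un_null_set) auto
      moreover have "(U - N) \<union> N = U" using U(2) by auto
      ultimately show ?thesis using U(4) by simp
    qed
    \<comment> \<open>One radius for both tasks: at a point of \<open>N\<close> the ball stays
      inside \<open>U\<close>, at other points of the interval it realises the straddle
      estimate.\<close>
    have "\<forall>x. \<exists>r>0. (x \<in> N \<longrightarrow> ball x r \<subseteq> U) \<and> (x \<in> {c..d} - N \<longrightarrow>
      (\<forall>u v. u \<in> {c..d} \<longrightarrow> v \<in> {c..d} \<longrightarrow> u \<le> x \<longrightarrow> x \<le> v \<longrightarrow> {u..v} \<subseteq> ball x r \<longrightarrow>
        norm ((v - u) *\<^sub>R f x - (F v - F u)) \<le> \<epsilon>1 * (v - u)))"
    proof
      fix x
      show "\<exists>r>0. (x \<in> N \<longrightarrow> ball x r \<subseteq> U) \<and> (x \<in> {c..d} - N \<longrightarrow>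
        (\<forall>u v. u \<in> {c..d} \<longrightarrow> v \<in> {c..d} \<longrightarrow> u \<le> x \<longrightarrow> x \<le> v \<longrightarrow> {u..v} \<subseteq> ball x r \<longrightarrow>
          norm ((v - u) *\<^sub>R f x - (F v - F u)) \<le> \<epsilon>1 * (v - u)))"
      proof (cases "x \<in> N")
        case True
        then have "x \<in> U" using U(2) by blast
        from openE[OF U(1) this] True show ?thesis by auto
      next
        case False
        show ?thesis
        proof (cases "x \<in> {c..d}")
          case True
          then have "(F has_vector_derivative f x) (at x within {c..d})" using N(2) False by blast
          from has_vector_derivative_interval_bound[OF this \<epsilon>1(1)] False show ?thesis by auto
        next
          case out: False
          then show ?thesis using False by (intro exI[of _ 1]) auto
        qed
      qed
    qed
    from choice[OF this] obtain r where "\<forall>x. r x > 0 \<and> ((x \<in> N \<longrightarrow> ball x (r x) \<subseteq> U) \<and> (x \<in> {c..d} - N \<longrightarrow>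
      (\<forall>u v. u \<in> {c..d} \<longrightarrow> v \<in> {c..d} \<longrightarrow> u \<le> x \<longrightarrow> x \<le> v \<longrightarrow> {u..v} \<subseteq> ball x (r x) \<longrightarrow>
        norm ((v - u) *\<^sub>R f x - (F v - F u)) \<le> \<epsilon>1 * (v - u))))" ..
    then have r: "\<And>x. r x > 0" "\<And>x. x \<in> N \<Longrightarrow> ball x (r x) \<subseteq> U"
      "\<And>x u v. x \<in> {c..d} \<Longrightarrow> x \<notin> N \<Longrightarrow> u \<in> {c..d} \<Longrightarrow> v \<in> {c..d} \<Longrightarrow> u \<le> x \<Longrightarrow> x \<le> v \<Longrightarrow> {u..v} \<subseteq> ball x (r x) \<Longrightarrow>
        norm ((v - u) *\<^sub>R f x - (F v - F u)) \<le> \<epsilon>1 * (v - u)"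
      by auto
    show "\<exists>\<gamma>. gauge \<gamma> \<and> (\<forall>\<D>. \<D> tagged_division_of cbox c d \<and> \<gamma> fine \<D> \<longrightarrow>
        norm ((\<Sum>(x, K)\<in>\<D>. measure lborel K *\<^sub>R g x) - (F d - F c)) < \<epsilon>)"
    proof (intro exI[of _ "\<lambda>x. ball x (r x)"] conjI allI impI)
      show "gauge (\<lambda>x. ball x (r x))" using r(1) gauge_ball_dependent by blast
    next
      fix p assume "p tagged_division_of cbox c d \<and> (\<lambda>x. ball x (r x)) fine p"
      then have p: "p tagged_division_of cbox c d" and fine: "(\<lambda>x. ball x (r x)) fine p" by auto
      have finp: "finite p" using p by blast
      have "F d - F c = (\<Sum>(x,K)\<in>p. F (Sup K) - F (Inf K))" and len: "d - c = (\<Sum>(x,K)\<in>p. Sup K - Inf K)"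
        using additive_tagged_division_1[where f=F] additive_tagged_division_1[where f="\<lambda>x. x"] \<open>c \<le> d\<close> p by auto
      define q where "q = (\<lambda>(x,K). measure lborel K *\<^sub>R g x - (F (Sup K) - F (Inf K)))"
      define p1 where "p1 = {(x,K) \<in> p. x \<in> N}"
      have p1: "p1 \<subseteq> p" by (auto simp: p1_def)
      have piece: "\<exists>u v. K = cbox u v \<and> u \<le> v \<and> u \<le> x \<and> x \<le> v \<and> Inf K = u \<and> Sup K = v \<and> u \<in> {c..d} \<and> v \<in> {c..d} \<and>
          K \<subseteq> ball x (r x)" if "(x, K) \<in> p" for x K
      proof -
        obtain u v where uv: "K = cbox u v" using p \<open>(x, K) \<in> p\<close> by blast
        have "x \<in> K" "K \<subseteq> cbox c d" using p \<open>(x, K) \<in> p\<close> by blast+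
        moreover have "K \<subseteq> ball x (r x)" using fine \<open>(x, K) \<in> p\<close> by blast
        ultimately show ?thesis using uv by (intro exI[of _ u] exI[of _ v]) auto
      qed
      have "(\<Sum>(x, K)\<in>p. measure lborel K *\<^sub>R g x) - (F d - F c) = sum q p"
        using \<open>F d - F c = _\<close> by (simp add: q_def split_def sum_subtractf)
      also have "\<dots> = sum q (p - p1) + sum q p1" using finp p1 by (simp add: sum.subset_diff)
      finally have "norm ((\<Sum>(x, K)\<in>p. measure lborel K *\<^sub>R g x) - (F d - F c)) \<le> norm (sum q (p - p1)) + norm (sum q p1)"
        by (simp add: norm_triangle_ineq)
      also have "norm (sum q (p - p1)) \<le> \<epsilon> / 2"
      proof -
        have "norm (sum q (p - p1)) \<le> (\<Sum>(x,K)\<in>p - p1. \<epsilon>1 * (Sup K - Inf K))"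
        proof (rule sum_norm_le, clarify)
          fix x K assume xK: "(x, K) \<in> p" "(x, K) \<notin> p1"
          then have "x \<notin> N" by (auto simp: p1_def)
          obtain u v where "K = cbox u v" "u \<le> v" "u \<le> x" "x \<le> v" "Inf K = u" "Sup K = v" "u \<in> {c..d}" "v \<in> {c..d}"
            "K \<subseteq> ball x (r x)" using piece[OF xK(1)] by blast
          then show "norm (q (x, K)) \<le> \<epsilon>1 * (Sup K - Inf K)"
            using r(3)[of x u v] \<open>x \<notin> N\<close> by (simp add: q_def g_def)
        qed
        also have "\<dots> \<le> (\<Sum>(x,K)\<in>p. \<epsilon>1 * (Sup K - Inf K))"
        proof (rule sum_mono2)
          fix b assume "b \<in> p - (p - p1)"
          then obtain x K where b: "b = (x, K)" "(x, K) \<in> p" by (cases b) auto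
          from piece[OF b(2)] have "Inf K \<le> Sup K" by auto
          then show "0 \<le> (case b of (x, K) \<Rightarrow> \<epsilon>1 * (Sup K - Inf K))" using \<epsilon>1(1) b(1) by simp
        qed (use finp in auto)
        also have "\<dots> = \<epsilon>1 * (d - c)" by (simp add: len sum_distrib_left split_def)
        finally show ?thesis using \<epsilon>1(2) by simp
      qed
      also have "norm (sum q p1) < \<epsilon> / 2"
      proof -
        define D where "D = snd ` p1"
        have tp1: "p1 tagged_division_of \<Union>D"
        proof -
          have "p1 tagged_partial_division_of cbox c d"
            using p p1 by (meson tagged_division_of_def tagged_partial_division_subset)
          then show ?thesis unfolding D_def by (rule tagged_partial_division_of_Union_self)
        qed
        have div: "D division_of \<Union>D" unfolding D_def using division_of_tagged_division[OF tp1] by (simp add: D_def)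
        have sub: "\<Union>D \<subseteq> {c..d}" unfolding D_def using p1 p by (auto, (metis (no_types, lifting) atLeastAtMost_iff box_real(2) subsetD tagged_division_ofD(3))+)
        have subU: "\<Union>D \<subseteq> U"
        proof
          fix y assume "y \<in> \<Union>D"
          then obtain x K where xK: "(x, K) \<in> p1" "y \<in> K" by (auto simp: D_def)
          then have "K \<subseteq> ball x (r x)" "x \<in> N" using piece p1 by (auto simp: p1_def)
          then show "y \<in> U" using r(2) xK(2) by blast
        qed
        have "(\<Sum>K\<in>D. Sup K - Inf K) = (\<Sum>K\<in>D. measure lebesgue K)"
        proof (rule sum.cong)
          fix K assume "K \<in> D"
          then obtain x where "(x, K) \<in> p" using p1 by (auto simp: D_def)
          from piece[OF this] obtain u v where "K = cbox u v" "u \<le> v" "Inf K = u" "Sup K = v" by blast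
          then show "Sup K - Inf K = measure lebesgue K" by simp
        qed simp
        also have "\<dots> = measure lebesgue (\<Union>D)" using content_division[OF div] by simp
        also have "\<dots> < \<delta>"
        proof -
          have "emeasure lebesgue (\<Union>D) \<le> emeasure lebesgue U" using subU U(1) by (intro emeasure_mono) auto
          also have "\<dots> < ennreal \<delta>" by (rule emU)
          finally show ?thesis using \<delta>(1)
            by (simp add: measure_def) (metis enn2real_less_iff ennreal_less_top order.strict_trans)
        qed
        finally have "(\<Sum>K\<in>D. cmod (F (Sup K) - F (Inf K))) < \<epsilon> / 2" using \<delta>(2) div sub by blast
        moreover have "(\<Sum>(x,K)\<in>p1. cmod (F (Sup K) - F (Inf K))) = (\<Sum>K\<in>D. cmod (F (Sup K) - F (Inf K)))"
        proof -
          \<comment> \<open>Passing from tagged pairs to distinct intervals needs a function that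
            vanishes on every box with empty interior. Increments do so for single points, but the
            \<open>Sup\<close> and \<open>Inf\<close> of the empty set are unspecified, hence the
            case distinction.\<close>
          define h where "h K = (if K = {} then 0 else cmod (F (Sup K) - F (Inf K)))" for K
          have ne: "K \<noteq> {}" if "(x, K) \<in> p1" for x K using that p1 piece by fastforce
          have "(\<Sum>(x,K)\<in>p1. cmod (F (Sup K) - F (Inf K))) = (\<Sum>(x,K)\<in>p1. h K)"
            using ne by (intro sum.cong) (auto simp: h_def)
          also have "\<dots> = (\<Sum>K\<in>D. h K)"
            unfolding D_def by (rule sum.over_tagged_division_lemma[OF tp1]) (auto simp: h_def)
          also have "\<dots> = (\<Sum>K\<in>D. cmod (F (Sup K) - F (Inf K)))"
            using ne by (intro sum.cong) (auto simp: h_def D_def)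
          finally show ?thesis .
        qed
        moreover have "norm (sum q p1) \<le> (\<Sum>(x,K)\<in>p1. cmod (F (Sup K) - F (Inf K)))"
          by (rule sum_norm_le) (auto simp: q_def g_def p1_def norm_minus_commute)
        ultimately show ?thesis by simp
      qed
      finally show "norm ((\<Sum>(x, K)\<in>p. measure lborel K *\<^sub>R g x) - (F d - F c)) < \<epsilon>" by simp
    qed
  qed
  then have "(g has_integral (F d - F c)) {c..d}" by simp
  then show ?thesis
    by (rule has_integral_spike[OF negN, rotated]) (simp add: g_def)
qed

section \<open>Weighted square integrable functions\<close>

definition restr :: "real set \<Rightarrow> (real \<Rightarrow> complex) \<Rightarrow> real \<Rightarrow> complex" where
  "restr K f = (\<lambda>x. if x \<in> K then f x else 0)"

lemma borel_measurable_cnj [measurable]: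
  "f \<in> borel_measurable M \<Longrightarrow> (\<lambda>x. cnj (f x)) \<in> borel_measurable M"
  using borel_measurable_continuous_onI[of cnj] measurable_compose[of f M borel cnj borel] continuous_on_cnj[of UNIV "\<lambda>x. x"]
  by (simp add: continuous_on_id)

locale weight =
  fixes w :: "real \<Rightarrow> real" and S :: "real set"
  assumes S_sets [measurable]: "S \<in> sets lebesgue"
    and w_measurable: "w \<in> borel_measurable (lebesgue_on S)"
    and w_pos: "AE x in lebesgue. x \<in> S \<longrightarrow> 0 < w x"
begin

text \<open>\<open>w\<close> is positive only almost everywhere and arbitrary outside
  \<open>S\<close>. This version is nonnegative everywhere and moves all integrals from
  \<open>lebesgue_on S\<close> to the whole line.\<close>

definition wt :: "real \<Rightarrow> real" where "wt x = (if x \<in> S then max 0 (w x) else 0)"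

lemma wt_nonneg [simp]: "0 \<le> wt x"
  by (simp add: wt_def)

lemma w_ind_measurable: "(\<lambda>x. indicator S x * w x) \<in> borel_measurable lebesgue"
  using w_measurable borel_measurable_restrict_space_iff[of S lebesgue w] by simp

lemma wt_measurable [measurable]: "wt \<in> borel_measurable lebesgue"
proof -
  have "wt = (\<lambda>x. max 0 (indicator S x * w x))"
    by (auto simp: wt_def fun_eq_iff)
  also have "\<dots> \<in> borel_measurable lebesgue"
    using w_ind_measurable by measurable
  finally show ?thesis .
qed

lemma wt_eq: "AE x in lebesgue. x \<in> S \<longrightarrow> wt x = w x \<and> 0 < wt x"
  using w_pos by eventually_elim (auto simp: wt_def)

lemma lint_eq_wt:
  fixes h :: "real \<Rightarrow> 'b::{euclidean_space,real_normed_algebra_1}"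
  assumes [measurable]: "h \<in> borel_measurable lebesgue" and van: "\<And>x. x \<notin> S \<Longrightarrow> h x = 0"
  shows "integrable (lebesgue_on S) (\<lambda>x. h x * of_real (w x)) \<longleftrightarrow> integrable lebesgue (\<lambda>x. h x * of_real (wt x))"
    and "(LINT x|lebesgue_on S. h x * of_real (w x)) = (LINT x|lebesgue. h x * of_real (wt x))"
proof -
  have S': "S \<inter> space lebesgue \<in> sets lebesgue" by simp
  have "(\<lambda>x. h x * of_real (indicator S x * w x)) \<in> borel_measurable lebesgue"
    using w_ind_measurable by measurable
  moreover have "(\<lambda>x. h x * of_real (indicator S x * w x)) = (\<lambda>x. indicator S x *\<^sub>R (h x * of_real (w x)))"
    by (auto simp: indicator_def)
  ultimately have m: "(\<lambda>x. indicator S x *\<^sub>R (h x * of_real (w x))) \<in> borel_measurable lebesgue" by simp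
  have m2: "(\<lambda>x. h x * of_real (wt x)) \<in> borel_measurable lebesgue" by measurable
  have ae: "AE x in lebesgue. indicator S x *\<^sub>R (h x * of_real (w x)) = h x * of_real (wt x)"
    using wt_eq by eventually_elim (use van in \<open>auto simp: indicator_def\<close>)
  show "integrable (lebesgue_on S) (\<lambda>x. h x * of_real (w x)) \<longleftrightarrow> integrable lebesgue (\<lambda>x. h x * of_real (wt x))"
    unfolding integrable_restrict_space[OF S'] by (rule integrable_cong_AE[OF m m2 ae])
  show "(LINT x|lebesgue_on S. h x * of_real (w x)) = (LINT x|lebesgue. h x * of_real (wt x))"
    unfolding integral_restrict_space[OF S'] by (rule integral_cong_AE[OF m m2 ae])
qed

lemma measurable_vanishing:
  fixes f :: "real \<Rightarrow> complex"
  assumes "\<And>x. x \<notin> S \<Longrightarrow> f x = 0"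
  shows "f \<in> borel_measurable (lebesgue_on S) \<longleftrightarrow> f \<in> borel_measurable lebesgue"
proof -
  have "(\<lambda>x. indicator S x *\<^sub>R f x) = f" using assms by (auto simp: indicator_def fun_eq_iff)
  then show ?thesis using borel_measurable_restrict_space_iff[of S lebesgue f] by simp
qed

lemma L2w_iff:
  "f \<in> L2w w S \<longleftrightarrow> (\<forall>x. x \<notin> S \<longrightarrow> f x = 0) \<and> f \<in> borel_measurable lebesgue \<and>
     integrable lebesgue (\<lambda>x. (cmod (f x))\<^sup>2 * wt x)"
proof (cases "(\<forall>x. x \<notin> S \<longrightarrow> f x = 0) \<and> f \<in> borel_measurable lebesgue")
  case True
  then have [measurable]: "f \<in> borel_measurable lebesgue" by simp
  have "(\<lambda>x. (cmod (f x))\<^sup>2) \<in> borel_measurable lebesgue" by measurable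
  from lint_eq_wt(1)[OF this] True measurable_vanishing[of f] show ?thesis by (simp add: L2w_def)
next
  case False
  then show ?thesis using measurable_vanishing[of f] by (auto simp: L2w_def)
qed

lemma L2wD:
  assumes "f \<in> L2w w S"
  shows "\<And>x. x \<notin> S \<Longrightarrow> f x = 0" "f \<in> borel_measurable lebesgue" "integrable lebesgue (\<lambda>x. (cmod (f x))\<^sup>2 * wt x)"
  using assms by (auto simp: L2w_iff)

lemma inner_w_eq:
  assumes "f \<in> borel_measurable lebesgue" "g \<in> borel_measurable lebesgue" "\<And>x. x \<notin> S \<Longrightarrow> f x * cnj (g x) = 0"
  shows "inner_w w S f g = (LINT x|lebesgue. f x * cnj (g x) * of_real (wt x))"
proof -
  have "(\<lambda>x. f x * cnj (g x)) \<in> borel_measurable lebesgue" using assms(1,2) by measurable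
  from lint_eq_wt(2)[OF this assms(3)] show ?thesis by (simp add: inner_w_def)
qed

lemma norm_w_eq:
  assumes "f \<in> borel_measurable lebesgue" "\<And>x. x \<notin> S \<Longrightarrow> f x = 0"
  shows "norm_w w S f = sqrt (LINT x|lebesgue. (cmod (f x))\<^sup>2 * wt x)"
proof -
  have "(\<lambda>x. (cmod (f x))\<^sup>2) \<in> borel_measurable lebesgue" using assms(1) by measurable
  from lint_eq_wt(2)[OF this] assms(2) show ?thesis by (simp add: norm_w_def)
qed

lemma L2w_prod_integrable:
  assumes f: "f \<in> L2w w S" and g: "g \<in> L2w w S"
  shows "integrable lebesgue (\<lambda>x. cmod (f x) * cmod (g x) * wt x)"
    and "integrable lebesgue (\<lambda>x. f x * cnj (g x) * of_real (wt x))"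
proof -
  note [measurable] = L2wD(2)[OF f] L2wD(2)[OF g]
  have i: "integrable lebesgue (\<lambda>x. (cmod (f x))\<^sup>2 * wt x + (cmod (g x))\<^sup>2 * wt x)"
    using L2wD(3)[OF f] L2wD(3)[OF g] by (rule Bochner_Integration.integrable_add)
  have b: "cmod (f x) * cmod (g x) * wt x \<le> (cmod (f x))\<^sup>2 * wt x + (cmod (g x))\<^sup>2 * wt x" for x
  proof -
    have "2 * (cmod (f x) * cmod (g x)) \<le> (cmod (f x))\<^sup>2 + (cmod (g x))\<^sup>2"
      using sum_squares_bound[of "cmod (f x)" "cmod (g x)"] by (simp add: power2_eq_square)
    moreover have "0 \<le> cmod (f x) * cmod (g x)" by simp
    ultimately have "cmod (f x) * cmod (g x) \<le> (cmod (f x))\<^sup>2 + (cmod (g x))\<^sup>2" by linarith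
    from mult_right_mono[OF this wt_nonneg] show ?thesis by (simp add: algebra_simps)
  qed
  show "integrable lebesgue (\<lambda>x. cmod (f x) * cmod (g x) * wt x)"
    by (rule Bochner_Integration.integrable_bound[OF i])
       (use b in \<open>auto simp: abs_mult order_trans[OF _ abs_ge_self]\<close>)
  show "integrable lebesgue (\<lambda>x. f x * cnj (g x) * of_real (wt x))"
    by (rule Bochner_Integration.integrable_bound[OF i])
       (use b in \<open>auto simp: norm_mult order_trans[OF _ abs_ge_self]\<close>)
qed

lemma L2w_add:
  assumes f: "f \<in> L2w w S" and g: "g \<in> L2w w S"
  shows "f + g \<in> L2w w S"
proof -
  note [measurable] = L2wD(2)[OF f] L2wD(2)[OF g]
  have i: "integrable lebesgue (\<lambda>x. 2 * ((cmod (f x))\<^sup>2 * wt x) + 2 * ((cmod (g x))\<^sup>2 * wt x))"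
    using L2wD(3)[OF f] L2wD(3)[OF g] by simp
  have b: "(cmod (f x + g x))\<^sup>2 * wt x \<le> 2 * ((cmod (f x))\<^sup>2 * wt x) + 2 * ((cmod (g x))\<^sup>2 * wt x)" for x
  proof -
    have "(cmod (f x + g x))\<^sup>2 \<le> (cmod (f x) + cmod (g x))\<^sup>2"
      by (intro power_mono norm_triangle_ineq) auto
    also have "\<dots> \<le> 2 * (cmod (f x))\<^sup>2 + 2 * (cmod (g x))\<^sup>2"
      using sum_squares_bound[of "cmod (f x)" "cmod (g x)"] by (simp add: power2_sum)
    finally show ?thesis using mult_right_mono[OF _ wt_nonneg[of x]] by (fastforce simp: algebra_simps)
  qed
  have "integrable lebesgue (\<lambda>x. (cmod (f x + g x))\<^sup>2 * wt x)"
    by (rule Bochner_Integration.integrable_bound[OF i])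
       (use b in \<open>auto simp: abs_mult order_trans[OF _ abs_ge_self]\<close>)
  then show ?thesis using L2wD(1)[OF f] L2wD(1)[OF g] by (auto simp: L2w_iff plus_fun_def)
qed

lemma L2w_cmult:
  assumes f: "f \<in> L2w w S"
  shows "(\<lambda>x. c * f x) \<in> L2w w S"
  using L2wD[OF f] by (simp add: L2w_iff norm_mult power_mult_distrib mult.assoc)

lemma L2w_subspace: "cfun.subspace (L2w w S)"
  by (rule cfun.subspaceI) (auto intro: L2w_add L2w_cmult, auto simp: L2w_iff zero_fun_def)

lemma inner_self:
  assumes f: "f \<in> L2w w S"
  shows "inner_w w S f f = of_real (LINT x|lebesgue. (cmod (f x))\<^sup>2 * wt x)"
proof -
  have "inner_w w S f f = (LINT x|lebesgue. f x * cnj (f x) * of_real (wt x))"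
    using L2wD[OF f] by (simp add: inner_w_eq)
  also have "\<dots> = (LINT x|lebesgue. of_real ((cmod (f x))\<^sup>2 * wt x))"
    unfolding of_real_mult complex_norm_square ..
  also have "\<dots> = of_real (LINT x|lebesgue. (cmod (f x))\<^sup>2 * wt x)"
    by (rule integral_complex_of_real)
  finally show ?thesis .
qed

sublocale L2: semi_inner "\<lambda>c f x. c * f x" "L2w w S" "inner_w w S"
proof
  show "cfun.subspace (L2w w S)" by (rule L2w_subspace)
next
  fix f g h assume fgh: "f \<in> L2w w S" "g \<in> L2w w S" "h \<in> L2w w S"
  note [measurable] = L2wD(2)[OF fgh(1)] L2wD(2)[OF fgh(2)] L2wD(2)[OF fgh(3)]
  have "(LINT x|lebesgue. (f x + g x) * cnj (h x) * of_real (wt x)) =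
     (LINT x|lebesgue. f x * cnj (h x) * of_real (wt x) + g x * cnj (h x) * of_real (wt x))"
    by (simp add: algebra_simps)
  then show "inner_w w S (f + g) h = inner_w w S f h + inner_w w S g h"
    using fgh L2w_prod_integrable(2)[OF fgh(1,3)] L2w_prod_integrable(2)[OF fgh(2,3)] L2wD(1)
    by (simp add: inner_w_eq plus_fun_def)
next
  fix f h c assume "f \<in> L2w w S" "h \<in> L2w w S"
  show "inner_w w S (\<lambda>x. c * f x) h = c * inner_w w S f h"
    by (simp add: inner_w_def mult.assoc)
next
  fix f g assume "f \<in> L2w w S" "g \<in> L2w w S"
  have "inner_w w S g f = (LINT x|lebesgue_on S. cnj (f x * cnj (g x) * of_real (w x)))"
    unfolding inner_w_def by (intro Bochner_Integration.integral_cong) (auto simp: mult_ac)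
  also have "\<dots> = cnj (inner_w w S f g)" unfolding inner_w_def by (rule Bochner_Integration.integral_cnj)
  finally show "inner_w w S g f = cnj (inner_w w S f g)" .
next
  fix f assume f: "f \<in> L2w w S"
  show "0 \<le> Re (inner_w w S f f)" by (simp add: inner_self[OF f])
qed

lemma nrm_eq_norm_w:
  assumes f: "f \<in> L2w w S"
  shows "L2.nrm f = norm_w w S f"
  using L2wD[OF f] by (simp add: L2.nrm_def norm_w_eq inner_self[OF f])

lemma nrm_sq_eq:
  assumes f: "f \<in> L2w w S"
  shows "(L2.nrm f)\<^sup>2 = (LINT x|lebesgue. (cmod (f x))\<^sup>2 * wt x)"
  using nrm_eq_norm_w[OF f] L2wD[OF f] by (simp add: norm_w_eq)

lemma inner_zero_imp_AE:
  assumes f: "f \<in> L2w w S" and "inner_w w S f f = 0"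
  shows "AE x in lebesgue. f x = 0"
proof -
  have "(LINT x|lebesgue. (cmod (f x))\<^sup>2 * wt x) = 0"
    using nrm_sq_eq[OF f] assms(2) by (simp add: L2.nrm_def)
  then have "AE x in lebesgue. (cmod (f x))\<^sup>2 * wt x = 0"
    using integral_nonneg_eq_0_iff_AE[OF L2wD(3)[OF f]] by simp
  with wt_eq show ?thesis by eventually_elim (use L2wD(1)[OF f] in force)
qed

lemma L2w_AE:
  assumes f: "f \<in> L2w w S" and g: "\<And>x. x \<notin> S \<Longrightarrow> g x = 0" and ae: "AE x in lebesgue. x \<in> S \<longrightarrow> f x = g x"
  shows "g \<in> L2w w S"
proof -
  have ae': "AE x in lebesgue. f x = g x"
    using ae by eventually_elim (use g L2wD(1)[OF f] in force)
  have m [measurable]: "f \<in> borel_measurable lebesgue" "g \<in> borel_measurable lebesgue"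
    using L2wD(2)[OF f] borel_measurable_AE[OF _ ae'] by auto
  have "integrable lebesgue (\<lambda>x. (cmod (g x))\<^sup>2 * wt x)"
  proof (subst integrable_cong_AE)
    show "AE x in lebesgue. (cmod (g x))\<^sup>2 * wt x = (cmod (f x))\<^sup>2 * wt x"
      using ae' by eventually_elim simp
    show "integrable lebesgue (\<lambda>x. (cmod (f x))\<^sup>2 * wt x)" by (rule L2wD(3)[OF f])
  qed (use m in measurable)
  then show ?thesis using g m by (auto simp: L2w_iff)
qed

lemma inner_w_AE:
  assumes f: "f \<in> L2w w S" "f' \<in> L2w w S" and g: "g \<in> L2w w S" "g' \<in> L2w w S"
    and ae: "AE x in lebesgue. x \<in> S \<longrightarrow> f x = f' x" "AE x in lebesgue. x \<in> S \<longrightarrow> g x = g' x"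
  shows "inner_w w S f g = inner_w w S f' g'"
proof -
  note [measurable] = L2wD(2)[OF f(1)] L2wD(2)[OF f(2)] L2wD(2)[OF g(1)] L2wD(2)[OF g(2)]
  have "(LINT x|lebesgue. f x * cnj (g x) * of_real (wt x)) = (LINT x|lebesgue. f' x * cnj (g' x) * of_real (wt x))"
  proof (rule integral_cong_AE)
    show "AE x in lebesgue. f x * cnj (g x) * of_real (wt x) = f' x * cnj (g' x) * of_real (wt x)"
      using ae by eventually_elim (use L2wD(1)[OF f(1)] L2wD(1)[OF f(2)] in force)
  qed measurable
  then show ?thesis using L2wD(1)[OF f(1)] L2wD(1)[OF f(2)] by (simp add: inner_w_eq)
qed

text \<open>Used twice: for the limit that makes \<open>T\<close> compact, and for the strong
  convergence of truncations to the identity.\<close>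

lemma L2_dominated_convergence:
  assumes u: "\<And>n. u n \<in> L2w w S" and lim: "\<And>x. x \<in> S \<Longrightarrow> (\<lambda>n. u n x) \<longlonglongrightarrow> z x"
    and z: "\<And>x. x \<notin> S \<Longrightarrow> z x = 0" and G: "G \<in> L2w w S" and dom: "\<And>n x. x \<in> S \<Longrightarrow> cmod (u n x) \<le> cmod (G x)"
  shows "z \<in> L2w w S" "(\<lambda>n. L2.nrm (u n - z)) \<longlonglongrightarrow> 0"
proof -
  have lim': "(\<lambda>n. u n x) \<longlonglongrightarrow> z x" for x
  proof (cases "x \<in> S")
    case False
    then have "(\<lambda>n. u n x) = (\<lambda>n. 0)" using L2wD(1)[OF u] by auto
    then show ?thesis using z[OF False] by simp
  qed (rule lim)
  have [measurable]: "u n \<in> borel_measurable lebesgue" for n using L2wD(2)[OF u] .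
  have [measurable]: "z \<in> borel_measurable lebesgue"
    by (rule borel_measurable_LIMSEQ_metric[OF _ lim']) measurable
  have dom': "cmod (u n x) \<le> cmod (G x)" for n x using dom L2wD(1)[OF u] by (cases "x \<in> S") auto
  have zG: "cmod (z x) \<le> cmod (G x)" for x
    using tendsto_norm[OF lim'[of x]] dom' by (intro LIMSEQ_le_const2) auto
  show zL: "z \<in> L2w w S"
    unfolding L2w_iff
  proof (intro conjI allI impI)
    show "integrable lebesgue (\<lambda>x. (cmod (z x))\<^sup>2 * wt x)"
      by (rule Bochner_Integration.integrable_bound[OF L2wD(3)[OF G]])
         (auto simp: abs_mult intro!: mult_right_mono power_mono zG)
  qed (use z in auto)
  have "(\<lambda>n. LINT x|lebesgue. (cmod (u n x - z x))\<^sup>2 * wt x) \<longlonglongrightarrow> integral\<^sup>L (lebesgue :: real measure) (\<lambda>x. 0 :: real)"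
  proof (rule Bochner_Integration.integral_dominated_convergence[where w = "\<lambda>x. 4 * ((cmod (G x))\<^sup>2 * wt x)"])
    show "integrable lebesgue (\<lambda>x. 4 * ((cmod (G x))\<^sup>2 * wt x))" using L2wD(3)[OF G] by simp
    show "AE x in lebesgue. (\<lambda>n. (cmod (u n x - z x))\<^sup>2 * wt x) \<longlonglongrightarrow> 0"
    proof (rule AE_I2)
      fix x
      have "(\<lambda>n. (cmod (u n x - z x))\<^sup>2 * wt x) \<longlonglongrightarrow> (cmod (z x - z x))\<^sup>2 * wt x"
        by (intro tendsto_intros lim')
      then show "(\<lambda>n. (cmod (u n x - z x))\<^sup>2 * wt x) \<longlonglongrightarrow> 0" by simp
    qed
    show "AE x in lebesgue. norm ((cmod (u n x - z x))\<^sup>2 * wt x) \<le> 4 * ((cmod (G x))\<^sup>2 * wt x)" for n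
    proof (rule AE_I2)
      fix x
      have "cmod (u n x - z x) \<le> 2 * cmod (G x)"
        using norm_triangle_ineq4[of "u n x" "z x"] dom'[of n x] zG[of x] by linarith
      then have "(cmod (u n x - z x))\<^sup>2 \<le> (2 * cmod (G x))\<^sup>2" by (intro power_mono) auto
      then have "(cmod (u n x - z x))\<^sup>2 * wt x \<le> (2 * cmod (G x))\<^sup>2 * wt x" by (intro mult_right_mono) auto
      then show "norm ((cmod (u n x - z x))\<^sup>2 * wt x) \<le> 4 * ((cmod (G x))\<^sup>2 * wt x)"
        by (simp add: power_mult_distrib mult.assoc)
    qed
  qed measurable
  then have "(\<lambda>n. sqrt (LINT x|lebesgue. (cmod (u n x - z x))\<^sup>2 * wt x)) \<longlonglongrightarrow> sqrt 0"
    by (intro tendsto_intros) simp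
  moreover have "L2.nrm (u n - z) = sqrt (LINT x|lebesgue. (cmod (u n x - z x))\<^sup>2 * wt x)" for n
    using L2wD[OF L2.H_diff[OF u zL]] nrm_eq_norm_w[OF L2.H_diff[OF u zL]] by (simp add: norm_w_eq)
  ultimately show "(\<lambda>n. L2.nrm (u n - z)) \<longlonglongrightarrow> 0" by simp
qed

lemma restr_in_L2w:
  assumes f: "f \<in> L2w w S" and K: "K \<in> sets lebesgue"
  shows "restr K f \<in> L2w w S"
proof -
  note [measurable] = L2wD(2)[OF f] K
  have [measurable]: "restr K f \<in> borel_measurable lebesgue" unfolding restr_def by measurable
  have "integrable lebesgue (\<lambda>x. (cmod (restr K f x))\<^sup>2 * wt x)"
    by (rule Bochner_Integration.integrable_bound[OF L2wD(3)[OF f]]) (auto simp: restr_def)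
  then show ?thesis using L2wD(1)[OF f] by (auto simp: L2w_iff restr_def)
qed

lemma weight_subset:
  assumes "K \<in> sets lebesgue" "K \<subseteq> S"
  shows "weight w K"
proof
  show "AE x in lebesgue. x \<in> K \<longrightarrow> 0 < w x"
    using w_pos by eventually_elim (use assms in auto)
  show "w \<in> borel_measurable (lebesgue_on K)"
    using measurable_restrict_mono[OF w_measurable assms(2)] .
qed (rule assms)

text \<open>Makes the space over a subinterval the range of the projection \<open>restr K\<close> in
  the large space, so that an operator on it can be a compression.\<close>

lemma L2w_subset:
  assumes "K \<in> sets lebesgue" "K \<subseteq> S"
  shows "L2w w K = {f \<in> L2w w S. restr K f = f}"
proof -
  interpret K: weight w K by (rule weight_subset[OF assms])
  have eq: "(\<lambda>x. (cmod (f x))\<^sup>2 * K.wt x) = (\<lambda>x. (cmod (f x))\<^sup>2 * wt x)" if "\<And>x. x \<notin> K \<Longrightarrow> f x = 0" for f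
    using that assms by (auto simp: fun_eq_iff K.wt_def wt_def)
  have r: "restr K f = f \<longleftrightarrow> (\<forall>x. x \<notin> K \<longrightarrow> f x = 0)" for f
    by (auto simp: restr_def fun_eq_iff)
  show ?thesis unfolding set_eq_iff mem_Collect_eq r K.L2w_iff L2w_iff using eq assms by fastforce
qed

lemma inner_w_subset:
  assumes "K \<in> sets lebesgue" "K \<subseteq> S" "f \<in> L2w w K" "g \<in> L2w w S"
  shows "inner_w w K f g = inner_w w S f g" "inner_w w K g f = inner_w w S g f"
proof -
  interpret K: weight w K by (rule weight_subset[OF assms(1,2)])
  have f: "f \<in> L2w w S" using L2w_subset[OF assms(1,2)] assms(3) by auto
  have "(\<lambda>x. f x * cnj (g x) * of_real (K.wt x)) = (\<lambda>x. f x * cnj (g x) * of_real (wt x))"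
    using K.L2wD(1)[OF assms(3)] assms(2) by (auto simp: fun_eq_iff K.wt_def wt_def)
  then show "inner_w w K f g = inner_w w S f g"
    using K.L2wD[OF assms(3)] L2wD[OF f] L2wD[OF assms(4)] by (simp add: K.inner_w_eq inner_w_eq)
  have "(\<lambda>x. g x * cnj (f x) * of_real (K.wt x)) = (\<lambda>x. g x * cnj (f x) * of_real (wt x))"
    using K.L2wD(1)[OF assms(3)] assms(2) by (auto simp: fun_eq_iff K.wt_def wt_def)
  then show "inner_w w K g f = inner_w w S g f"
    using K.L2wD[OF assms(3)] L2wD[OF f] L2wD[OF assms(4)] by (simp add: K.inner_w_eq inner_w_eq)
qed

lemma restr_tendsto:
  assumes f: "f \<in> L2w w S" and K: "\<And>j. K j \<in> sets lebesgue"
    and ex: "\<And>x. x \<in> S \<Longrightarrow> \<forall>\<^sub>F j in sequentially. x \<in> K j"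
  shows "(\<lambda>j. L2.nrm (f - restr (K j) f)) \<longlonglongrightarrow> 0"
proof -
  have "(\<lambda>j. L2.nrm (restr (K j) f - f)) \<longlonglongrightarrow> 0"
  proof (rule L2_dominated_convergence(2))
    show "restr (K j) f \<in> L2w w S" for j by (rule restr_in_L2w[OF f K])
    show "(\<lambda>j. restr (K j) f x) \<longlonglongrightarrow> f x" if "x \<in> S" for x
      by (rule tendsto_eventually, rule eventually_mono[OF ex[OF that]]) (simp add: restr_def)
    show "cmod (restr (K n) f x) \<le> cmod (f x)" for n x by (simp add: restr_def)
  qed (use f L2wD in auto)
  then show ?thesis using L2.nrm_minus_commute[OF f restr_in_L2w[OF f K]] by simp
qed

lemma nn_integral_sq:
  assumes f: "f \<in> L2w w S"
  shows "(\<integral>\<^sup>+x. ennreal ((cmod (f x))\<^sup>2 * wt x) \<partial>lebesgue) = ennreal ((L2.nrm f)\<^sup>2)"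
  unfolding nrm_sq_eq[OF f] by (rule nn_integral_eq_integral[OF L2wD(3)[OF f]]) simp

text \<open>Suited to Fatou's lemma, which bounds a nonnegative integral before integrability of the
  limit is known.\<close>

lemma L2w_of_nn_integral:
  assumes [measurable]: "f \<in> borel_measurable lebesgue" and van: "\<And>x. x \<notin> S \<Longrightarrow> f x = 0"
    and le: "(\<integral>\<^sup>+x. ennreal ((cmod (f x))\<^sup>2 * wt x) \<partial>lebesgue) \<le> ennreal (B\<^sup>2)" and "0 \<le> B"
  shows "f \<in> L2w w S" "L2.nrm f \<le> B"
proof -
  have "integrable lebesgue (\<lambda>x. (cmod (f x))\<^sup>2 * wt x)"
    using le by (intro integrableI_bounded) (auto simp: order.strict_trans1 ennreal_less_top)
  then show f: "f \<in> L2w w S" using van by (auto simp: L2w_iff)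
  have "(L2.nrm f)\<^sup>2 \<le> B\<^sup>2" using le unfolding nn_integral_sq[OF f] by simp
  then show "L2.nrm f \<le> B" using \<open>0 \<le> B\<close> by (rule power2_le_imp_le)
qed

text \<open>Along a subsequence with increments of size \<open>1/4 ^ n\<close>, the series
  \<open>\<Sum>n. 4 ^ n * |u (n + 1) - u n|\<^sup>2\<close> is integrable, so the increments decay geometrically
  almost everywhere.\<close>

lemma riesz_fischer:
  assumes u: "\<And>n::nat. u n \<in> L2w w S"
    and cauchy: "\<And>e. 0 < e \<Longrightarrow> \<exists>N. \<forall>m\<ge>N. \<forall>n\<ge>N. L2.nrm (u m - u n) < e"
  shows "\<exists>z\<in>L2w w S. (\<lambda>n. L2.nrm (u n - z)) \<longlonglongrightarrow> 0"
proof -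
  have um [measurable]: "u n \<in> borel_measurable lebesgue" for n using L2wD(2)[OF u] .
  have "\<forall>k::nat. \<exists>N. \<forall>m\<ge>N. \<forall>n\<ge>N. L2.nrm (u m - u n) < (1/4)^k"
    using cauchy by simp
  from choice[OF this] obtain N where N: "\<And>k m n. m \<ge> N k \<Longrightarrow> n \<ge> N k \<Longrightarrow> L2.nrm (u m - u n) < (1/4)^k"
    by auto
  \<comment> \<open>\<open>Suc x\<close> makes the subsequence strictly increasing,
    \<open>N (Suc k)\<close> makes its increments geometrically small.\<close>
  define r where "r = rec_nat (N 0) (\<lambda>k x. max (Suc x) (N (Suc k)))"
  have rS: "r (Suc k) = max (Suc (r k)) (N (Suc k))" for k by (simp add: r_def)
  have rN: "N k \<le> r k" for k by (cases k) (auto simp: r_def)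
  have rmono: "strict_mono r" unfolding strict_mono_Suc_iff using rS by (simp add: less_max_iff_disj)
  define d where "d n = u (r (Suc n)) - u (r n)" for n
  have dL: "d n \<in> L2w w S" for n unfolding d_def by (rule L2.H_diff[OF u u])
  have dm [measurable]: "d n \<in> borel_measurable lebesgue" for n using L2wD(2)[OF dL] .
  have dn: "L2.nrm (d n) \<le> (1/4)^n" for n
  proof -
    have "r n \<le> r (Suc n)" using rS[of n] by simp
    then show ?thesis unfolding d_def
      using N[of n "r (Suc n)" "r n"] rN[of n] by simp
  qed
  have "(\<integral>\<^sup>+x. (\<Sum>n. ennreal (4^n * ((cmod (d n x))\<^sup>2 * wt x))) \<partial>lebesgue)
      = (\<Sum>n. \<integral>\<^sup>+x. ennreal (4^n * ((cmod (d n x))\<^sup>2 * wt x)) \<partial>lebesgue)"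
    by (rule nn_integral_suminf) measurable
  also have "\<dots> = (\<Sum>n. ennreal (4^n * (L2.nrm (d n))\<^sup>2))"
  proof (rule suminf_cong)
    fix n
    have "(\<integral>\<^sup>+x. ennreal (4^n * ((cmod (d n x))\<^sup>2 * wt x)) \<partial>lebesgue)
      = (\<integral>\<^sup>+x. ennreal (4^n) * ennreal ((cmod (d n x))\<^sup>2 * wt x) \<partial>lebesgue)"
      by (intro nn_integral_cong ennreal_mult) auto
    also have "\<dots> = ennreal (4^n) * ennreal ((L2.nrm (d n))\<^sup>2)"
      unfolding nn_integral_sq[OF dL, symmetric] by (rule nn_integral_cmult) measurable
    finally show "(\<integral>\<^sup>+x. ennreal (4^n * ((cmod (d n x))\<^sup>2 * wt x)) \<partial>lebesgue) = ennreal (4^n * (L2.nrm (d n))\<^sup>2)"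
      by (simp add: ennreal_mult)
  qed
  also have "\<dots> \<le> (\<Sum>n. ennreal ((1/4)^n))"
  proof (rule suminf_le)
    fix n
    have "4^n * (L2.nrm (d n))\<^sup>2 \<le> 4^n * ((1/4)^n)\<^sup>2"
      using dn[of n] L2.nrm_nonneg[OF dL] by (intro mult_left_mono power_mono) auto
    also have "\<dots> = (1/4::real)^n" by (simp add: power2_eq_square power_divide)
    finally show "ennreal (4^n * (L2.nrm (d n))\<^sup>2) \<le> ennreal ((1/4)^n)" by (simp add: ennreal_leI)
  qed (rule summableI)+
  also have "\<dots> = ennreal (\<Sum>n. (1/4)^n)"
    by (rule suminf_ennreal2) (simp, rule summable_geometric, simp)
  also have "\<dots> < \<infinity>" by simp
  finally have fin: "(\<integral>\<^sup>+x. (\<Sum>n. ennreal (4^n * ((cmod (d n x))\<^sup>2 * wt x))) \<partial>lebesgue) \<noteq> \<infinity>" by simp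
  have "AE x in lebesgue. (\<Sum>n. ennreal (4^n * ((cmod (d n x))\<^sup>2 * wt x))) \<noteq> \<infinity>"
    by (rule nn_integral_PInf_AE[OF _ fin]) measurable
  with wt_eq have conv: "AE x in lebesgue. convergent (\<lambda>n. u (r n) x)"
  proof eventually_elim
    case (elim x)
    show ?case
    proof (cases "x \<in> S")
      case False
      then have "(\<lambda>n. u (r n) x) = (\<lambda>n. 0)" using L2wD(1)[OF u] by auto
      then show ?thesis by (simp add: convergent_const)
    next
      case True
      then have wx: "0 < wt x" using elim by simp
      define h where "h n = ennreal (4^n * ((cmod (d n x))\<^sup>2 * wt x))" for n
      \<comment> \<open>The finite sum dominates each of its terms, and \<open>4^n\<close> times the
        square of the increment being bounded means that the increment is at most a multiple of
        \<open>(1/2)^n\<close>.\<close>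
      define Q where "Q = suminf h"
      have "h = (\<lambda>n. ennreal (4^n * ((cmod (d n x))\<^sup>2 * wt x)))" by (simp add: h_def fun_eq_iff)
      then have "Q \<noteq> top" using elim(2) by (simp only: Q_def infinity_ennreal_def not_False_eq_True)
      then obtain C where C: "Q = ennreal C" "0 \<le> C" by (cases Q) auto
      have bnd: "cmod (d n x) \<le> sqrt (C / wt x) * (1/2)^n" for n
      proof -
        have "ennreal (4^n * ((cmod (d n x))\<^sup>2 * wt x)) \<le> ennreal C"
        proof -
          have "sum h {n} \<le> suminf h" by (rule sum_le_suminf) (auto intro: summableI)
          then have "h n \<le> ennreal C" using C(1) unfolding Q_def by simp
          then show ?thesis unfolding h_def .
        qed
        then have "4^n * ((cmod (d n x))\<^sup>2 * wt x) \<le> C" using C(2) by simp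
        then have "(cmod (d n x))\<^sup>2 \<le> (C / wt x) * (1/4)^n"
          using wx by (simp add: field_simps power_divide)
        also have "\<dots> = (sqrt (C / wt x) * (1/2)^n)\<^sup>2"
        proof -
          have "((1/2::real)^n)\<^sup>2 = (1/4)^n" by (simp add: power_mult[symmetric] mult.commute power_even_eq power_divide power2_eq_square flip: power_mult_distrib)
          then show ?thesis using C(2) wx by (simp add: power_mult_distrib)
        qed
        finally show ?thesis using C(2) wx by (intro power2_le_imp_le[of "cmod (d n x)"]) auto
      qed
      have "summable (\<lambda>n. sqrt (C / wt x) * (1/2)^n)"
        by (intro summable_mult summable_geometric) simp
      from summable_comparison_test'[OF this bnd] have "summable (\<lambda>n. d n x)" .
      then have "convergent (\<lambda>n. \<Sum>i<n. d i x)" by (simp add: summable_iff_convergent)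
      moreover have "(\<Sum>i<n. d i x) = u (r n) x - u (r 0) x" for n
        unfolding d_def by (induction n) auto
      ultimately have "convergent (\<lambda>n. u (r n) x - u (r 0) x)" by simp
      then have "convergent (\<lambda>n. (u (r n) x - u (r 0) x) + u (r 0) x)"
        by (intro convergent_add convergent_const)
      then show ?thesis by simp
    qed
  qed
  define z where "z x = lim (\<lambda>n. u (r n) x)" for x
  have zm [measurable]: "z \<in> borel_measurable lebesgue" unfolding z_def by (rule borel_measurable_lim_metric) (rule um)
  have zv: "z x = 0" if "x \<notin> S" for x using L2wD(1)[OF u that] by (simp add: z_def)
  \<comment> \<open>Fatou along \<open>u (r m) - u n\<close> as \<open>m\<close> tends to infinity.
    Membership of \<open>u n - z\<close> in the space comes with the estimate, and \<open>z\<close>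
    itself is recovered from it afterwards.\<close>
  have key: "u n - z \<in> L2w w S \<and> L2.nrm (u n - z) \<le> e"
    if e: "0 < e" and n: "\<And>m. m \<ge> M \<Longrightarrow> L2.nrm (u m - u n) < e" for e M n
  proof -
    have "(\<integral>\<^sup>+x. ennreal ((cmod ((u n - z) x))\<^sup>2 * wt x) \<partial>lebesgue)
       = (\<integral>\<^sup>+x. liminf (\<lambda>m. ennreal ((cmod (u (r m) x - u n x))\<^sup>2 * wt x)) \<partial>lebesgue)"
    proof (rule nn_integral_cong_AE, use conv in eventually_elim)
      fix x assume "convergent (\<lambda>n. u (r n) x)"
      then have "(\<lambda>m. u (r m) x) \<longlonglongrightarrow> z x" by (simp add: z_def convergent_LIMSEQ_iff)
      then have "(\<lambda>m. ennreal ((cmod (u (r m) x - u n x))\<^sup>2 * wt x)) \<longlonglongrightarrow> ennreal ((cmod (z x - u n x))\<^sup>2 * wt x)"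
        by (intro tendsto_intros)
      from lim_imp_Liminf[OF _ this]
      show "ennreal ((cmod ((u n - z) x))\<^sup>2 * wt x) = liminf (\<lambda>m. ennreal ((cmod (u (r m) x - u n x))\<^sup>2 * wt x))"
        by (simp add: norm_minus_commute)
    qed
    also have "\<dots> \<le> liminf (\<lambda>m. \<integral>\<^sup>+x. ennreal ((cmod (u (r m) x - u n x))\<^sup>2 * wt x) \<partial>lebesgue)"
      by (rule nn_integral_liminf) measurable
    also have "\<dots> = liminf (\<lambda>m. ennreal ((L2.nrm (u (r m) - u n))\<^sup>2))"
      using nn_integral_sq[OF L2.H_diff[OF u u]] by simp
    also have "\<dots> \<le> limsup (\<lambda>m. ennreal ((L2.nrm (u (r m) - u n))\<^sup>2))"
      by (rule Liminf_le_Limsup) simp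
    also have "\<dots> \<le> ennreal (e\<^sup>2)"
    proof (rule Limsup_bounded)
      show "\<forall>\<^sub>F m in sequentially. ennreal ((L2.nrm (u (r m) - u n))\<^sup>2) \<le> ennreal (e\<^sup>2)"
        using eventually_ge_at_top[of M]
      proof eventually_elim
        fix m assume "M \<le> m"
        then have "M \<le> r m" using seq_suble[OF rmono, of m] by simp
        then show "ennreal ((L2.nrm (u (r m) - u n))\<^sup>2) \<le> ennreal (e\<^sup>2)"
          using n[of "r m"] L2.nrm_nonneg[OF L2.H_diff[OF u u], of "r m" n]
          by (intro ennreal_leI power_mono) auto
      qed
    qed
    finally have "(\<integral>\<^sup>+x. ennreal ((cmod ((u n - z) x))\<^sup>2 * wt x) \<partial>lebesgue) \<le> ennreal (e\<^sup>2)" .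
    moreover have "u n - z \<in> borel_measurable lebesgue" unfolding fun_diff_def by measurable
    moreover have "(u n - z) x = 0" if "x \<notin> S" for x using zv[OF that] L2wD(1)[OF u that] by simp
    ultimately show ?thesis using L2w_of_nn_integral[of "u n - z" e] e by auto
  qed
  obtain N0 where N0: "\<forall>m\<ge>N0. \<forall>n\<ge>N0. L2.nrm (u m - u n) < 1" using cauchy[of 1] by auto
  have "u N0 - z \<in> L2w w S" using key[of 1 N0 N0] N0 by auto
  then have "u N0 - (u N0 - z) \<in> L2w w S" by (rule L2.H_diff[OF u])
  then have zL: "z \<in> L2w w S" by simp
  moreover have "(\<lambda>n. L2.nrm (u n - z)) \<longlonglongrightarrow> 0"
  proof (rule LIMSEQ_I)
    fix e :: real assume "0 < e"
    then obtain M where M: "\<forall>m\<ge>M. \<forall>n\<ge>M. L2.nrm (u m - u n) < e/2" using cauchy[of "e/2"] by auto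
    show "\<exists>no. \<forall>n\<ge>no. norm (L2.nrm (u n - z) - 0) < e"
    proof (intro exI[of _ M] allI impI)
      fix n assume "M \<le> n"
      then have "L2.nrm (u n - z) \<le> e/2" using key[of "e/2" M n] M \<open>0 < e\<close> by auto
      then show "norm (L2.nrm (u n - z) - 0) < e"
        using L2.nrm_nonneg[OF L2.H_diff[OF u zL], of n] \<open>0 < e\<close> by simp
    qed
  qed
  ultimately show ?thesis by blast
qed

end

section \<open>Quasi-derivatives\<close>

text \<open>The equation \<open>- (Y 3)' + q * Y 0 = g\<close> as a first-order system with explicit
  derivatives. The right-hand side is not divided by \<open>w\<close>; for \<open>ell y = f\<close>
  it is \<open>w * f\<close>, and an eigenvalue can be absorbed into \<open>q\<close>, leaving
  \<open>g = 0\<close>.\<close>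

definition system ::
  "(real \<Rightarrow> real) \<Rightarrow> (real \<Rightarrow> real) \<Rightarrow> (real \<Rightarrow> real) \<Rightarrow> real set \<Rightarrow> (nat \<Rightarrow> real \<Rightarrow> complex) \<Rightarrow>
    (real \<Rightarrow> complex) \<Rightarrow> bool" where
  "system p s q S Y g \<longleftrightarrow>
     (\<forall>k\<le>3. loc_abs_cont S (Y k)) \<and>
     (\<forall>x\<in>S. (Y 0 has_vector_derivative Y 1 x) (at x within S)) \<and>
     (AE x in lebesgue. x \<in> S \<longrightarrow>
        (Y 1 has_vector_derivative Y 2 x / of_real (p x)) (at x within S) \<and>
        (Y 2 has_vector_derivative - Y 3 x + of_real (s x) * Y 1 x) (at x within S) \<and>
        (Y 3 has_vector_derivative of_real (q x) * Y 0 x - g x) (at x within S))"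

lemma systemD:
  assumes "system p s q S Y g"
  shows "\<And>k. k \<le> 3 \<Longrightarrow> loc_abs_cont S (Y k)"
    "\<And>x. x \<in> S \<Longrightarrow> (Y 0 has_vector_derivative Y 1 x) (at x within S)"
    "AE x in lebesgue. x \<in> S \<longrightarrow>
        (Y 1 has_vector_derivative Y 2 x / of_real (p x)) (at x within S) \<and>
        (Y 2 has_vector_derivative - Y 3 x + of_real (s x) * Y 1 x) (at x within S) \<and>
        (Y 3 has_vector_derivative of_real (q x) * Y 0 x - g x) (at x within S)"
  using assms unfolding system_def by auto

lemma loc_abs_contD: "loc_abs_cont S f \<Longrightarrow> {c..d} \<subseteq> S \<Longrightarrow> abs_cont_on c d f"
  by (simp add: loc_abs_cont_def)

lemma loc_abs_cont_add_cmult: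
  "loc_abs_cont S f \<Longrightarrow> loc_abs_cont S g \<Longrightarrow> loc_abs_cont S (\<lambda>x. f x + c * g x)"
  unfolding loc_abs_cont_def by (intro allI impI abs_cont_on_add abs_cont_on_cmult) auto

lemma system_add_cmult:
  assumes Y: "system p s q S Y g" and Z: "system p s q S Z h"
  shows "system p s q S (\<lambda>k x. Y k x + c * Z k x) (\<lambda>x. g x + c * h x)"
proof -
  have comb: "((\<lambda>x. u x + c * v x) has_vector_derivative l) (at x within S)"
    if "(u has_vector_derivative u') (at x within S)" "(v has_vector_derivative v') (at x within S)" "l = u' + c * v'"
    for u v :: "real \<Rightarrow> complex" and u' v' l x
    unfolding that(3)
    by (intro has_vector_derivative_add that(1) has_vector_derivative_mult_right that(2))
  show ?thesis
    unfolding system_def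
  proof (intro conjI allI impI ballI)
    fix k :: nat assume "k \<le> 3"
    then show "loc_abs_cont S (\<lambda>x. Y k x + c * Z k x)"
      using systemD(1)[OF Y] systemD(1)[OF Z] by (intro loc_abs_cont_add_cmult)
  next
    fix x assume "x \<in> S"
    then show "((\<lambda>x. Y 0 x + c * Z 0 x) has_vector_derivative Y 1 x + c * Z 1 x) (at x within S)"
      using comb[OF systemD(2)[OF Y] systemD(2)[OF Z]] by simp
  next
    show "AE x in lebesgue. x \<in> S \<longrightarrow>
        ((\<lambda>x. Y 1 x + c * Z 1 x) has_vector_derivative (Y 2 x + c * Z 2 x) / of_real (p x)) (at x within S) \<and>
        ((\<lambda>x. Y 2 x + c * Z 2 x) has_vector_derivative - (Y 3 x + c * Z 3 x) + of_real (s x) * (Y 1 x + c * Z 1 x)) (at x within S) \<and>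
        ((\<lambda>x. Y 3 x + c * Z 3 x) has_vector_derivative of_real (q x) * (Y 0 x + c * Z 0 x) - (g x + c * h x)) (at x within S)"
      using systemD(3)[OF Y] systemD(3)[OF Z]
      by eventually_elim (auto intro!: comb simp: algebra_simps add_divide_distrib)
  qed
qed

lemma system_combination:
  assumes "system p s q S Y g" "system p s q S Z h"
  shows "system p s q S (\<lambda>k x. c * Y k x + d * Z k x) (\<lambda>x. c * g x + d * h x)"
proof -
  have "system p s q S (\<lambda>k x. Y k x + (c - 1) * Y k x) (\<lambda>x. g x + (c - 1) * g x)"
    by (rule system_add_cmult[OF assms(1,1)])
  from system_add_cmult[OF this assms(2), of d] show ?thesis by (simp add: algebra_simps)
qed

lemma system_subset:
  assumes Y: "system p s q S Y g" and "K \<subseteq> S"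
  shows "system p s q K Y g"
  unfolding system_def
proof (intro conjI allI impI ballI)
  fix k :: nat assume "k \<le> 3"
  then show "loc_abs_cont K (Y k)" using systemD(1)[OF Y] \<open>K \<subseteq> S\<close> by (auto simp: loc_abs_cont_def)
next
  fix x assume "x \<in> K"
  then show "(Y 0 has_vector_derivative Y 1 x) (at x within K)"
    using systemD(2)[OF Y] \<open>K \<subseteq> S\<close> has_vector_derivative_within_subset by blast
next
  show "AE x in lebesgue. x \<in> K \<longrightarrow>
        (Y 1 has_vector_derivative Y 2 x / of_real (p x)) (at x within K) \<and>
        (Y 2 has_vector_derivative - Y 3 x + of_real (s x) * Y 1 x) (at x within K) \<and>
        (Y 3 has_vector_derivative of_real (q x) * Y 0 x - g x) (at x within K)"
    using systemD(3)[OF Y]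
    by eventually_elim (use \<open>K \<subseteq> S\<close> has_vector_derivative_within_subset in blast)
qed

lemma system_cong:
  assumes Y: "system p s q S Y g" and eq: "\<And>k x. k \<le> 3 \<Longrightarrow> x \<in> S \<Longrightarrow> Z k x = Y k x"
    and g: "AE x in lebesgue. x \<in> S \<longrightarrow> h x = g x"
  shows "system p s q S Z h"
  unfolding system_def
proof (intro conjI allI impI ballI)
  fix k :: nat assume k: "k \<le> 3"
  show "loc_abs_cont S (Z k)"
    unfolding loc_abs_cont_def
  proof (intro allI impI)
    fix c d :: real assume cd: "{c..d} \<subseteq> S"
    then have ac: "abs_cont_on c d (Y k)" using systemD(1)[OF Y k] by (simp add: loc_abs_cont_def)
    show "abs_cont_on c d (Z k)"
    proof (rule abs_cont_on_dominated[OF ac ac, of 1])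
      fix u v assume "u \<in> {c..d}" "v \<in> {c..d}"
      then have "Z k u = Y k u" "Z k v = Y k v" using eq[OF k] cd by blast+
      then show "cmod (Z k v - Z k u) \<le> 1 * (cmod (Y k v - Y k u) + cmod (Y k v - Y k u))" by simp
    qed simp
  qed
next
  fix x assume x: "x \<in> S"
  show "(Z 0 has_vector_derivative Z 1 x) (at x within S)"
    using has_vector_derivative_transform[OF x _ systemD(2)[OF Y x], of "Z 0"] eq x by simp
next
  show "AE x in lebesgue. x \<in> S \<longrightarrow>
        (Z 1 has_vector_derivative Z 2 x / of_real (p x)) (at x within S) \<and>
        (Z 2 has_vector_derivative - Z 3 x + of_real (s x) * Z 1 x) (at x within S) \<and>
        (Z 3 has_vector_derivative of_real (q x) * Z 0 x - h x) (at x within S)"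
    using systemD(3)[OF Y] g
  proof eventually_elim
    case (elim x)
    show ?case
    proof
      assume x: "x \<in> S"
      have t: "(Z k has_vector_derivative l) (at x within S)" if "(Y k has_vector_derivative l) (at x within S)" "k \<le> 3" for k l
        by (rule has_vector_derivative_transform[OF x _ that(1)]) (use eq that(2) in simp)
      have *: "Z 0 x = Y 0 x" "Z 1 x = Y 1 x" "Z 2 x = Y 2 x" "Z 3 x = Y 3 x" "h x = g x"
        using eq x elim(2) by auto
      show "(Z 1 has_vector_derivative Z 2 x / of_real (p x)) (at x within S) \<and>
        (Z 2 has_vector_derivative - Z 3 x + of_real (s x) * Z 1 x) (at x within S) \<and>
        (Z 3 has_vector_derivative of_real (q x) * Z 0 x - h x) (at x within S)"
        unfolding * by (intro conjI t) (use elim(1) x in \<open>simp_all\<close>)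
    qed
  qed
qed

lemma system_continuous:
  "system p s q S Y g \<Longrightarrow> k \<le> 3 \<Longrightarrow> {c..d} \<subseteq> S \<Longrightarrow> continuous_on {c..d} (Y k)"
  by (intro abs_cont_on_continuous loc_abs_contD systemD(1))

lemma system_integrals:
  assumes Y: "system p s q S Y g" and cd: "c \<le> d" "{c..d} \<subseteq> S"
  shows "(Y 1 has_integral Y 0 d - Y 0 c) {c..d}"
    "((\<lambda>x. Y 2 x / of_real (p x)) has_integral Y 1 d - Y 1 c) {c..d}"
    "((\<lambda>x. - Y 3 x + of_real (s x) * Y 1 x) has_integral Y 2 d - Y 2 c) {c..d}"
    "((\<lambda>x. of_real (q x) * Y 0 x - g x) has_integral Y 3 d - Y 3 c) {c..d}"
proof -
  note ac = loc_abs_contD[OF systemD(1)[OF Y] cd(2)]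
  have Y': "system p s q {c..d} Y g" by (rule system_subset[OF Y cd(2)])
  note ae = systemD(3)[OF Y']
  show "(Y 1 has_integral Y 0 d - Y 0 c) {c..d}"
    using systemD(2)[OF Y'] by (intro fundamental_theorem_abs_cont cd ac) auto
  show "((\<lambda>x. Y 2 x / of_real (p x)) has_integral Y 1 d - Y 1 c) {c..d}"
    by (rule fundamental_theorem_abs_cont[OF cd(1) ac]) (simp, use ae in eventually_elim, blast)
  show "((\<lambda>x. - Y 3 x + of_real (s x) * Y 1 x) has_integral Y 2 d - Y 2 c) {c..d}"
    by (rule fundamental_theorem_abs_cont[OF cd(1) ac]) (simp, use ae in eventually_elim, blast)
  show "((\<lambda>x. of_real (q x) * Y 0 x - g x) has_integral Y 3 d - Y 3 c) {c..d}"
    by (rule fundamental_theorem_abs_cont[OF cd(1) ac]) (simp, use ae in eventually_elim, blast)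
qed

text \<open>When the bracket is differentiated, the terms with \<open>1 / p\<close>,
  \<open>s\<close> and \<open>q\<close> appear twice with opposite signs because these coefficients
  are real; what remains are the two right-hand sides.\<close>

lemma lagrange_identity:
  assumes F: "system p s q S F g" and G: "system p s q S G h" and cd: "c \<le> d" "{c..d} \<subseteq> S"
  shows "((\<lambda>x. g x * cnj (G 0 x) - F 0 x * cnj (h x)) has_integral bracket F G d - bracket F G c) {c..d}"
proof (rule fundamental_theorem_abs_cont[OF cd(1)])
  note acF = loc_abs_contD[OF systemD(1)[OF F] cd(2)] and acG = loc_abs_contD[OF systemD(1)[OF G] cd(2)]
  show "abs_cont_on c d (bracket F G)"
    unfolding bracket_def
    by (intro abs_cont_on_diff abs_cont_on_add abs_cont_on_mult abs_cont_on_cnj acF acG) auto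
  have F': "system p s q {c..d} F g" and G': "system p s q {c..d} G h"
    by (rule system_subset[OF F cd(2)], rule system_subset[OF G cd(2)])
  show "AE x in lebesgue. x \<in> {c..d} \<longrightarrow>
     (bracket F G has_vector_derivative g x * cnj (G 0 x) - F 0 x * cnj (h x)) (at x within {c..d})"
    using systemD(3)[OF F'] systemD(3)[OF G']
  proof eventually_elim
    case (elim x)
    show ?case
    proof
      assume x: "x \<in> {c..d}"
      let ?at = "at x within {c..d}"
      have f: "(F 0 has_vector_derivative F 1 x) ?at" "(F 1 has_vector_derivative F 2 x / of_real (p x)) ?at"
        "(F 2 has_vector_derivative - F 3 x + of_real (s x) * F 1 x) ?at"
        "(F 3 has_vector_derivative of_real (q x) * F 0 x - g x) ?at"
        using elim(1) systemD(2)[OF F'] x by auto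
      have g: "((\<lambda>x. cnj (G 0 x)) has_vector_derivative cnj (G 1 x)) ?at"
        "((\<lambda>x. cnj (G 1 x)) has_vector_derivative cnj (G 2 x / of_real (p x))) ?at"
        "((\<lambda>x. cnj (G 2 x)) has_vector_derivative cnj (- G 3 x + of_real (s x) * G 1 x)) ?at"
        "((\<lambda>x. cnj (G 3 x)) has_vector_derivative cnj (of_real (q x) * G 0 x - h x)) ?at"
      proof -
        have g0: "(G 0 has_vector_derivative G 1 x) ?at" "(G 1 has_vector_derivative G 2 x / of_real (p x)) ?at"
        "(G 2 has_vector_derivative - G 3 x + of_real (s x) * G 1 x) ?at"
        "(G 3 has_vector_derivative of_real (q x) * G 0 x - h x) ?at"
          using elim(2) systemD(2)[OF G'] x by auto
        show "((\<lambda>x. cnj (G 0 x)) has_vector_derivative cnj (G 1 x)) ?at"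
        "((\<lambda>x. cnj (G 1 x)) has_vector_derivative cnj (G 2 x / of_real (p x))) ?at"
        "((\<lambda>x. cnj (G 2 x)) has_vector_derivative cnj (- G 3 x + of_real (s x) * G 1 x)) ?at"
        "((\<lambda>x. cnj (G 3 x)) has_vector_derivative cnj (of_real (q x) * G 0 x - h x)) ?at"
          by (intro has_vector_derivative_cnj g0)+
      qed
      have "(bracket F G has_vector_derivative
        ((F 0 x * cnj (of_real (q x) * G 0 x - h x) + F 1 x * cnj (G 3 x))
         + (F 1 x * cnj (- G 3 x + of_real (s x) * G 1 x) + F 2 x / of_real (p x) * cnj (G 2 x)))
        - ((F 3 x * cnj (G 1 x) + (of_real (q x) * F 0 x - g x) * cnj (G 0 x))
         + (F 2 x * cnj (G 2 x / of_real (p x)) + (- F 3 x + of_real (s x) * F 1 x) * cnj (G 1 x)))) ?at"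
        unfolding bracket_def
        by (intro has_vector_derivative_diff has_vector_derivative_add has_vector_derivative_mult f g)
      then show "(bracket F G has_vector_derivative g x * cnj (G 0 x) - F 0 x * cnj (h x)) ?at"
        by (rule back_subst[of "\<lambda>l. (bracket F G has_vector_derivative l) ?at"]) (simp add: algebra_simps)
    qed
  qed
qed

section \<open>Uniqueness for the first-order system\<close>

lemma small_integral:
  fixes h :: "real \<Rightarrow> real"
  assumes h: "h integrable_on {A..B}" and "0 < \<epsilon>"
  shows "\<exists>\<delta>>0. \<forall>x y. A \<le> x \<longrightarrow> x \<le> y \<longrightarrow> y \<le> B \<longrightarrow> y - x < \<delta> \<longrightarrow> integral {x..y} h < \<epsilon>"
proof -
  have "uniformly_continuous_on {A..B} (\<lambda>x. integral {A..x} h)"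
    by (intro compact_uniformly_continuous indefinite_integral_continuous_1 h) auto
  then obtain \<delta> where \<delta>: "0 < \<delta>" "\<And>x y. x \<in> {A..B} \<Longrightarrow> y \<in> {A..B} \<Longrightarrow> dist y x < \<delta> \<Longrightarrow>
     dist (integral {A..y} h) (integral {A..x} h) < \<epsilon>"
    unfolding uniformly_continuous_on_def using \<open>0 < \<epsilon>\<close> by metis
  have "integral {x..y} h < \<epsilon>" if "A \<le> x" "x \<le> y" "y \<le> B" "y - x < \<delta>" for x y
  proof -
    have "h integrable_on {A..y}" using integrable_on_subinterval[OF h] that by auto
    then have "integral {A..x} h + integral {x..y} h = integral {A..y} h"
      using that by (intro Henstock_Kurzweil_Integration.integral_combine) auto
    moreover have "dist (integral {A..y} h) (integral {A..x} h) < \<epsilon>" using that by (intro \<delta>(2)) (auto simp: dist_real_def)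
    ultimately show ?thesis by (simp add: dist_real_def)
  qed
  then show ?thesis using \<delta>(1) by blast
qed

lemma L1_loc_subset: "L1_loc S f \<Longrightarrow> K \<subseteq> S \<Longrightarrow> L1_loc K f"
  unfolding L1_loc_def by (meson subset_trans)

text \<open>Serves both the open interval and its compact subintervals. A nontrivial interval has no
  isolated points, so derivatives within \<open>S\<close> are unique, also at end points belonging
  to \<open>S\<close>.\<close>

locale quasi_coeffs =
  fixes p s q w :: "real \<Rightarrow> real" and S :: "real set"
  assumes S_interval: "is_interval S" and S_nontrivial: "\<exists>u\<in>S. \<exists>v\<in>S. u < v" and S_sets: "S \<in> sets lebesgue"
    and p_loc: "L1_loc S (\<lambda>x. 1 / p x)" and s_loc: "L1_loc S s" and q_loc: "L1_loc S q" and w_loc: "L1_loc S w"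
    and p_pos: "AE x in lebesgue. x \<in> S \<longrightarrow> 0 < p x" and w_pos: "AE x in lebesgue. x \<in> S \<longrightarrow> 0 < w x"
begin

lemma interval_subset: "c \<in> S \<Longrightarrow> d \<in> S \<Longrightarrow> {c..d} \<subseteq> S"
  using mem_is_interval_1_I[OF S_interval] by (meson atLeastAtMost_iff subsetI)

lemma S_limpt:
  assumes "x \<in> S"
  shows "at x within S \<noteq> bot"
proof -
  have "connected S" using S_interval is_interval_connected by blast
  moreover have "\<nexists>x. S = {x}" using S_nontrivial by fastforce
  ultimately have "x islimpt S" using assms connected_imp_perfect by blast
  then show ?thesis using trivial_limit_within by blast
qed

lemma surrounding_interval:
  assumes "x \<in> S"
  obtains c d where "c < d" "x \<in> {c..d}" "{c..d} \<subseteq> S"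
proof -
  obtain u v where uv: "u \<in> S" "v \<in> S" "u < v" using S_nontrivial by auto
  show ?thesis
  proof (cases "x < v")
    case True
    then show ?thesis using interval_subset[OF assms uv(2)] by (intro that[of x v]) auto
  next
    case False
    then show ?thesis using interval_subset[OF uv(1) assms] uv(3) by (intro that[of u x]) auto
  qed
qed

text \<open>Bounds the coefficients of the system in every row; the summand 1 accounts for
  \<open>Y 1\<close> in the first row and \<open>Y 3\<close> in the third.\<close>

definition majorant :: "real \<Rightarrow> real" where "majorant x = 1 + \<bar>1 / p x\<bar> + \<bar>s x\<bar> + \<bar>q x\<bar>"

lemma majorant_integrable:
  assumes "{c..d} \<subseteq> S"
  shows "majorant integrable_on {c..d}"
    "(\<lambda>x. \<bar>1 / p x\<bar>) integrable_on {c..d}" "(\<lambda>x. \<bar>s x\<bar>) integrable_on {c..d}" "(\<lambda>x. \<bar>q x\<bar>) integrable_on {c..d}"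
proof -
  have "(\<lambda>x. 1 / p x) absolutely_integrable_on {c..d}" "s absolutely_integrable_on {c..d}" "q absolutely_integrable_on {c..d}"
    using assms p_loc s_loc q_loc unfolding L1_loc_def by blast+
  then show i: "(\<lambda>x. \<bar>1 / p x\<bar>) integrable_on {c..d}" "(\<lambda>x. \<bar>s x\<bar>) integrable_on {c..d}" "(\<lambda>x. \<bar>q x\<bar>) integrable_on {c..d}"
    unfolding absolutely_integrable_on_def by simp_all
  show "majorant integrable_on {c..d}" unfolding majorant_def by (intro integrable_add i) auto
qed

text \<open>At the point where the sum \<open>N\<close> of the four moduli is largest, each
  component has moved from 0 by at most \<open>M\<close> times the integral of
  \<open>majorant\<close>. Four components and an integral below 1/4 leave only
  \<open>M = 0\<close>.\<close>

lemma system_unique_small: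
  assumes Y: "system p s q S Y (\<lambda>x. 0)" and cd: "{c..d} \<subseteq> S" and small: "integral {c..d} majorant < 1/4"
    and e: "e \<in> {c..d}" "\<And>k. k \<le> 3 \<Longrightarrow> Y k e = 0"
  shows "x \<in> {c..d} \<Longrightarrow> k \<le> 3 \<Longrightarrow> Y k x = 0"
proof -
  define N where "N x = cmod (Y 0 x) + cmod (Y 1 x) + cmod (Y 2 x) + cmod (Y 3 x)" for x
  have "continuous_on {c..d} N"
    unfolding N_def by (intro continuous_intros system_continuous[OF Y _ cd]) auto
  then obtain \<xi> where \<xi>: "\<xi> \<in> {c..d}" "\<And>x. x \<in> {c..d} \<Longrightarrow> N x \<le> N \<xi>"
    using continuous_attains_sup[of "{c..d}" N] e(1) by auto
  define M where "M = N \<xi>"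
  have YM: "cmod (Y k x) \<le> M" if "k \<le> 3" "x \<in> {c..d}" for k x
  proof -
    have "k = 0 \<or> k = 1 \<or> k = 2 \<or> k = 3" using that by linarith
    moreover have "N x \<le> M" using \<xi>(2) that by (simp add: M_def)
    ultimately show ?thesis
      using norm_ge_zero[of "Y 0 x"] norm_ge_zero[of "Y 1 x"] norm_ge_zero[of "Y 2 x"] norm_ge_zero[of "Y 3 x"]
      unfolding N_def by (elim disjE) (simp_all del: norm_ge_zero)
  qed
  have M0: "0 \<le> M" by (simp add: M_def N_def)
  have hpos: "0 \<le> majorant x" for x by (simp add: majorant_def)
  have bound: "cmod (F \<xi> - F e) \<le> M * integral {c..d} majorant"
    if F: "\<And>u v. u \<le> v \<Longrightarrow> {u..v} \<subseteq> S \<Longrightarrow> (f has_integral F v - F u) {u..v}"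
      and f: "\<And>x. x \<in> {c..d} \<Longrightarrow> cmod (f x) \<le> M * majorant x" for F f
  proof -
    define u where "u = min \<xi> e"
    define v where "v = max \<xi> e"
    have uv: "u \<le> v" "{u..v} \<subseteq> {c..d}" using \<xi>(1) e(1) by (auto simp: u_def v_def)
    have fi: "(f has_integral F v - F u) {u..v}" using F uv cd by blast
    have hi: "majorant integrable_on {u..v}" using majorant_integrable(1) uv cd by blast
    have "cmod (F \<xi> - F e) = cmod (F v - F u)" by (auto simp: u_def v_def min_def max_def norm_minus_commute)
    also have "\<dots> = cmod (integral {u..v} f)" using fi by (simp add: integral_unique)
    also have "\<dots> \<le> integral {u..v} (\<lambda>x. M * majorant x)"
      by (rule integral_norm_bound_integral) (use fi hi f uv in \<open>auto intro: integrable_on_mult_right\<close>)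
    also have "\<dots> = M * integral {u..v} majorant" by simp
    also have "\<dots> \<le> M * integral {c..d} majorant"
      using M0 hpos by (intro mult_left_mono integral_subset_le hi majorant_integrable(1)[OF cd] uv) auto
    finally show ?thesis .
  qed
  have majorant_ge: "1 \<le> majorant x" "\<bar>1 / p x\<bar> \<le> majorant x" "1 + \<bar>s x\<bar> \<le> majorant x" "\<bar>q x\<bar> \<le> majorant x" for x
    by (auto simp: majorant_def)
  note SI = system_integrals[OF Y]
  have "cmod (Y 0 \<xi> - Y 0 e) \<le> M * integral {c..d} majorant"
  proof (rule bound[OF SI(1)])
    fix x assume x: "x \<in> {c..d}"
    have "cmod (Y 1 x) \<le> M * 1" using YM x by simp
    also have "\<dots> \<le> M * majorant x" using majorant_ge M0 by (intro mult_left_mono)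
    finally show "cmod (Y 1 x) \<le> M * majorant x" .
  qed
  moreover have "cmod (Y 1 \<xi> - Y 1 e) \<le> M * integral {c..d} majorant"
  proof (rule bound[OF SI(2)])
    fix x assume x: "x \<in> {c..d}"
    have "cmod (Y 2 x / of_real (p x)) = cmod (Y 2 x) * \<bar>1 / p x\<bar>" by (simp add: norm_divide)
    also have "\<dots> \<le> M * majorant x" using YM[of 2 x] x majorant_ge M0 by (intro mult_mono) auto
    finally show "cmod (Y 2 x / of_real (p x)) \<le> M * majorant x" .
  qed
  moreover have "cmod (Y 2 \<xi> - Y 2 e) \<le> M * integral {c..d} majorant"
  proof (rule bound[OF SI(3)])
    fix x assume x: "x \<in> {c..d}"
    have "cmod (- Y 3 x + of_real (s x) * Y 1 x) \<le> cmod (Y 3 x) + \<bar>s x\<bar> * cmod (Y 1 x)"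
      using norm_triangle_ineq[of "- Y 3 x" "of_real (s x) * Y 1 x"] by (simp add: norm_mult)
    also have "\<dots> \<le> M + \<bar>s x\<bar> * M" using YM x by (intro add_mono mult_left_mono) auto
    also have "\<dots> = M * (1 + \<bar>s x\<bar>)" by (simp add: algebra_simps)
    also have "\<dots> \<le> M * majorant x" using majorant_ge M0 by (intro mult_left_mono)
    finally show "cmod (- Y 3 x + of_real (s x) * Y 1 x) \<le> M * majorant x" .
  qed
  moreover have "cmod (Y 3 \<xi> - Y 3 e) \<le> M * integral {c..d} majorant"
  proof (rule bound[OF SI(4)])
    fix x assume x: "x \<in> {c..d}"
    have "cmod (of_real (q x) * Y 0 x - 0) = cmod (Y 0 x) * \<bar>q x\<bar>" by (simp add: norm_mult)
    also have "\<dots> \<le> M * majorant x" using YM[of 0 x] x majorant_ge M0 by (intro mult_mono) auto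
    finally show "cmod (of_real (q x) * Y 0 x - 0) \<le> M * majorant x" .
  qed
  ultimately have "M \<le> 4 * (M * integral {c..d} majorant)" using e(2) by (simp add: M_def N_def)
  moreover have "M * integral {c..d} majorant < M * (1/4)" if "M \<noteq> 0"
    using small M0 that by (intro mult_strict_left_mono) auto
  ultimately have "M = 0" using M0 by fastforce
  then show "x \<in> {c..d} \<Longrightarrow> k \<le> 3 \<Longrightarrow> Y k x = 0" using YM by fastforce
qed

lemma system_unique:
  assumes Y: "system p s q S Y (\<lambda>x. 0)" and x0: "x0 \<in> S" "\<And>k. k \<le> 3 \<Longrightarrow> Y k x0 = 0"
    and x: "x \<in> S" "k \<le> 3"
  shows "Y k x = 0"
proof -
  define A where "A = min x x0"
  define B where "B = max x x0"
  have AB: "{A..B} \<subseteq> S" using interval_subset[of A B] x(1) x0(1) by (auto simp: A_def B_def min_def max_def split: if_splits)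
  obtain \<delta> where \<delta>: "0 < \<delta>" "\<And>x y. A \<le> x \<Longrightarrow> x \<le> y \<Longrightarrow> y \<le> B \<Longrightarrow> y - x < \<delta> \<Longrightarrow> integral {x..y} majorant < 1/4"
    using small_integral[OF majorant_integrable(1)[OF AB], of "1/4"] by auto
  \<comment> \<open>Uniqueness is carried from \<open>x0\<close> to \<open>x\<close> in steps
    strictly shorter than \<open>\<delta>\<close>.\<close>
  define \<eta> where "\<eta> = \<delta> / 2"
  have \<eta>: "0 < \<eta>" "\<eta> < \<delta>" using \<delta>(1) by (auto simp: \<eta>_def)
  have "\<forall>y\<in>{A..B}. \<bar>y - x0\<bar> \<le> real n * \<eta> \<longrightarrow> (\<forall>k\<le>3. Y k y = 0)" for n
  proof (induction n)
    case 0
    then show ?case using x0(2) by simp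
  next
    case (Suc n)
    show ?case
    proof (intro ballI impI allI)
      fix y k assume y: "y \<in> {A..B}" "\<bar>y - x0\<bar> \<le> real (Suc n) * \<eta>" and k: "(k::nat) \<le> 3"
      \<comment> \<open>A point within \<open>n\<close> steps of \<open>x0\<close>, where the
        induction hypothesis applies, and at most one step short of \<open>y\<close>.\<close>
      define e where "e = (if y \<ge> x0 then max x0 (y - \<eta>) else min x0 (y + \<eta>))"
      have e: "e \<in> {A..B}" "\<bar>e - x0\<bar> \<le> real n * \<eta>" "\<bar>y - e\<bar> \<le> \<eta>"
        using y \<eta>(1) by (auto simp: e_def A_def B_def min_def max_def algebra_simps split: if_splits)
      then have e0: "\<And>k. k \<le> 3 \<Longrightarrow> Y k e = 0" using Suc.IH by blast
      define c where "c = min y e"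
      define d where "d = max y e"
      have "d - c < \<delta>" using e(3) \<eta>(2) by (auto simp: c_def d_def min_def max_def)
      then have cd: "{c..d} \<subseteq> {A..B}" "integral {c..d} majorant < 1/4"
        using y(1) e(1) \<delta>(2)[of c d] by (auto simp: c_def d_def)
      show "Y k y = 0"
        by (rule system_unique_small[OF Y subset_trans[OF cd(1) AB] cd(2) _ e0 _ k]) (simp_all add: c_def d_def)
    qed
  qed
  moreover obtain n where "\<bar>x - x0\<bar> \<le> real n * \<eta>"
    using reals_Archimedean3[OF \<eta>(1)] less_imp_le by blast
  moreover have "x \<in> {A..B}" by (auto simp: A_def B_def)
  ultimately show ?thesis using x(2) by blast
qed

section \<open>Quasi-derivatives are determined by the function\<close>

lemma continuous_AE_zero:
  assumes c: "\<And>c d. {c..d} \<subseteq> S \<Longrightarrow> continuous_on {c..d} f" and ae: "AE x in lebesgue. x \<in> S \<longrightarrow> f x = (0::complex)"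
    and x: "x \<in> S"
  shows "f x = 0"
proof -
  obtain c d where cd: "c < d" "x \<in> {c..d}" "{c..d} \<subseteq> S" using surrounding_interval[OF x] .
  have cont: "continuous_on {c..d} f" using c cd(3) .
  have in_open: "f y = 0" if y: "y \<in> {c<..<d}" for y
  proof -
    have "closed {y \<in> {c..d}. f y = 0}"
      using continuous_closed_preimage_constant[OF cont] by auto
    moreover have "AE x\<in>{c<..<d} in lebesgue. x \<in> {y \<in> {c..d}. f y = 0}"
      using ae by eventually_elim (use subsetD[OF cd(3)] in auto)
    ultimately have "y \<in> {y \<in> {c..d}. f y = 0}"
      using y by (rule mem_closed_if_AE_lebesgue_open[OF open_greaterThanLessThan])
    then show ?thesis by simp
  qed
  show ?thesis
  proof (rule continuous_constant_on_closure[of "{c<..<d}" f 0])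
    show "continuous_on (closure {c<..<d}) f" using cd(1) cont by simp
    show "x \<in> closure {c<..<d}" using cd by simp
  qed (rule in_open)
qed

text \<open>The right-hand side is read off from the derivative of \<open>Y 3\<close>, so the last
  equation holds by construction; the second equation is solved for the derivative of
  \<open>Y 1\<close>, as \<open>p\<close> is nonzero almost everywhere.\<close>

lemma quasi_derivs_system:
  assumes Y: "quasi_derivs p s S Y"
  shows "system p s q S Y (\<lambda>x. of_real (q x) * Y 0 x - vector_derivative (Y 3) (at x within S))"
proof -
  have AEr: "(AE x in lebesgue_on S. P x) \<longleftrightarrow> (AE x in lebesgue. x \<in> S \<longrightarrow> P x)" for P
    using S_sets by (subst AE_restrict_space_iff) auto
  have Y': "\<forall>k\<le>3. loc_abs_cont S (Y k)" "\<forall>x\<in>S. (Y 0 has_vector_derivative Y 1 x) (at x within S)"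
    and ae: "AE x in lebesgue. x \<in> S \<longrightarrow> (\<exists>d. (Y 1 has_vector_derivative d) (at x within S) \<and> Y 2 x = of_real (p x) * d)"
     "AE x in lebesgue. x \<in> S \<longrightarrow> (\<exists>d. (Y 2 has_vector_derivative d) (at x within S) \<and> Y 3 x = - d + of_real (s x) * Y 1 x)"
     "AE x in lebesgue. x \<in> S \<longrightarrow> Y 3 differentiable (at x within S)"
    using Y unfolding quasi_derivs_def AEr by auto
  show ?thesis
    unfolding system_def
  proof (intro conjI Y')
    show "AE x in lebesgue. x \<in> S \<longrightarrow>
        (Y 1 has_vector_derivative Y 2 x / of_real (p x)) (at x within S) \<and>
        (Y 2 has_vector_derivative - Y 3 x + of_real (s x) * Y 1 x) (at x within S) \<and>
        (Y 3 has_vector_derivative of_real (q x) * Y 0 x -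
          (of_real (q x) * Y 0 x - vector_derivative (Y 3) (at x within S))) (at x within S)"
      using ae p_pos
    proof eventually_elim
      case (elim x)
      show ?case
      proof
        assume x: "x \<in> S"
        obtain d where d: "(Y 1 has_vector_derivative d) (at x within S)" "Y 2 x = of_real (p x) * d" using elim(1) x by auto
        have "p x \<noteq> 0" using elim(4) x by simp
        then have "Y 2 x / of_real (p x) = d" using d(2) by simp
        moreover obtain d' where "(Y 2 has_vector_derivative d') (at x within S)" "Y 3 x = - d' + of_real (s x) * Y 1 x"
          using elim(2) x by auto
        moreover have "(Y 3 has_vector_derivative vector_derivative (Y 3) (at x within S)) (at x within S)"
          using elim(3) x vector_derivative_works by blast
        ultimately show "(Y 1 has_vector_derivative Y 2 x / of_real (p x)) (at x within S) \<and>
        (Y 2 has_vector_derivative - Y 3 x + of_real (s x) * Y 1 x) (at x within S) \<and>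
        (Y 3 has_vector_derivative of_real (q x) * Y 0 x -
          (of_real (q x) * Y 0 x - vector_derivative (Y 3) (at x within S))) (at x within S)"
          using d(1) by simp
      qed
    qed
  qed
qed

lemma system_quasi_derivs:
  assumes Y: "system p s q S Y g"
  shows "quasi_derivs p s S Y"
proof -
  have AEr: "(AE x in lebesgue_on S. P x) \<longleftrightarrow> (AE x in lebesgue. x \<in> S \<longrightarrow> P x)" for P
    using S_sets by (subst AE_restrict_space_iff) auto
  have 1: "AE x in lebesgue. x \<in> S \<longrightarrow> (\<exists>d. (Y 1 has_vector_derivative d) (at x within S) \<and> Y 2 x = of_real (p x) * d)"
    using systemD(3)[OF Y] p_pos
    by eventually_elim (auto intro!: exI[of _ "Y 2 _ / of_real (p _)"])
  have 2: "AE x in lebesgue. x \<in> S \<longrightarrow> (\<exists>d. (Y 2 has_vector_derivative d) (at x within S) \<and> Y 3 x = - d + of_real (s x) * Y 1 x)"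
    using systemD(3)[OF Y]
    by eventually_elim (auto intro!: exI[of _ "- Y 3 _ + of_real (s _) * Y 1 _"])
  have 3: "AE x in lebesgue. x \<in> S \<longrightarrow> Y 3 differentiable (at x within S)"
    using systemD(3)[OF Y] by eventually_elim (auto intro: differentiableI_vector)
  show ?thesis
    unfolding quasi_derivs_def AEr using systemD(1,2)[OF Y] 1 2 3 by auto
qed

text \<open>The quasi-derivatives vanish one after the other: \<open>Z 1\<close> as a pointwise
  derivative, \<open>Z 2\<close> and \<open>Z 3\<close> first almost everywhere and then by
  continuity. By linearity this makes the choice in \<open>qd\<close> unique on \<open>S\<close> for
  indices up to 3.\<close>

lemma system_zero_function:
  assumes Z: "system p s q S Z g" and Z0: "\<And>x. x \<in> S \<Longrightarrow> Z 0 x = 0" and x: "x \<in> S" and k: "k \<le> 3"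
  shows "Z k x = 0" and "AE x in lebesgue. x \<in> S \<longrightarrow> g x = 0"
proof -
  have zero_deriv: "l = 0" if "(f has_vector_derivative l) (at x within S)" "x \<in> S" "\<And>y. y \<in> S \<Longrightarrow> f y = 0"
    for f :: "real \<Rightarrow> complex" and l x
  proof -
    have "((\<lambda>y. 0) has_vector_derivative l) (at x within S)"
      using has_vector_derivative_transform[OF that(2) _ that(1), of "\<lambda>y. 0"] that(3) by simp
    then show ?thesis
      using vector_derivative_unique_within[OF S_limpt[OF that(2)]] has_vector_derivative_const by blast
  qed
  have Z1: "Z 1 x = 0" if "x \<in> S" for x using zero_deriv[OF systemD(2)[OF Z that] that Z0] .
  have Z2: "Z 2 x = 0" if "x \<in> S" for x
  proof (rule continuous_AE_zero[OF _ _ that])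
    show "AE x in lebesgue. x \<in> S \<longrightarrow> Z 2 x = 0"
      using systemD(3)[OF Z] p_pos
    proof eventually_elim
      case (elim x)
      show ?case
      proof
        assume x: "x \<in> S"
        then have "Z 2 x / of_real (p x) = 0" using elim(1) zero_deriv[of "Z 1" "Z 2 x / of_real (p x)" x] x Z1 by blast
        then show "Z 2 x = 0" using elim(2) x by simp
      qed
    qed
  qed (use system_continuous[OF Z] in auto)
  have Z3: "Z 3 x = 0" if "x \<in> S" for x
  proof (rule continuous_AE_zero[OF _ _ that])
    show "AE x in lebesgue. x \<in> S \<longrightarrow> Z 3 x = 0"
      using systemD(3)[OF Z]
    proof eventually_elim
      case (elim x)
      show ?case
      proof
        assume x: "x \<in> S"
        then have "- Z 3 x + of_real (s x) * Z 1 x = 0" using elim zero_deriv[of "Z 2" "- Z 3 x + of_real (s x) * Z 1 x" x] x Z2 by blast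
        then show "Z 3 x = 0" using Z1[OF x] by simp
      qed
    qed
  qed (use system_continuous[OF Z] in auto)
  have "k = 0 \<or> k = 1 \<or> k = 2 \<or> k = 3" using k by linarith
  then show "Z k x = 0" using Z0 Z1 Z2 Z3 x by auto
  show "AE x in lebesgue. x \<in> S \<longrightarrow> g x = 0"
    using systemD(3)[OF Z]
  proof eventually_elim
    case (elim x)
    show ?case
    proof
      assume x: "x \<in> S"
      then have "of_real (q x) * Z 0 x - g x = 0" using elim zero_deriv[of "Z 3" "of_real (q x) * Z 0 x - g x" x] x Z3 by blast
      then show "g x = 0" using Z0[OF x] by simp
    qed
  qed
qed

lemma system_determined:
  assumes Y: "system p s q S Y g" and Z: "system p s q S Z h" and eq: "\<And>x. x \<in> S \<Longrightarrow> Y 0 x = Z 0 x"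
  shows "\<And>x k. x \<in> S \<Longrightarrow> k \<le> 3 \<Longrightarrow> Y k x = Z k x" and "AE x in lebesgue. x \<in> S \<longrightarrow> g x = h x"
proof -
  have D: "system p s q S (\<lambda>k x. Y k x + (-1) * Z k x) (\<lambda>x. g x + (-1) * h x)"
    by (rule system_add_cmult[OF Y Z])
  obtain x0 where x0: "x0 \<in> S" using S_nontrivial by blast
  have "Y k x + (-1) * Z k x = 0" if "x \<in> S" "k \<le> 3" for x k
    by (rule system_zero_function(1)[OF D _ that]) (use eq in simp)
  then show "\<And>x k. x \<in> S \<Longrightarrow> k \<le> 3 \<Longrightarrow> Y k x = Z k x" by simp
  have "AE x in lebesgue. x \<in> S \<longrightarrow> g x + (-1) * h x = 0"
    by (rule system_zero_function(2)[OF D _ x0, of 0]) (use eq in auto)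
  then show "AE x in lebesgue. x \<in> S \<longrightarrow> g x = h x" by eventually_elim simp
qed

lemma qd_props:
  assumes "y \<in> D_ell p s S"
  shows "qd p s S y 0 = y" "quasi_derivs p s S (qd p s S y)"
proof -
  have "\<exists>Y. Y 0 = y \<and> quasi_derivs p s S Y" using assms by (simp add: D_ell_def)
  from someI_ex[OF this] show "qd p s S y 0 = y" "quasi_derivs p s S (qd p s S y)" by (auto simp: qd_def)
qed

lemma qd_system:
  assumes y: "y \<in> D_ell p s S"
  shows "system p s q S (qd p s S y) (\<lambda>x. of_real (w x) * ell p s q w S y x)"
proof (rule system_cong[OF quasi_derivs_system[OF qd_props(2)[OF y]]])
  show "AE x in lebesgue. x \<in> S \<longrightarrow> of_real (w x) * ell p s q w S y x =
     of_real (q x) * qd p s S y 0 x - vector_derivative (qd p s S y 3) (at x within S)"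
    using w_pos by eventually_elim (auto simp: ell_def qd_props(1)[OF y])
qed auto

lemma ell_outside: "x \<notin> S \<Longrightarrow> ell p s q w S y x = 0"
  by (simp add: ell_def)

lemma D_ell_outside: "y \<in> D_ell p s S \<Longrightarrow> x \<notin> S \<Longrightarrow> y x = 0"
  by (simp add: D_ell_def)

text \<open>The way into \<open>D_ell\<close>: any solution of the system must agree on
  \<open>S\<close> with the family chosen by \<open>qd\<close>, so \<open>qd\<close> and
  \<open>ell\<close> can be computed from it.\<close>

lemma system_D_ell:
  assumes Y: "system p s q S Y (\<lambda>x. of_real (w x) * f x)" and y: "\<And>x. x \<in> S \<Longrightarrow> Y 0 x = y x" "\<And>x. x \<notin> S \<Longrightarrow> y x = 0"
  shows "y \<in> D_ell p s S" "\<And>k x. k \<le> 3 \<Longrightarrow> x \<in> S \<Longrightarrow> qd p s S y k x = Y k x"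
    "AE x in lebesgue. x \<in> S \<longrightarrow> ell p s q w S y x = f x"
proof -
  \<comment> \<open>\<open>D_ell\<close> requires the family to start with \<open>y\<close> on the
    whole line, whereas \<open>Y 0\<close> is known only on \<open>S\<close>.\<close>
  have Y': "system p s q S (Y(0 := y)) (\<lambda>x. of_real (w x) * f x)"
    by (rule system_cong[OF Y]) (use y in \<open>auto\<close>)
  from system_quasi_derivs[OF this] y(2) show yD: "y \<in> D_ell p s S"
    unfolding D_ell_def by (auto intro!: exI[of _ "Y(0 := y)"])
  have eq: "qd p s S y 0 x = Y 0 x" if "x \<in> S" for x using qd_props(1)[OF yD] y(1)[OF that] by simp
  show "\<And>k x. k \<le> 3 \<Longrightarrow> x \<in> S \<Longrightarrow> qd p s S y k x = Y k x"
    using system_determined(1)[OF qd_system[OF yD] Y eq] by blast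
  have "AE x in lebesgue. x \<in> S \<longrightarrow> of_real (w x) * ell p s q w S y x = of_real (w x) * f x"
    by (rule system_determined(2)[OF qd_system[OF yD] Y eq])
  with w_pos show "AE x in lebesgue. x \<in> S \<longrightarrow> ell p s q w S y x = f x" by eventually_elim auto
qed

lemma D_ell_combination:
  assumes y: "y \<in> D_ell p s S" and z: "z \<in> D_ell p s S"
  shows "(\<lambda>x. c * y x + d * z x) \<in> D_ell p s S"
    "\<And>k x. k \<le> 3 \<Longrightarrow> x \<in> S \<Longrightarrow> qd p s S (\<lambda>x. c * y x + d * z x) k x = c * qd p s S y k x + d * qd p s S z k x"
    "AE x in lebesgue. x \<in> S \<longrightarrow> ell p s q w S (\<lambda>x. c * y x + d * z x) x = c * ell p s q w S y x + d * ell p s q w S z x"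
proof -
  have sys: "system p s q S (\<lambda>k x. c * qd p s S y k x + d * qd p s S z k x)
     (\<lambda>x. of_real (w x) * (c * ell p s q w S y x + d * ell p s q w S z x))"
    using system_combination[OF qd_system[OF y] qd_system[OF z], of c d] by (simp add: algebra_simps)
  have 1: "c * qd p s S y 0 x + d * qd p s S z 0 x = c * y x + d * z x" for x
    by (simp add: qd_props(1)[OF y] qd_props(1)[OF z])
  have 2: "c * y x + d * z x = 0" if "x \<notin> S" for x using D_ell_outside[OF y that] D_ell_outside[OF z that] by simp
  note * = system_D_ell[OF sys 1 2]
  show "(\<lambda>x. c * y x + d * z x) \<in> D_ell p s S"
    "\<And>k x. k \<le> 3 \<Longrightarrow> x \<in> S \<Longrightarrow> qd p s S (\<lambda>x. c * y x + d * z x) k x = c * qd p s S y k x + d * qd p s S z k x"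
    "AE x in lebesgue. x \<in> S \<longrightarrow> ell p s q w S (\<lambda>x. c * y x + d * z x) x = c * ell p s q w S y x + d * ell p s q w S z x"
    using * by blast+
qed

lemma D_ell_add_cmult:
  assumes y: "y \<in> D_ell p s S" and z: "z \<in> D_ell p s S"
  shows "(\<lambda>x. y x + c * z x) \<in> D_ell p s S"
    "\<And>k x. k \<le> 3 \<Longrightarrow> x \<in> S \<Longrightarrow> qd p s S (\<lambda>x. y x + c * z x) k x = qd p s S y k x + c * qd p s S z k x"
    "AE x in lebesgue. x \<in> S \<longrightarrow> ell p s q w S (\<lambda>x. y x + c * z x) x = ell p s q w S y x + c * ell p s q w S z x"
  using D_ell_combination[OF assms, where c = 1 and d = c] by simp_all

lemma AE_on_iff: "(AE x in lebesgue_on S. P x) \<longleftrightarrow> (AE x in lebesgue. x \<in> S \<longrightarrow> P x)"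
  using S_sets by (subst AE_restrict_space_iff) auto

lemma eigenspace_iff:
  "y \<in> eigenspace p s q w S D \<mu> \<longleftrightarrow> y \<in> D \<and> (AE x in lebesgue. x \<in> S \<longrightarrow> ell p s q w S y x = \<mu> * y x)"
  by (simp add: eigenspace_def AE_on_iff)

lemma coeffs_subinterval:
  assumes "c < d" "{c..d} \<subseteq> S"
  shows "quasi_coeffs p s q w {c..d}"
proof
  show "is_interval {c..d}" by (rule is_interval_cc)
  show "\<exists>u\<in>{c..d}. \<exists>v\<in>{c..d}. u < v" using assms(1) by (intro bexI[of _ c] bexI[of _ d]) auto
  show "AE x in lebesgue. x \<in> {c..d} \<longrightarrow> 0 < p x" using p_pos by eventually_elim (use subsetD[OF assms(2)] in auto)
  show "AE x in lebesgue. x \<in> {c..d} \<longrightarrow> 0 < w x" using w_pos by eventually_elim (use subsetD[OF assms(2)] in auto)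
qed (use L1_loc_subset[OF _ assms(2)] p_loc s_loc q_loc w_loc in auto)

lemma coeffs_shift: "quasi_coeffs p s (\<lambda>x. q x - \<mu> * w x) w S"
proof
  have "(\<lambda>x. q x - \<mu> * w x) absolutely_integrable_on {c..d}" if "{c..d} \<subseteq> S" for c d
  proof -
    have "q absolutely_integrable_on {c..d}" "w absolutely_integrable_on {c..d}"
      using q_loc w_loc that unfolding L1_loc_def by blast+
    then show ?thesis
      by (intro set_integral_diff(1) set_integrable_mult_right)
  qed
  then show "L1_loc S (\<lambda>x. q x - \<mu> * w x)" by (simp add: L1_loc_def)
qed (rule S_interval S_nontrivial S_sets p_loc s_loc w_loc p_pos w_pos)+

lemma restr_D_ell:
  assumes y: "y \<in> D_ell p s S" and K: "c < d" "{c..d} \<subseteq> S"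
  shows "restr {c..d} y \<in> D_ell p s {c..d}"
    "\<And>k x. k \<le> 3 \<Longrightarrow> x \<in> {c..d} \<Longrightarrow> qd p s {c..d} (restr {c..d} y) k x = qd p s S y k x"
    "AE x in lebesgue. x \<in> {c..d} \<longrightarrow> ell p s q w {c..d} (restr {c..d} y) x = ell p s q w S y x"
proof -
  interpret K: quasi_coeffs p s q w "{c..d}" by (rule coeffs_subinterval[OF K])
  have sys: "system p s q {c..d} (qd p s S y) (\<lambda>x. of_real (w x) * ell p s q w S y x)"
    by (rule system_subset[OF qd_system[OF y] K(2)])
  have 1: "qd p s S y 0 x = restr {c..d} y x" if "x \<in> {c..d}" for x using that by (simp add: restr_def qd_props(1)[OF y])
  have 2: "restr {c..d} y x = 0" if "x \<notin> {c..d}" for x using that unfolding restr_def by (rule if_not_P)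
  note * = K.system_D_ell[OF sys 1 2]
  show "restr {c..d} y \<in> D_ell p s {c..d}"
    "\<And>k x. k \<le> 3 \<Longrightarrow> x \<in> {c..d} \<Longrightarrow> qd p s {c..d} (restr {c..d} y) k x = qd p s S y k x"
    "AE x in lebesgue. x \<in> {c..d} \<longrightarrow> ell p s q w {c..d} (restr {c..d} y) x = ell p s q w S y x"
    using * by blast+
qed

text \<open>With the eigenvalue moved into the coefficient \<open>q\<close>, the equation becomes
  homogeneous and uniqueness for initial values applies to eigenfunctions.\<close>

lemma eigen_system:
  assumes "y \<in> D_ell p s S" "AE x in lebesgue. x \<in> S \<longrightarrow> ell p s q w S y x = of_real \<mu> * y x"
  shows "system p s (\<lambda>x. q x - \<mu> * w x) S (qd p s S y) (\<lambda>x. 0)"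
proof -
  note sys = qd_system[OF assms(1)]
  show ?thesis
    unfolding system_def
  proof (intro conjI)
    show "AE x in lebesgue. x \<in> S \<longrightarrow>
        (qd p s S y 1 has_vector_derivative qd p s S y 2 x / of_real (p x)) (at x within S) \<and>
        (qd p s S y 2 has_vector_derivative - qd p s S y 3 x + of_real (s x) * qd p s S y 1 x) (at x within S) \<and>
        (qd p s S y 3 has_vector_derivative of_real (q x - \<mu> * w x) * qd p s S y 0 x - 0) (at x within S)"
      using systemD(3)[OF sys] assms(2)
    proof eventually_elim
      case (elim x)
      have "of_real (q x - \<mu> * w x) * qd p s S y 0 x - 0
        = of_real (q x) * qd p s S y 0 x - of_real (w x) * ell p s q w S y x" if "x \<in> S"
        using elim(2) that by (simp add: qd_props(1)[OF assms(1)] algebra_simps)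
      then show ?case using elim(1) by auto
    qed
  qed (use systemD(1,2)[OF sys] in auto)
qed

end

section \<open>The inverse operator\<close>

lemma bracket_cong:
  assumes "\<And>k. k \<le> 3 \<Longrightarrow> F k x = F' k x" "\<And>k. k \<le> 3 \<Longrightarrow> G k x = G' k x"
  shows "bracket F G x = bracket F' G' x"
  using assms by (simp add: bracket_def)

lemma bracket_combination_left:
  "bracket (\<lambda>k x. c * F k x + d * G k x) H x = c * bracket F H x + d * bracket G H x"
  by (simp add: bracket_def algebra_simps)

lemma bracket_combination_right:
  "bracket H (\<lambda>k x. c * F k x + d * G k x) x = cnj c * bracket H F x + cnj d * bracket H G x"
  by (simp add: bracket_def algebra_simps)

lemma bracket_skew: "bracket G F x = - cnj (bracket F G x)"
  by (simp add: bracket_def algebra_simps)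

text \<open>Cramer's rule. If the determinant were 0, the pairs \<open>(m21, - m11)\<close> and then
  \<open>(m22, - m12)\<close> would solve the homogeneous system, all entries would vanish, and
  \<open>(1, 0)\<close> would be a solution too.\<close>

lemma two_by_two_dual:
  fixes m11 m12 m21 m22 :: complex
  assumes "\<And>c d. c * m11 + d * m21 = 0 \<Longrightarrow> c * m12 + d * m22 = 0 \<Longrightarrow> c = 0 \<and> d = 0"
  shows "\<exists>c d. c * m11 + d * m21 = 1 \<and> c * m12 + d * m22 = 0"
    "\<exists>c d. c * m11 + d * m21 = 0 \<and> c * m12 + d * m22 = 1"
proof -
  define \<Delta> where "\<Delta> = m11 * m22 - m12 * m21"
  have \<Delta>: "\<Delta> \<noteq> 0"
  proof
    assume "\<Delta> = 0"
    then have "m21 = 0 \<and> - m11 = 0" by (intro assms) (auto simp: \<Delta>_def algebra_simps)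
    moreover from this have "m22 = 0 \<and> - m12 = 0" by (intro assms) (auto simp: algebra_simps)
    ultimately show False using assms[of 1 0] by auto
  qed
  then show "\<exists>c d. c * m11 + d * m21 = 1 \<and> c * m12 + d * m22 = 0"
    by (intro exI[of _ "m22 / \<Delta>"] exI[of _ "- m12 / \<Delta>"])
       (simp add: divide_simps, simp add: \<Delta>_def algebra_simps)
  show "\<exists>c d. c * m11 + d * m21 = 0 \<and> c * m12 + d * m22 = 1"
    using \<Delta> by (intro exI[of _ "- m21 / \<Delta>"] exI[of _ "m11 / \<Delta>"])
       (simp add: divide_simps, simp add: \<Delta>_def algebra_simps)
qed

text \<open>The four values of \<open>U\<close> at \<open>x\<close> are expanded in dual bases of two complementary Lagrangian planes of the
  bracket.\<close>

lemma lagrangian_expansion: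
  fixes U F1 F2 G1 G2 :: "nat \<Rightarrow> real \<Rightarrow> complex"
  assumes F: "bracket F1 F1 x = 0" "bracket F1 F2 x = 0" "bracket F2 F2 x = 0"
    and G: "bracket G1 G1 x = 0" "bracket G1 G2 x = 0" "bracket G2 G2 x = 0"
    and GF: "bracket G1 F1 x = 1" "bracket G1 F2 x = 0" "bracket G2 F1 x = 0" "bracket G2 F2 x = 1"
    and k: "k \<le> 3"
  shows "U k x = bracket U F1 x * G1 k x + bracket U F2 x * G2 k x - bracket U G1 x * F1 k x - bracket U G2 x * F2 k x"
proof -
  have F': "bracket F2 F1 x = 0" and G': "bracket G2 G1 x = 0"
    and FG: "bracket F1 G1 x = -1" "bracket F2 G1 x = 0" "bracket F1 G2 x = 0" "bracket F2 G2 x = -1"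
    using F G GF bracket_skew[of F2 F1] bracket_skew[of G2 G1] bracket_skew[of F1 G1] bracket_skew[of F2 G1]
      bracket_skew[of F1 G2] bracket_skew[of F2 G2] by simp_all
  \<comment> \<open>Five vectors with four coordinates are linearly dependent; pairing the
    dependence with the dual bases determines its coefficients up to the factor
    \<open>c 0\<close>.\<close>
  define V where "V e = (if e = 0 then U else if e = 1 then F1 else if e = 2 then F2 else if e = (3::nat) then G1 else G2)" for e
  obtain c where c: "\<exists>e\<in>{..4::nat}. c e \<noteq> 0" "\<And>k. k \<in> {..3::nat} \<Longrightarrow> (\<Sum>e\<in>{..4}. c e * V e k x) = 0"
    using homogeneous_system_nontrivial[of "{..3::nat}" "{..4::nat}" "\<lambda>e k. V e k x"] by auto
  have s5: "(\<Sum>e\<in>{..4::nat}. f e) = f 0 + f 1 + f 2 + f 3 + f 4" for f :: "nat \<Rightarrow> complex"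
    by (simp add: numeral_eq_Suc)
  have lin: "c 0 * U k x + c 1 * F1 k x + c 2 * F2 k x + c 3 * G1 k x + c 4 * G2 k x = 0" if "k \<le> 3" for k
    using c(2)[of k] that unfolding s5 by (simp add: V_def)
  have pair: "c 0 * bracket U H x + c 1 * bracket F1 H x + c 2 * bracket F2 H x + c 3 * bracket G1 H x + c 4 * bracket G2 H x = 0" for H
  proof -
    have "c 0 * bracket U H x + c 1 * bracket F1 H x + c 2 * bracket F2 H x + c 3 * bracket G1 H x + c 4 * bracket G2 H x
      = bracket (\<lambda>k x. c 0 * U k x + c 1 * F1 k x + c 2 * F2 k x + c 3 * G1 k x + c 4 * G2 k x) H x"
      by (simp add: bracket_def algebra_simps)
    also have "\<dots> = bracket (\<lambda>k x. 0) H x" by (rule bracket_cong) (use lin in auto)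
    finally show ?thesis by (simp add: bracket_def)
  qed
  have c3: "c 3 = - c 0 * bracket U F1 x" and c4: "c 4 = - c 0 * bracket U F2 x"
    and c1: "c 1 = c 0 * bracket U G1 x" and c2: "c 2 = c 0 * bracket U G2 x"
    using pair[of F1] pair[of F2] pair[of G1] pair[of G2] F G GF F' G' FG by (simp_all add: add_eq_0_iff)
  \<comment> \<open>The other four coefficients are multiples of \<open>c 0\<close>, so it cannot
    vanish.\<close>
  have "c 0 \<noteq> 0"
  proof
    assume "c 0 = 0"
    then have "c 0 = 0" "c 1 = 0" "c 2 = 0" "c 3 = 0" "c 4 = 0" using c1 c2 c3 c4 by auto
    moreover obtain e where "e \<le> 4" "c e \<noteq> 0" using c(1) by auto
    moreover have "e = 0 \<or> e = 1 \<or> e = 2 \<or> e = 3 \<or> e = 4" using \<open>e \<le> 4\<close> by linarith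
    ultimately show False by auto
  qed
  have "c 0 * (U k x - (bracket U F1 x * G1 k x + bracket U F2 x * G2 k x - bracket U G1 x * F1 k x - bracket U G2 x * F2 k x)) = 0"
    using lin[OF k] unfolding c1 c2 c3 c4 by (simp add: algebra_simps)
  then show ?thesis using \<open>c 0 \<noteq> 0\<close> by simp
qed

lemma diagonal_convergence:
  fixes v :: "nat \<Rightarrow> nat \<Rightarrow> complex"
  assumes bd: "\<And>m n. cmod (v m n) \<le> M n"
  shows "\<exists>r. strict_mono (r::nat\<Rightarrow>nat) \<and> (\<forall>n. convergent (\<lambda>m. v (r m) n))"
proof -
  interpret subseqs "\<lambda>n r. convergent (\<lambda>m. v (r m) n)"
  proof
    fix n and s :: "nat \<Rightarrow> nat" assume "strict_mono s"
    have "bounded (range (\<lambda>m. v (s m) n))" using bd unfolding bounded_iff by auto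
    then obtain l r where r: "strict_mono (r::nat\<Rightarrow>nat)" "((\<lambda>m. v (s m) n) \<circ> r) \<longlonglongrightarrow> l"
      using bounded_imp_convergent_subsequence by blast
    then have "convergent (\<lambda>m. v ((s \<circ> r) m) n)" by (auto simp: convergent_def o_def)
    then show "\<exists>r'. strict_mono r' \<and> convergent (\<lambda>m. v ((s \<circ> r') m) n)" using r(1) by blast
  qed
  have "convergent (\<lambda>m. v (diagseq m) n)" for n
  proof -
    \<comment> \<open>The diagonal sequence is a subsequence of the one selected for
      \<open>n\<close> only after its first \<open>Suc n\<close> terms; these do not affect
      convergence.\<close>
    have "convergent (\<lambda>m. v ((diagseq \<circ> (+) (Suc n)) m) n)"
    proof (rule diagseq_holds)
      fix r s :: "nat \<Rightarrow> nat" and n assume "strict_mono r" "convergent (\<lambda>m. v (s m) n)"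
      then show "convergent (\<lambda>m. v ((s \<circ> r) m) n)"
        using convergent_subseq_convergent[of "\<lambda>m. v (s m) n" r] by (simp add: o_def)
    qed
    then have "convergent (\<lambda>m. v (diagseq (m + Suc n)) n)" by (simp add: add.commute)
    then show ?thesis using convergent_ignore_initial_segment[of "\<lambda>m. v (diagseq m) n" "Suc n"] by simp
  qed
  then show ?thesis using subseq_diagseq by blast
qed

text \<open>Removes the extended real end points from the argument. A boundary limit 0 enters only
  through small values of the bracket beyond every given point, and membership in \<open>D\<close>
  is needed only when all brackets vanish identically. The last four assumptions are what
  self-adjointness, a trivial kernel and 0 in the resolvent set provide.\<close>

locale boundary_setting = quasi_coeffs p s q w S + W: weight w S
  for p s q w :: "real \<Rightarrow> real" and S :: "real set" +
  fixes D :: "(real \<Rightarrow> complex) set" and \<phi>1 \<phi>2 \<psi>1 \<psi>2 :: "real \<Rightarrow> complex"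
  assumes S_open: "open S"
    and D_D_max: "D \<subseteq> D_max p s q w S" and D_subspace: "cfun.subspace D"
    and sol: "{\<phi>1, \<phi>2, \<psi>1, \<psi>2} \<subseteq> solutions p s q w S 0 \<inter> L2w w S"
    and \<psi>_indep: "\<And>c d. (\<And>x. c * \<psi>1 x + d * \<psi>2 x = 0) \<Longrightarrow> c = 0 \<and> d = 0"
    and \<phi>_iso: "\<And>x. x \<in> S \<Longrightarrow> bracket (qd p s S \<phi>1) (qd p s S \<phi>1) x = 0"
      "\<And>x. x \<in> S \<Longrightarrow> bracket (qd p s S \<phi>1) (qd p s S \<phi>2) x = 0"
      "\<And>x. x \<in> S \<Longrightarrow> bracket (qd p s S \<phi>2) (qd p s S \<phi>2) x = 0"
    and \<psi>_iso: "\<And>x. x \<in> S \<Longrightarrow> bracket (qd p s S \<psi>1) (qd p s S \<psi>1) x = 0"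
      "\<And>x. x \<in> S \<Longrightarrow> bracket (qd p s S \<psi>1) (qd p s S \<psi>2) x = 0"
      "\<And>x. x \<in> S \<Longrightarrow> bracket (qd p s S \<psi>2) (qd p s S \<psi>2) x = 0"
    and left_bc: "\<And>y x \<epsilon> \<phi>. \<lbrakk>y \<in> D; x \<in> S; (0::real) < \<epsilon>; \<phi> \<in> {\<phi>1, \<phi>2}\<rbrakk> \<Longrightarrow>
        \<exists>\<alpha>\<in>S. \<alpha> < x \<and> cmod (bracket (qd p s S y) (qd p s S \<phi>) \<alpha>) < \<epsilon>"
    and right_bc: "\<And>y x \<epsilon> \<psi>. \<lbrakk>y \<in> D; x \<in> S; (0::real) < \<epsilon>; \<psi> \<in> {\<psi>1, \<psi>2}\<rbrakk> \<Longrightarrow>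
        \<exists>\<beta>\<in>S. x < \<beta> \<and> cmod (bracket (qd p s S y) (qd p s S \<psi>) \<beta>) < \<epsilon>"
    and D_mem: "\<And>y. \<lbrakk>y \<in> D_max p s q w S;
        \<And>x z. \<lbrakk>x \<in> S; z \<in> {\<phi>1, \<phi>2, \<psi>1, \<psi>2}\<rbrakk> \<Longrightarrow> bracket (qd p s S y) (qd p s S z) x = 0\<rbrakk> \<Longrightarrow> y \<in> D"
    and surj: "\<And>f. f \<in> L2w w S \<Longrightarrow> \<exists>y\<in>D. AE x in lebesgue. x \<in> S \<longrightarrow> ell p s q w S y x = f x"
    and inj: "\<And>y. \<lbrakk>y \<in> D; AE x in lebesgue. x \<in> S \<longrightarrow> ell p s q w S y x = 0\<rbrakk> \<Longrightarrow> y = 0"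
    and D_sym: "\<And>y z. \<lbrakk>y \<in> D; z \<in> D\<rbrakk> \<Longrightarrow> inner_w w S (ell p s q w S y) z = inner_w w S y (ell p s q w S z)"
    and D_bdd: "\<exists>C. \<forall>y\<in>D. norm_w w S y \<le> C * norm_w w S (ell p s q w S y)"
begin

abbreviation Q :: "(real \<Rightarrow> complex) \<Rightarrow> nat \<Rightarrow> real \<Rightarrow> complex" where "Q \<equiv> qd p s S"
abbreviation lop :: "(real \<Rightarrow> complex) \<Rightarrow> real \<Rightarrow> complex" where "lop \<equiv> ell p s q w S"

lemma D_maxD:
  assumes "y \<in> D_max p s q w S"
  shows "y \<in> D_ell p s S" "y \<in> L2w w S" "lop y \<in> L2w w S"
  using assms by (auto simp: D_max_def)

lemma DD:
  assumes "y \<in> D"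
  shows "y \<in> D_ell p s S" "y \<in> L2w w S" "lop y \<in> L2w w S"
  using assms D_D_max D_maxD by auto

lemma solD:
  assumes "z \<in> {\<phi>1, \<phi>2, \<psi>1, \<psi>2}"
  shows "z \<in> D_ell p s S" "z \<in> L2w w S" "system p s q S (Q z) (\<lambda>x. 0)"
    "AE x in lebesgue. x \<in> S \<longrightarrow> lop z x = 0"
proof -
  show 1: "z \<in> D_ell p s S" "z \<in> L2w w S" using assms sol by (auto simp: eigenspace_def)
  have "z \<in> solutions p s q w S 0" using assms sol by auto
  then show ae: "AE x in lebesgue. x \<in> S \<longrightarrow> lop z x = 0" by (simp add: eigenspace_iff)
  show "system p s q S (Q z) (\<lambda>x. 0)"
    by (rule system_cong[OF qd_system[OF 1(1)]]) (use ae in \<open>auto elim: eventually_mono\<close>)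
qed

lemma bracket_increment:
  assumes y: "y \<in> D_ell p s S" and z: "z \<in> {\<phi>1, \<phi>2, \<psi>1, \<psi>2}" and cd: "c \<le> d" "c \<in> S" "d \<in> S"
  shows "((\<lambda>x. of_real (w x) * lop y x * cnj (z x)) has_integral
     bracket (Q y) (Q z) d - bracket (Q y) (Q z) c) {c..d}"
  using lagrange_identity[OF qd_system[OF y] solD(3)[OF z] cd(1) interval_subset[OF cd(2,3)]]
  by (simp add: qd_props(1)[OF solD(1)[OF z]])

lemma bracket_solutions_const:
  assumes "z \<in> {\<phi>1, \<phi>2, \<psi>1, \<psi>2}" "z' \<in> {\<phi>1, \<phi>2, \<psi>1, \<psi>2}" "x \<in> S" "x' \<in> S"
  shows "bracket (Q z) (Q z') x = bracket (Q z) (Q z') x'"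
proof -
  have *: "bracket (Q z) (Q z') d = bracket (Q z) (Q z') c" if "c \<le> d" "c \<in> S" "d \<in> S" for c d
    using lagrange_identity[OF solD(3)[OF assms(1)] solD(3)[OF assms(2)] that(1) interval_subset[OF that(2,3)]]
    by (simp add: has_integral_0_eq)
  show ?thesis using *[of x x'] *[of x' x] assms by (cases "x \<le> x'") auto
qed

text \<open>A combination of the \<psi>s annihilating the \<phi>s has vanishing brackets with all
  four solutions, and everywhere, since brackets of solutions are constant. It therefore satisfies
  the boundary conditions at both ends and lies in the kernel of \<open>L\<close>, which is
  trivial.\<close>

lemma pairing_nondegenerate:
  assumes x0: "x0 \<in> S"
    and c: "c * bracket (Q \<psi>1) (Q \<phi>1) x0 + d * bracket (Q \<psi>2) (Q \<phi>1) x0 = 0"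
      "c * bracket (Q \<psi>1) (Q \<phi>2) x0 + d * bracket (Q \<psi>2) (Q \<phi>2) x0 = 0"
  shows "c = 0 \<and> d = 0"
proof -
  define v where "v = (\<lambda>x. c * \<psi>1 x + d * \<psi>2 x)"
  have \<psi>D: "\<psi>1 \<in> D_ell p s S" "\<psi>2 \<in> D_ell p s S" using solD(1) by auto
  note comb = D_ell_combination[OF \<psi>D, where c = c and d = d, folded v_def]
  have v_ell: "AE x in lebesgue. x \<in> S \<longrightarrow> lop v x = 0"
    using comb(3) solD(4)[of \<psi>1, simplified] solD(4)[of \<psi>2, simplified] by eventually_elim auto
  have "v = (\<lambda>x. c * \<psi>1 x) + (\<lambda>x. d * \<psi>2 x)" by (simp add: v_def plus_fun_def)
  then have vL: "v \<in> L2w w S" using W.L2w_add[OF W.L2w_cmult W.L2w_cmult] solD(2) by simp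
  have "lop v \<in> L2w w S"
    by (rule W.L2w_AE[OF W.L2.H_zero]) (use v_ell in \<open>auto simp: ell_outside elim: eventually_mono\<close>)
  then have "v \<in> D_max p s q w S" using comb(1) vL by (simp add: D_max_def)
  moreover have "bracket (Q v) (Q z) x = 0" if x: "x \<in> S" and z: "z \<in> {\<phi>1, \<phi>2, \<psi>1, \<psi>2}" for x z
  proof -
    have eq: "bracket (Q v) (Q z) x = c * bracket (Q \<psi>1) (Q z) x + d * bracket (Q \<psi>2) (Q z) x"
      unfolding bracket_combination_left[symmetric] by (rule bracket_cong) (use comb(2) x in auto)
    have k: "bracket (Q \<psi>1) (Q z) x = bracket (Q \<psi>1) (Q z) x0" "bracket (Q \<psi>2) (Q z) x = bracket (Q \<psi>2) (Q z) x0"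
      using bracket_solutions_const[OF _ z x x0] by auto
    have "bracket (Q \<psi>2) (Q \<psi>1) x0 = 0"
      using bracket_skew[of "Q \<psi>2" "Q \<psi>1" x0] \<psi>_iso(2)[OF x0] by simp
    then show ?thesis unfolding eq k using z c \<psi>_iso[OF x0] by auto
  qed
  ultimately have "v \<in> D" by (rule D_mem)
  from inj[OF this v_ell] have "c * \<psi>1 x + d * \<psi>2 x = 0" for x
    unfolding v_def by (metis zero_fun_apply)
  then show ?thesis by (rule \<psi>_indep)
qed

text \<open>The \<open>a\<close> coefficients turn the \<psi>s into the basis dual to the \<phi>s
  under the bracket. They are computed at one point and serve at all points because brackets of
  solutions are constant. \<open>U\<close> is arbitrary, so the formula also applies to
  quasi-derivatives taken on a subinterval.\<close>

lemma representation:
  "\<exists>a11 a12 a21 a22. \<forall>x\<in>S. \<forall>U. \<forall>k\<le>3. U k x =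
     bracket U (Q \<phi>1) x * (a11 * Q \<psi>1 k x + a12 * Q \<psi>2 k x) + bracket U (Q \<phi>2) x * (a21 * Q \<psi>1 k x + a22 * Q \<psi>2 k x)
     - (cnj a11 * bracket U (Q \<psi>1) x + cnj a12 * bracket U (Q \<psi>2) x) * Q \<phi>1 k x
     - (cnj a21 * bracket U (Q \<psi>1) x + cnj a22 * bracket U (Q \<psi>2) x) * Q \<phi>2 k x"
proof -
  obtain x0 where x0: "x0 \<in> S" using S_nontrivial by blast
  obtain a11 a12 where a1: "a11 * bracket (Q \<psi>1) (Q \<phi>1) x0 + a12 * bracket (Q \<psi>2) (Q \<phi>1) x0 = 1"
    "a11 * bracket (Q \<psi>1) (Q \<phi>2) x0 + a12 * bracket (Q \<psi>2) (Q \<phi>2) x0 = 0"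
    using two_by_two_dual(1)[where ?m11.0 = "bracket (Q \<psi>1) (Q \<phi>1) x0" and ?m21.0 = "bracket (Q \<psi>2) (Q \<phi>1) x0"
      and ?m12.0 = "bracket (Q \<psi>1) (Q \<phi>2) x0" and ?m22.0 = "bracket (Q \<psi>2) (Q \<phi>2) x0"] pairing_nondegenerate[OF x0] by metis
  obtain a21 a22 where a2: "a21 * bracket (Q \<psi>1) (Q \<phi>1) x0 + a22 * bracket (Q \<psi>2) (Q \<phi>1) x0 = 0"
    "a21 * bracket (Q \<psi>1) (Q \<phi>2) x0 + a22 * bracket (Q \<psi>2) (Q \<phi>2) x0 = 1"
    using two_by_two_dual(2)[where ?m11.0 = "bracket (Q \<psi>1) (Q \<phi>1) x0" and ?m21.0 = "bracket (Q \<psi>2) (Q \<phi>1) x0"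
      and ?m12.0 = "bracket (Q \<psi>1) (Q \<phi>2) x0" and ?m22.0 = "bracket (Q \<psi>2) (Q \<phi>2) x0"] pairing_nondegenerate[OF x0] by metis
  have "U k x =
     bracket U (Q \<phi>1) x * (a11 * Q \<psi>1 k x + a12 * Q \<psi>2 k x) + bracket U (Q \<phi>2) x * (a21 * Q \<psi>1 k x + a22 * Q \<psi>2 k x)
     - (cnj a11 * bracket U (Q \<psi>1) x + cnj a12 * bracket U (Q \<psi>2) x) * Q \<phi>1 k x
     - (cnj a21 * bracket U (Q \<psi>1) x + cnj a22 * bracket U (Q \<psi>2) x) * Q \<phi>2 k x"
    if x: "x \<in> S" and k: "k \<le> 3" for x k U
  proof -
    have k': "bracket (Q \<psi>1) (Q \<phi>1) x = bracket (Q \<psi>1) (Q \<phi>1) x0" "bracket (Q \<psi>2) (Q \<phi>1) x = bracket (Q \<psi>2) (Q \<phi>1) x0"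
      "bracket (Q \<psi>1) (Q \<phi>2) x = bracket (Q \<psi>1) (Q \<phi>2) x0" "bracket (Q \<psi>2) (Q \<phi>2) x = bracket (Q \<psi>2) (Q \<phi>2) x0"
      using bracket_solutions_const[OF _ _ x x0] by auto
    have sk: "bracket (Q \<psi>2) (Q \<psi>1) x = 0"
      using bracket_skew[of "Q \<psi>2" "Q \<psi>1" x] \<psi>_iso(2)[OF x] by simp
    note bl = bracket_combination_left and br = bracket_combination_right
    have "U k x = bracket U (Q \<phi>1) x * (a11 * Q \<psi>1 k x + a12 * Q \<psi>2 k x) + bracket U (Q \<phi>2) x * (a21 * Q \<psi>1 k x + a22 * Q \<psi>2 k x)
      - bracket U (\<lambda>k x. a11 * Q \<psi>1 k x + a12 * Q \<psi>2 k x) x * Q \<phi>1 k x - bracket U (\<lambda>k x. a21 * Q \<psi>1 k x + a22 * Q \<psi>2 k x) x * Q \<phi>2 k x"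
      by (rule lagrangian_expansion) (use \<phi>_iso[OF x] \<psi>_iso[OF x] sk k in \<open>simp_all add: bl br k' a1 a2\<close>)
    then show ?thesis by (simp only: br)
  qed
  then show ?thesis by blast
qed

lemma brackets_zero_imp_zero:
  assumes "x \<in> S" "k \<le> 3" "\<And>z. z \<in> {\<phi>1, \<phi>2, \<psi>1, \<psi>2} \<Longrightarrow> bracket U (Q z) x = 0"
  shows "U k x = 0"
proof -
  obtain a11 a12 a21 a22 where "\<forall>x\<in>S. \<forall>U. \<forall>k\<le>3. U k x =
     bracket U (Q \<phi>1) x * (a11 * Q \<psi>1 k x + a12 * Q \<psi>2 k x) + bracket U (Q \<phi>2) x * (a21 * Q \<psi>1 k x + a22 * Q \<psi>2 k x)
     - (cnj a11 * bracket U (Q \<psi>1) x + cnj a12 * bracket U (Q \<psi>2) x) * Q \<phi>1 k x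
     - (cnj a21 * bracket U (Q \<psi>1) x + cnj a22 * bracket U (Q \<psi>2) x) * Q \<phi>2 k x"
    using representation by blast
  from this[rule_format, OF assms(1,2), of U] assms(3) show ?thesis by simp
qed

text \<open>The bridge between the gauge integrals produced by the Lagrange identity and the inner
  product, to which Cauchy-Schwarz applies.\<close>

lemma inner_restr_integral:
  assumes f: "f \<in> L2w w S" and g: "g \<in> L2w w S" and cd: "{c..d} \<subseteq> S"
    and I: "((\<lambda>x. of_real (w x) * f x * cnj (g x)) has_integral I) {c..d}"
  shows "inner_w w S (restr {c..d} f) g = I"
proof -
  have rf: "restr {c..d} f \<in> L2w w S" by (rule W.restr_in_L2w[OF f]) simp
  define h where "h x = restr {c..d} f x * cnj (g x) * complex_of_real (W.wt x)" for x
  have "integrable lebesgue h" unfolding h_def by (rule W.L2w_prod_integrable(2)[OF rf g])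
  then have 1: "(h has_integral integral\<^sup>L lebesgue h) UNIV" by (rule has_integral_integral_lebesgue)
  have 2: "((\<lambda>x. if x \<in> {c..d} then of_real (w x) * f x * cnj (g x) else 0) has_integral I) UNIV"
    unfolding has_integral_restrict_UNIV by (rule I)
  obtain N where N: "N \<in> null_sets lebesgue" "{x. \<not> (x \<in> S \<longrightarrow> W.wt x = w x \<and> 0 < W.wt x)} \<subseteq> N"
    using W.wt_eq unfolding eventually_ae_filter by auto
  have "(h has_integral I) UNIV"
  proof (rule has_integral_spike[OF _ _ 2])
    show "negligible N" using N(1) by (simp add: negligible_iff_null_sets)
    fix x assume "x \<in> UNIV - N"
    then have "x \<in> S \<longrightarrow> W.wt x = w x" using N(2) by blast
    then show "h x = (if x \<in> {c..d} then of_real (w x) * f x * cnj (g x) else 0)"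
      using subsetD[OF cd, of x] by (simp add: h_def restr_def)
  qed
  then have "integral\<^sup>L lebesgue h = I" using 1 has_integral_unique by blast
  moreover have "inner_w w S (restr {c..d} f) g = integral\<^sup>L lebesgue h"
    unfolding h_def using W.L2wD[OF rf] W.L2wD(2)[OF g] by (intro W.inner_w_eq) auto
  ultimately show ?thesis by simp
qed

lemma restr_nrm_le:
  assumes f: "f \<in> L2w w S" and K: "K \<in> sets lebesgue"
  shows "W.L2.nrm (restr K f) \<le> W.L2.nrm f"
proof (rule power2_le_imp_le)
  show "(W.L2.nrm (restr K f))\<^sup>2 \<le> (W.L2.nrm f)\<^sup>2"
    unfolding W.nrm_sq_eq[OF f] W.nrm_sq_eq[OF W.restr_in_L2w[OF f K]]
    by (rule integral_mono) (use W.L2wD(3)[OF f] W.L2wD(3)[OF W.restr_in_L2w[OF f K]] in \<open>auto simp: restr_def\<close>)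
qed (rule W.L2.nrm_nonneg[OF f])

lemma bracket_increment_bound:
  assumes y: "y \<in> D_ell p s S" "lop y \<in> L2w w S" and z: "z \<in> {\<phi>1, \<phi>2, \<psi>1, \<psi>2}" and cd: "c \<in> S" "d \<in> S"
  shows "cmod (bracket (Q y) (Q z) d - bracket (Q y) (Q z) c) \<le> W.L2.nrm (lop y) * W.L2.nrm z"
proof -
  have *: "cmod (bracket (Q y) (Q z) d - bracket (Q y) (Q z) c) \<le> W.L2.nrm (lop y) * W.L2.nrm z"
    if cd: "c \<le> d" "c \<in> S" "d \<in> S" for c d
  proof -
    note zL = solD(2)[OF z]
    have rL: "restr {c..d} (lop y) \<in> L2w w S" by (rule W.restr_in_L2w[OF y(2)]) simp
    have "inner_w w S (restr {c..d} (lop y)) z = bracket (Q y) (Q z) d - bracket (Q y) (Q z) c"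
      by (rule inner_restr_integral[OF y(2) zL interval_subset[OF cd(2,3)] bracket_increment[OF y(1) z cd]])
    then have "cmod (bracket (Q y) (Q z) d - bracket (Q y) (Q z) c) \<le> W.L2.nrm (restr {c..d} (lop y)) * W.L2.nrm z"
      using W.L2.cauchy_schwarz[OF rL zL] by simp
    also have "\<dots> \<le> W.L2.nrm (lop y) * W.L2.nrm z"
      by (intro mult_right_mono restr_nrm_le y(2) W.L2.nrm_nonneg zL) auto
    finally show ?thesis .
  qed
  show ?thesis using *[of c d] *[of d c] cd by (cases "c \<le> d") (auto simp: norm_minus_commute)
qed

text \<open>The bracket is arbitrarily small somewhere near one end point, and its increments are
  bounded by Cauchy-Schwarz independently of the two points.\<close>

lemma bracket_bound:
  assumes y: "y \<in> D" and z: "z \<in> {\<phi>1, \<phi>2, \<psi>1, \<psi>2}" and x: "x \<in> S"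
  shows "cmod (bracket (Q y) (Q z) x) \<le> W.L2.nrm (lop y) * W.L2.nrm z"
proof (rule field_le_epsilon)
  fix \<epsilon> :: real assume "0 < \<epsilon>"
  have "\<exists>\<alpha>\<in>S. cmod (bracket (Q y) (Q z) \<alpha>) < \<epsilon>"
    using left_bc[OF y x \<open>0 < \<epsilon>\<close>, of z] right_bc[OF y x \<open>0 < \<epsilon>\<close>, of z] z by auto
  then obtain \<alpha> where \<alpha>: "\<alpha> \<in> S" "cmod (bracket (Q y) (Q z) \<alpha>) < \<epsilon>" by auto
  have "cmod (bracket (Q y) (Q z) x) \<le> cmod (bracket (Q y) (Q z) x - bracket (Q y) (Q z) \<alpha>) + cmod (bracket (Q y) (Q z) \<alpha>)"
    using norm_triangle_ineq[of "bracket (Q y) (Q z) x - bracket (Q y) (Q z) \<alpha>" "bracket (Q y) (Q z) \<alpha>"] by simp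
  then show "cmod (bracket (Q y) (Q z) x) \<le> W.L2.nrm (lop y) * W.L2.nrm z + \<epsilon>"
    using bracket_increment_bound[OF DD(1)[OF y] DD(3)[OF y] z \<alpha>(1) x] \<alpha>(2) by linarith
qed

section \<open>Pointwise bounds and compactness of the inverse\<close>

definition envelope :: "nat \<Rightarrow> real \<Rightarrow> real" where
  "envelope k x = cmod (Q \<phi>1 k x) + cmod (Q \<phi>2 k x) + cmod (Q \<psi>1 k x) + cmod (Q \<psi>2 k x)"

text \<open>In \<open>representation\<close> the dependence on \<open>y\<close> sits entirely in its
  four brackets, which \<open>bracket_bound\<close> controls by the norm of \<open>lop y\<close>;
  the remaining factors are fixed solutions.\<close>

lemma pointwise_bound:
  "\<exists>C\<ge>0. \<forall>y\<in>D. \<forall>x\<in>S. \<forall>k\<le>3. cmod (Q y k x) \<le> C * W.L2.nrm (lop y) * envelope k x"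
proof -
  obtain a11 a12 a21 a22 where rep: "\<forall>x\<in>S. \<forall>U. \<forall>k\<le>3. U k x =
     bracket U (Q \<phi>1) x * (a11 * Q \<psi>1 k x + a12 * Q \<psi>2 k x) + bracket U (Q \<phi>2) x * (a21 * Q \<psi>1 k x + a22 * Q \<psi>2 k x)
     - (cnj a11 * bracket U (Q \<psi>1) x + cnj a12 * bracket U (Q \<psi>2) x) * Q \<phi>1 k x
     - (cnj a21 * bracket U (Q \<psi>1) x + cnj a22 * bracket U (Q \<psi>2) x) * Q \<phi>2 k x"
    using representation by blast
  define m where "m = W.L2.nrm \<phi>1 + W.L2.nrm \<phi>2 + W.L2.nrm \<psi>1 + W.L2.nrm \<psi>2"
  define A where "A = cmod a11 + cmod a12 + cmod a21 + cmod a22"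
  have nn: "0 \<le> W.L2.nrm \<phi>1" "0 \<le> W.L2.nrm \<phi>2" "0 \<le> W.L2.nrm \<psi>1" "0 \<le> W.L2.nrm \<psi>2"
    using W.L2.nrm_nonneg solD(2) by auto
  then have m: "0 \<le> m" "\<And>z. z \<in> {\<phi>1, \<phi>2, \<psi>1, \<psi>2} \<Longrightarrow> W.L2.nrm z \<le> m" by (auto simp: m_def)
  have A: "cmod a11 \<le> A" "cmod a12 \<le> A" "cmod a21 \<le> A" "cmod a22 \<le> A" "0 \<le> A" by (auto simp: A_def)
  have "cmod (Q y k x) \<le> (8 * A * m) * W.L2.nrm (lop y) * envelope k x" if y: "y \<in> D" and x: "x \<in> S" and k: "k \<le> 3" for y x k
  proof -
    define n where "n = W.L2.nrm (lop y) * m"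
    have n0: "0 \<le> n" using m W.L2.nrm_nonneg[OF DD(3)[OF y]] by (simp add: n_def)
    have b: "cmod (bracket (Q y) (Q z) x) \<le> n" if z: "z \<in> {\<phi>1, \<phi>2, \<psi>1, \<psi>2}" for z
    proof -
      have "cmod (bracket (Q y) (Q z) x) \<le> W.L2.nrm (lop y) * W.L2.nrm z" by (rule bracket_bound[OF y z x])
      also have "\<dots> \<le> n" unfolding n_def using m(2)[OF z] W.L2.nrm_nonneg[OF DD(3)[OF y]] by (intro mult_left_mono)
      finally show ?thesis .
    qed
    have t: "cmod (\<beta> * (\<alpha> * u + \<alpha>' * v)) \<le> n * (A * (cmod u + cmod v))"
      if "cmod \<beta> \<le> n" "cmod \<alpha> \<le> A" "cmod \<alpha>' \<le> A" for \<alpha> \<alpha>' \<beta> u v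
    proof -
      have "cmod (\<alpha> * u + \<alpha>' * v) \<le> cmod \<alpha> * cmod u + cmod \<alpha>' * cmod v"
        using norm_triangle_ineq[of "\<alpha> * u" "\<alpha>' * v"] by (simp add: norm_mult)
      also have "\<dots> \<le> A * cmod u + A * cmod v" using that by (intro add_mono mult_right_mono) auto
      finally show ?thesis unfolding norm_mult using that n0 by (intro mult_mono) (auto simp: algebra_simps)
    qed
    have t': "cmod ((\<alpha> * \<beta> + \<alpha>' * \<beta>') * u) \<le> (2 * A * n) * cmod u"
      if "cmod \<beta> \<le> n" "cmod \<beta>' \<le> n" "cmod \<alpha> \<le> A" "cmod \<alpha>' \<le> A" for \<alpha> \<alpha>' \<beta> \<beta>' u
    proof -
      have "cmod (\<alpha> * \<beta> + \<alpha>' * \<beta>') \<le> cmod \<alpha> * cmod \<beta> + cmod \<alpha>' * cmod \<beta>'"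
        using norm_triangle_ineq[of "\<alpha> * \<beta>" "\<alpha>' * \<beta>'"] by (simp add: norm_mult)
      also have "\<dots> \<le> A * n + A * n" using that A(5) by (intro add_mono mult_mono) auto
      finally show ?thesis unfolding norm_mult by (intro mult_right_mono) auto
    qed
    define r1 where "r1 = bracket (Q y) (Q \<phi>1) x * (a11 * Q \<psi>1 k x + a12 * Q \<psi>2 k x)"
    define r2 where "r2 = bracket (Q y) (Q \<phi>2) x * (a21 * Q \<psi>1 k x + a22 * Q \<psi>2 k x)"
    define r3 where "r3 = (cnj a11 * bracket (Q y) (Q \<psi>1) x + cnj a12 * bracket (Q y) (Q \<psi>2) x) * Q \<phi>1 k x"
    define r4 where "r4 = (cnj a21 * bracket (Q y) (Q \<psi>1) x + cnj a22 * bracket (Q y) (Q \<psi>2) x) * Q \<phi>2 k x"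
    have "Q y k x = r1 + r2 - r3 - r4" unfolding r1_def r2_def r3_def r4_def using rep x k by blast
    then have "cmod (Q y k x) \<le> cmod r1 + cmod r2 + cmod r3 + cmod r4"
      by (smt (verit) norm_triangle_ineq norm_triangle_ineq4)
    also have "\<dots> \<le> n * (A * (cmod (Q \<psi>1 k x) + cmod (Q \<psi>2 k x))) + n * (A * (cmod (Q \<psi>1 k x) + cmod (Q \<psi>2 k x)))
       + (2 * A * n) * cmod (Q \<phi>1 k x) + (2 * A * n) * cmod (Q \<phi>2 k x)"
      unfolding r1_def r2_def r3_def r4_def using b A by (intro add_mono t t') auto
    also have "\<dots> = 2 * A * n * envelope k x" by (simp add: envelope_def algebra_simps)
    \<comment> \<open>The estimate yields the factor 2; the constant 8 is merely generous.\<close>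
    also have "\<dots> \<le> 8 * A * n * envelope k x" using A n0 by (intro mult_right_mono) (auto simp: envelope_def)
    finally show ?thesis by (simp add: n_def mult_ac)
  qed
  moreover have "0 \<le> 8 * A * m" using A m by simp
  ultimately show ?thesis by blast
qed

text \<open>The choice is not arbitrary: by \<open>inj\<close>, two elements of \<open>D\<close>
  with the same image almost everywhere coincide as functions.\<close>

definition T :: "(real \<Rightarrow> complex) \<Rightarrow> real \<Rightarrow> complex" where
  "T f = (SOME y. y \<in> D \<and> (AE x in lebesgue. x \<in> S \<longrightarrow> lop y x = f x))"

lemma T_props:
  assumes "f \<in> L2w w S"
  shows "T f \<in> D" "AE x in lebesgue. x \<in> S \<longrightarrow> lop (T f) x = f x"
proof -
  have "\<exists>y. y \<in> D \<and> (AE x in lebesgue. x \<in> S \<longrightarrow> lop y x = f x)" using surj[OF assms] by blast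
  from someI_ex[OF this] show "T f \<in> D" "AE x in lebesgue. x \<in> S \<longrightarrow> lop (T f) x = f x"
    unfolding T_def by auto
qed

lemma D_add_cmult: "y \<in> D \<Longrightarrow> z \<in> D \<Longrightarrow> (\<lambda>x. y x + c * z x) \<in> D"
  using cfun.subspace_add[OF D_subspace _ cfun.subspace_scale[OF D_subspace], of y z c] by (simp add: plus_fun_def)

lemma T_unique:
  assumes y: "y \<in> D" and ae: "AE x in lebesgue. x \<in> S \<longrightarrow> lop y x = f x" and f: "f \<in> L2w w S"
  shows "T f = y"
proof -
  have D': "(\<lambda>x. T f x + (-1) * y x) \<in> D" using D_add_cmult T_props(1)[OF f] y by blast
  have "AE x in lebesgue. x \<in> S \<longrightarrow> lop (\<lambda>x. T f x + (-1) * y x) x = 0"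
    using D_ell_add_cmult(3)[OF DD(1)[OF T_props(1)[OF f]] DD(1)[OF y], of "-1"] T_props(2)[OF f] ae
    by eventually_elim auto
  from inj[OF D' this] have "T f x + (-1) * y x = 0" for x by (metis zero_fun_apply)
  then show ?thesis by (simp add: fun_eq_iff)
qed

lemma T_add_cmult:
  assumes f: "f \<in> L2w w S" and g: "g \<in> L2w w S"
  shows "T (\<lambda>x. f x + c * g x) = (\<lambda>x. T f x + c * T g x)"
proof (rule T_unique)
  show "(\<lambda>x. T f x + c * T g x) \<in> D" by (intro D_add_cmult T_props f g)
  show "AE x in lebesgue. x \<in> S \<longrightarrow> lop (\<lambda>x. T f x + c * T g x) x = f x + c * g x"
    using D_ell_add_cmult(3)[OF DD(1)[OF T_props(1)[OF f]] DD(1)[OF T_props(1)[OF g]], of c] T_props(2)[OF f] T_props(2)[OF g]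
    by eventually_elim auto
  show "(\<lambda>x. f x + c * g x) \<in> L2w w S"
    using W.L2w_add[OF f W.L2w_cmult[OF g]] by (simp add: plus_fun_def)
qed

lemma T_AE_zero:
  assumes "f \<in> L2w w S" "AE x in lebesgue. x \<in> S \<longrightarrow> f x = 0"
  shows "T f = 0"
proof (rule inj[OF T_props(1)[OF assms(1)]])
  show "AE x in lebesgue. x \<in> S \<longrightarrow> lop (T f) x = 0"
    using T_props(2)[OF assms(1)] assms(2) by eventually_elim auto
qed

lemma nrm_lop_T:
  assumes f: "f \<in> L2w w S"
  shows "W.L2.nrm (lop (T f)) = W.L2.nrm f"
  unfolding W.L2.nrm_def
  using W.inner_w_AE[OF DD(3)[OF T_props(1)[OF f]] f DD(3)[OF T_props(1)[OF f]] f T_props(2)[OF f] T_props(2)[OF f]] by simp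

lemma T_sym:
  assumes f: "f \<in> L2w w S" and g: "g \<in> L2w w S"
  shows "inner_w w S (T f) g = inner_w w S f (T g)"
proof -
  note Tf = T_props[OF f] and Tg = T_props[OF g]
  have "inner_w w S (T f) g = inner_w w S (T f) (lop (T g))"
    by (rule W.inner_w_AE) (use DD Tf Tg f g in \<open>auto elim: eventually_mono\<close>)
  also have "\<dots> = inner_w w S (lop (T f)) (T g)" using D_sym Tf(1) Tg(1) by simp
  also have "\<dots> = inner_w w S f (T g)"
    by (rule W.inner_w_AE) (use DD Tf Tg f g in \<open>auto elim: eventually_mono\<close>)
  finally show ?thesis .
qed

lemma envelope_L2w: "(\<lambda>x. complex_of_real (if x \<in> S then envelope 0 x else 0)) \<in> L2w w S"
proof -
  have a: "(\<lambda>x. complex_of_real (cmod (z x))) \<in> L2w w S" if "z \<in> {\<phi>1, \<phi>2, \<psi>1, \<psi>2}" for z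
  proof -
    note z = W.L2wD[OF solD(2)[OF that]]
    have "(\<lambda>x. complex_of_real (cmod (z x))) \<in> borel_measurable lebesgue" using z(2) by measurable
    then show ?thesis using z by (simp add: W.L2w_iff)
  qed
  have "(\<lambda>x. complex_of_real (if x \<in> S then envelope 0 x else 0)) =
     (\<lambda>x. complex_of_real (cmod (\<phi>1 x))) + (\<lambda>x. complex_of_real (cmod (\<phi>2 x))) +
     (\<lambda>x. complex_of_real (cmod (\<psi>1 x))) + (\<lambda>x. complex_of_real (cmod (\<psi>2 x)))"
  proof
    fix x
    have q: "Q \<phi>1 0 = \<phi>1" "Q \<phi>2 0 = \<phi>2" "Q \<psi>1 0 = \<psi>1" "Q \<psi>2 0 = \<psi>2"
      by (rule qd_props(1)[OF solD(1)], simp)+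
    have "\<phi>1 x = 0" "\<phi>2 x = 0" "\<psi>1 x = 0" "\<psi>2 x = 0" if "x \<notin> S"
      by (rule W.L2wD(1)[OF solD(2) that], simp)+
    then show "complex_of_real (if x \<in> S then envelope 0 x else 0) =
      ((\<lambda>x. complex_of_real (cmod (\<phi>1 x))) + (\<lambda>x. complex_of_real (cmod (\<phi>2 x))) +
       (\<lambda>x. complex_of_real (cmod (\<psi>1 x))) + (\<lambda>x. complex_of_real (cmod (\<psi>2 x)))) x"
      by (cases "x \<in> S") (simp_all add: envelope_def q)
  qed
  also have "\<dots> \<in> L2w w S" by (intro W.L2w_add a) simp_all
  finally show ?thesis .
qed

lemma rational_near:
  assumes "x \<in> S" "0 < (\<epsilon>::real)"
  shows "\<exists>t\<in>\<rat> \<inter> S. \<bar>x - t\<bar> < \<epsilon>"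
proof -
  obtain e where e: "0 < e" "ball x e \<subseteq> S" using S_open assms(1) openE by blast
  obtain t where t: "t \<in> \<rat>" "x < t" "t < x + min e \<epsilon>"
    using Rats_dense_in_real[of x "x + min e \<epsilon>"] e(1) assms(2) by auto
  then have "t \<in> ball x e" by (simp add: dist_real_def)
  then show ?thesis using t e(2) by (intro bexI[of _ t]) auto
qed

text \<open>The images are uniformly bounded by the envelope and uniformly Lipschitz on compact subintervals,
  so convergence at the rational points gives pointwise convergence, hence convergence in norm.\<close>

lemma T_compact:
  assumes fs: "\<And>n::nat. fs n \<in> L2w w S" and B: "\<And>n. W.L2.nrm (fs n) \<le> B"
  shows "\<exists>(r::nat\<Rightarrow>nat) z. strict_mono r \<and> z \<in> L2w w S \<and> (\<lambda>n. W.L2.nrm (T (fs (r n)) - z)) \<longlonglongrightarrow> 0"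
proof -
  obtain C where C: "0 \<le> C" "\<And>y x k. y \<in> D \<Longrightarrow> x \<in> S \<Longrightarrow> k \<le> 3 \<Longrightarrow> cmod (Q y k x) \<le> C * W.L2.nrm (lop y) * envelope k x"
    using pointwise_bound by blast
  define u where "u n = T (fs n)" for n
  have uD: "u n \<in> D" for n unfolding u_def by (rule T_props(1)[OF fs])
  have env0: "0 \<le> envelope k x" for k x by (simp add: envelope_def)
  have ub: "cmod (Q (u n) k x) \<le> C * B * envelope k x" if "x \<in> S" "k \<le> 3" for n k x
  proof -
    have "cmod (Q (u n) k x) \<le> C * W.L2.nrm (lop (u n)) * envelope k x" using C(2) uD that by blast
    also have "\<dots> \<le> C * B * envelope k x"
      unfolding u_def nrm_lop_T[OF fs] using B C(1) env0 by (intro mult_right_mono mult_left_mono) auto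
    finally show ?thesis .
  qed
  have u0: "Q (u n) 0 = u n" for n by (rule qd_props(1)[OF DD(1)[OF uD]])
  have ne: "\<rat> \<inter> S \<noteq> {}" using rational_near[of _ 1] S_nontrivial by fastforce
  have cnt: "countable (\<rat> \<inter> S)" using countable_rat by blast
  define t where "t = from_nat_into (\<rat> \<inter> S)"
  have tS: "t n \<in> \<rat> \<inter> S" for n unfolding t_def by (rule from_nat_into[OF ne])
  have "cmod (u m (t n)) \<le> C * B * envelope 0 (t n)" for m n
    using ub[of "t n" 0 m] tS[of n] unfolding u0 by simp
  then obtain r where r: "strict_mono (r::nat\<Rightarrow>nat)" "\<And>n. convergent (\<lambda>m. u (r m) (t n))"
    using diagonal_convergence[of "\<lambda>m n. u m (t n)" "\<lambda>n. C * B * envelope 0 (t n)"] by auto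
  have conv_rat: "convergent (\<lambda>m. u (r m) y)" if "y \<in> \<rat> \<inter> S" for y
    using r(2) from_nat_into_surj[OF cnt that] by (auto simp: t_def)
  have B0: "0 \<le> B" using B[of 0] W.L2.nrm_nonneg[OF fs, of 0] by linarith
  have conv: "convergent (\<lambda>m. u (r m) x)" if x: "x \<in> S" for x
  proof -
    obtain e where e: "0 < e" "cball x e \<subseteq> S" using S_open x open_contains_cball by blast
    have sub: "{x-e..x+e} \<subseteq> S" using e(2) by (simp add: cball_eq_atLeastAtMost)
    have "continuous_on {x-e..x+e} (envelope 1)"
      unfolding envelope_def by (intro continuous_intros system_continuous[OF solD(3) _ sub]) auto
    then have "bounded (envelope 1 ` {x-e..x+e})" by (intro compact_imp_bounded compact_continuous_image) auto
    then obtain L where "\<forall>v\<in>envelope 1 ` {x-e..x+e}. norm v \<le> L" unfolding bounded_iff by blast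
    then have L: "envelope 1 y \<le> L" if "y \<in> {x-e..x+e}" for y
      using bspec[OF _ imageI[OF that], of "envelope 1" "\<lambda>v. norm v \<le> L"] abs_ge_self[of "envelope 1 y"] by simp
    have L0: "0 \<le> L" using L[of x] env0[of 1 x] e(1) by simp
    define M where "M = C * B * L"
    have M0: "0 \<le> M" using C(1) B0 L0 by (simp add: M_def)
    \<comment> \<open>The derivative of \<open>u n\<close> is its first quasi-derivative, which the
      envelope of order 1 bounds on the compact interval uniformly in \<open>n\<close>.\<close>
    have lip: "cmod (u n d - u n c) \<le> M * (d - c)" if "c \<le> d" "{c..d} \<subseteq> {x-e..x+e}" for n c d
    proof -
      have "(Q (u n) 1 has_integral Q (u n) 0 d - Q (u n) 0 c) (cbox c d)"
        using system_integrals(1)[OF qd_system[OF DD(1)[OF uD]] that(1) subset_trans[OF that(2) sub]]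
        unfolding box_real .
      moreover have "cmod (Q (u n) 1 y) \<le> M" if y: "y \<in> cbox c d" for y
      proof -
        have y': "y \<in> {x-e..x+e}" using y \<open>{c..d} \<subseteq> _\<close> by auto
        have "cmod (Q (u n) 1 y) \<le> C * B * envelope 1 y" using ub[of y 1 n] y' sub by auto
        also have "\<dots> \<le> M" unfolding M_def using L[OF y'] C(1) B0 by (intro mult_left_mono) auto
        finally show ?thesis .
      qed
      ultimately have "cmod (Q (u n) 0 d - Q (u n) 0 c) \<le> M * measure lborel (cbox c d)"
        by (intro has_integral_bound[OF M0])
      then show ?thesis using that(1) by (simp add: u0)
    qed
    have "Cauchy (\<lambda>m. u (r m) x)"
    proof (rule metric_CauchyI)
      fix \<epsilon> :: real assume \<epsilon>: "0 < \<epsilon>"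
      \<comment> \<open>Staying within \<open>e\<close> keeps the rational point where the Lipschitz
        bound holds; \<open>M + 1\<close> avoids division by 0.\<close>
      define \<delta> where "\<delta> = min e (\<epsilon> / (4 * (M + 1)))"
      have \<delta>: "0 < \<delta>" "\<delta> \<le> e" using e(1) \<epsilon> M0 by (auto simp: \<delta>_def)
      have M\<delta>: "M * \<delta> \<le> \<epsilon> / 4"
      proof -
        have "M * \<delta> \<le> (M + 1) * (\<epsilon> / (4 * (M + 1)))" using M0 \<delta> by (intro mult_mono) (auto simp: \<delta>_def)
        also have "\<dots> = \<epsilon> / 4" using M0 by (simp add: divide_simps)
        finally show ?thesis .
      qed
      obtain y where y: "y \<in> \<rat> \<inter> S" "\<bar>x - y\<bar> < \<delta>" using rational_near[OF x \<delta>(1)] by auto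
      have near: "cmod (u n x - u n y) \<le> \<epsilon> / 4" for n
      proof -
        have "cmod (u n x - u n y) \<le> M * \<bar>x - y\<bar>"
        proof (cases "x \<le> y")
          case True
          then have "cmod (u n y - u n x) \<le> M * (y - x)" using y(2) \<delta>(2) by (intro lip) auto
          then show ?thesis using True by (simp add: norm_minus_commute)
        next
          case False
          then have "cmod (u n x - u n y) \<le> M * (x - y)" using y(2) \<delta>(2) by (intro lip) auto
          then show ?thesis using False by simp
        qed
        also have "\<dots> \<le> M * \<delta>" using y(2) M0 by (intro mult_left_mono) auto
        finally show ?thesis using M\<delta> by linarith
      qed
      have "Cauchy (\<lambda>m. u (r m) y)" using conv_rat[OF y(1)] by (rule convergent_Cauchy)
      then obtain N where N: "\<And>m n. m \<ge> N \<Longrightarrow> n \<ge> N \<Longrightarrow> dist (u (r m) y) (u (r n) y) < \<epsilon> / 4"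
        using metric_CauchyD[of "\<lambda>m. u (r m) y" "\<epsilon> / 4"] \<epsilon> by auto
      show "\<exists>N. \<forall>m\<ge>N. \<forall>n\<ge>N. dist (u (r m) x) (u (r n) x) < \<epsilon>"
      proof (intro exI[of _ N] allI impI)
        fix m n assume "N \<le> m" "N \<le> n"
        have "dist (u (r m) x) (u (r n) x) \<le> dist (u (r m) x) (u (r m) y) + dist (u (r m) y) (u (r n) y) + dist (u (r n) y) (u (r n) x)"
          using dist_triangle[of "u (r m) x" "u (r n) x" "u (r m) y"] dist_triangle[of "u (r m) y" "u (r n) x" "u (r n) y"] by linarith
        moreover have "dist (u (r m) x) (u (r m) y) \<le> \<epsilon> / 4" "dist (u (r n) y) (u (r n) x) \<le> \<epsilon> / 4"
          using near[of "r m"] near[of "r n"] by (auto simp: dist_norm norm_minus_commute)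
        ultimately show "dist (u (r m) x) (u (r n) x) < \<epsilon>" using N[OF \<open>N \<le> m\<close> \<open>N \<le> n\<close>] \<epsilon> by linarith
      qed
    qed
    then show ?thesis by (rule Cauchy_convergent)
  qed
  define z where "z x = lim (\<lambda>m. u (r m) x)" for x
  have uL: "u n \<in> L2w w S" for n by (rule DD(2)[OF uD])
  have 1: "(\<lambda>m. u (r m) x) \<longlonglongrightarrow> z x" if "x \<in> S" for x
    using conv[OF that] by (simp add: z_def convergent_LIMSEQ_iff)
  have 2: "z x = 0" if "x \<notin> S" for x using W.L2wD(1)[OF uL that] by (simp add: z_def)
  \<comment> \<open>The envelope of order 0 dominates the whole sequence; it is square integrable
    because all four solutions are.\<close>
  define G where "G = (\<lambda>x. of_real (C * B) * complex_of_real (if x \<in> S then envelope 0 x else 0))"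
  have GL: "G \<in> L2w w S" unfolding G_def by (rule W.L2w_cmult[OF envelope_L2w])
  have 3: "cmod (u (r n) x) \<le> cmod (G x)" if "x \<in> S" for n x
    using ub[OF that, of 0 "r n"] that C(1) B0 env0[of 0 x] by (simp add: u0 G_def norm_mult abs_mult)
  have "z \<in> L2w w S" "(\<lambda>n. W.L2.nrm (u (r n) - z)) \<longlonglongrightarrow> 0"
    using W.L2_dominated_convergence[of "\<lambda>n. u (r n)" z G, OF uL 1 2 GL 3] by auto
  then show ?thesis using r(1) unfolding u_def by blast
qed

sublocale T: compact_symmetric "\<lambda>c f x. c * f x" "L2w w S" "inner_w w S" T
proof
  fix f assume f: "f \<in> L2w w S"
  show "T f \<in> L2w w S" by (rule DD(2)[OF T_props(1)[OF f]])
  show "T (\<lambda>x. c * f x) = (\<lambda>x. c * T f x)" for c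
    using T_add_cmult[OF f f, of "c - 1"] by (simp add: algebra_simps)
  show "T f = 0" if "inner_w w S f f = 0"
    by (rule T_AE_zero[OF f]) (use W.inner_zero_imp_AE[OF f that] in \<open>auto elim: eventually_mono\<close>)
  fix g assume g: "g \<in> L2w w S"
  show "T (f + g) = T f + T g" using T_add_cmult[OF f g, of 1] by (simp add: plus_fun_def)
  show "inner_w w S (T f) g = inner_w w S f (T g)" by (rule T_sym[OF f g])
next
  obtain C where C: "\<And>y. y \<in> D \<Longrightarrow> norm_w w S y \<le> C * norm_w w S (lop y)" using D_bdd by blast
  have "W.L2.nrm (T f) \<le> max 0 C * W.L2.nrm f" if f: "f \<in> L2w w S" for f
  proof -
    have "norm_w w S (lop (T f)) = W.L2.nrm f"
      using W.nrm_eq_norm_w[OF DD(3)[OF T_props(1)[OF f]]] nrm_lop_T[OF f] by simp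
    then have "W.L2.nrm (T f) \<le> C * W.L2.nrm f"
      using C[OF T_props(1)[OF f]] W.nrm_eq_norm_w[OF DD(2)[OF T_props(1)[OF f]]] by simp
    also have "\<dots> \<le> max 0 C * W.L2.nrm f" using W.L2.nrm_nonneg[OF f] by (intro mult_right_mono) auto
    finally show ?thesis .
  qed
  then show "\<exists>C\<ge>0. \<forall>f\<in>L2w w S. W.L2.nrm (T f) \<le> C * W.L2.nrm f" by (intro exI[of _ "max 0 C"]) auto
next
  fix fs :: "nat \<Rightarrow> real \<Rightarrow> complex" and B
  assume "\<And>n. fs n \<in> L2w w S" "\<And>n. W.L2.nrm (fs n) \<le> B"
  then show "\<exists>(r::nat\<Rightarrow>nat) z. strict_mono r \<and> z \<in> L2w w S \<and> (\<lambda>n. W.L2.nrm (T (fs (r n)) - z)) \<longlonglongrightarrow> 0"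
    by (rule T_compact)
qed

text \<open>An equality between sets of functions, not of classes: \<open>y = \<mu> * T y\<close>
  holds everywhere, so \<open>y\<close> is itself an element of \<open>D\<close>.\<close>

lemma eig_T:
  assumes "\<mu> \<noteq> 0"
  shows "cfun.eig T (L2w w S) \<mu> = eigenspace p s q w S D \<mu>"
proof (intro set_eqI iffI)
  fix y assume "y \<in> cfun.eig T (L2w w S) \<mu>"
  then have y: "y \<in> L2w w S" "(\<lambda>x. \<mu> * T y x) = y" by (auto simp: cfun.eig_def)
  have my: "(\<lambda>x. \<mu> * y x) \<in> L2w w S" by (rule W.L2w_cmult[OF y(1)])
  have "T (\<lambda>x. \<mu> * y x) = y" using T.T_scale[OF y(1)] y(2) by simp
  then show "y \<in> eigenspace p s q w S D \<mu>" using T_props[OF my] by (simp add: eigenspace_iff)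
next
  fix y assume "y \<in> eigenspace p s q w S D \<mu>"
  then have y: "y \<in> D" "AE x in lebesgue. x \<in> S \<longrightarrow> lop y x = \<mu> * y x" by (auto simp: eigenspace_iff)
  have yL: "y \<in> L2w w S" by (rule DD(2)[OF y(1)])
  have "T (\<lambda>x. \<mu> * y x) = y" by (rule T_unique[OF y W.L2w_cmult[OF yL]])
  then show "y \<in> cfun.eig T (L2w w S) \<mu>" using T.T_scale[OF yL] yL by (simp add: cfun.eig_def)
qed

end

section \<open>Truncation to a compact subinterval\<close>

text \<open>The projection theorem in a semidefinite setting. A sequence in \<open>R\<close>
  minimising the distance to \<open>f\<close> is Cauchy by the parallelogram identity; the limit
  \<open>z\<close> of the differences is orthogonal to \<open>R\<close>, hence null, so the distance
  is 0. Completeness is a premise because the locale does not contain it.\<close>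

lemma (in semi_inner) dense_if_trivial_complement:
  assumes R: "subspace R" "R \<subseteq> H"
    and complete: "\<And>u::nat \<Rightarrow> _. \<lbrakk>\<And>n. u n \<in> H; \<And>e. 0 < e \<Longrightarrow> \<exists>N. \<forall>m\<ge>N. \<forall>n\<ge>N. nrm (u m - u n) < e\<rbrakk> \<Longrightarrow>
      \<exists>z\<in>H. (\<lambda>n. nrm (u n - z)) \<longlonglongrightarrow> 0"
    and trivial: "\<And>z. \<lbrakk>z \<in> H; \<And>r. r \<in> R \<Longrightarrow> ip z r = 0\<rbrakk> \<Longrightarrow> ip z z = 0"
    and f: "f \<in> H" and "0 < \<epsilon>"
  shows "\<exists>r\<in>R. nrm (f - r) < \<epsilon>"
proof -
  define V where "V = {(nrm (f - r))\<^sup>2 |r. r \<in> R}"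
  define \<delta> where "\<delta> = Inf V"
  have Vbd: "bdd_below V" by (intro bdd_belowI[of _ 0]) (auto simp: V_def)
  have Vne: "V \<noteq> {}" using subspace_0[OF R(1)] by (auto simp: V_def)
  have \<delta>_le: "\<delta> \<le> (nrm (f - r))\<^sup>2" if "r \<in> R" for r
    unfolding \<delta>_def using that Vbd by (intro cInf_lower) (auto simp: V_def)
  have "\<exists>r\<in>R. (nrm (f - r))\<^sup>2 < \<delta> + 1 / Suc n" for n
  proof -
    have "\<exists>x\<in>V. x < \<delta> + 1 / Suc n" unfolding \<delta>_def by (intro cInf_lessD Vne) auto
    then show ?thesis by (auto simp: V_def)
  qed
  then obtain r where r: "\<And>n. r n \<in> R" "\<And>n. (nrm (f - r n))\<^sup>2 < \<delta> + 1 / Suc n" by metis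
  define g where "g n = f - r n" for n
  have rH: "r n \<in> H" for n using r(1) R(2) by auto
  have gH: "g n \<in> H" for n using f rH by (simp add: g_def)
  have par: "(nrm (a - b))\<^sup>2 = 2 * (nrm a)\<^sup>2 + 2 * (nrm b)\<^sup>2 - (nrm (a + b))\<^sup>2" if "a \<in> H" "b \<in> H" for a b
    using that by (simp add: nrm_sq ip_add ip_add_right ip_diff ip_diff_right)
  \<comment> \<open>The midpoint of two elements of \<open>R\<close> is in \<open>R\<close>, so it
    is no closer to \<open>f\<close> than the infimum allows.\<close>
  have mid: "4 * \<delta> \<le> (nrm (g m + g n))\<^sup>2" for m n
  proof -
    define a where "a = scale (1/2) (r m + r n)"
    have "a \<in> R" unfolding a_def using r(1) R(1) by (intro subspace_scale subspace_add) auto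
    have "g m + g n = scale 2 (f - a)"
    proof -
      have "scale 2 a = r m + r n" by (simp add: a_def)
      moreover have "scale 2 f = f + f" using scale_left_distrib[of 1 1 f] by simp
      ultimately show ?thesis by (simp add: g_def scale_right_diff_distrib)
    qed
    then have "nrm (g m + g n) = 2 * nrm (f - a)" using f \<open>a \<in> R\<close> R(2) by (simp add: nrm_scale subset_iff)
    then show ?thesis using \<delta>_le[OF \<open>a \<in> R\<close>] by (simp add: power_mult_distrib)
  qed
  have close: "(nrm (g m - g n))\<^sup>2 \<le> 2 / Suc m + 2 / Suc n" for m n
    using par[OF gH gH, of m n] mid[of m n] r(2)[of m] r(2)[of n] by (simp add: g_def)
  have "\<exists>z\<in>H. (\<lambda>n. nrm (g n - z)) \<longlonglongrightarrow> 0"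
  proof (rule complete[OF gH])
    fix e :: real assume "0 < e"
    then obtain N where N: "4 / e\<^sup>2 < real N" using reals_Archimedean2 by blast
    have "nrm (g m - g n) < e" if "N \<le> m" "N \<le> n" for m n
    proof (rule power2_less_imp_less)
      have "0 < e\<^sup>2" using \<open>0 < e\<close> by simp
      have half: "2 / real (Suc k) < e\<^sup>2 / 2" if "N \<le> k" for k
      proof -
        have "4 / e\<^sup>2 < real (Suc k)" using N that by linarith
        then have "4 < real (Suc k) * e\<^sup>2" using \<open>0 < e\<^sup>2\<close> by (simp add: divide_less_eq)
        then show ?thesis by (simp add: divide_less_eq field_simps)
      qed
      show "(nrm (g m - g n))\<^sup>2 < e\<^sup>2" using close[of m n] half[OF that(1)] half[OF that(2)] by linarith
    qed (use \<open>0 < e\<close> in simp)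
    then show "\<exists>N. \<forall>m\<ge>N. \<forall>n\<ge>N. nrm (g m - g n) < e" by blast
  qed
  then obtain z where z: "z \<in> H" "(\<lambda>n. nrm (g n - z)) \<longlonglongrightarrow> 0" by blast
  have nz: "(\<lambda>n. (nrm (g n))\<^sup>2) \<longlonglongrightarrow> (nrm z)\<^sup>2" by (intro tendsto_power nrm_tendsto gH z)
  have z\<delta>: "(nrm z)\<^sup>2 \<le> \<delta>"
  proof (rule LIMSEQ_le[OF nz])
    show "(\<lambda>n. \<delta> + 1 / real (Suc n)) \<longlonglongrightarrow> \<delta>" using tendsto_add[OF tendsto_const lim_1_over_n[THEN LIMSEQ_Suc], of \<delta>] by simp
    show "\<exists>N. \<forall>n\<ge>N. (nrm (g n))\<^sup>2 \<le> \<delta> + 1 / real (Suc n)" using r(2) unfolding g_def by (intro exI[of _ 0] allI impI less_imp_le)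
  qed
  have orth: "ip z a = 0" if a: "a \<in> R" for a
  proof -
    have aH: "a \<in> H" using a R(2) by auto
    define c where "c = ip z a"
    \<comment> \<open>Moving \<open>z\<close> by a multiple of \<open>a\<close> stays within the
      limits of \<open>f - r\<close> with \<open>r\<close> in \<open>R\<close>, and so cannot lower
      the length below the infimum. The factor \<open>c\<close> in the multiple makes the linear
      term real.\<close>
    have key: "0 \<le> - 2 * t * (cmod c)\<^sup>2 + t\<^sup>2 * (cmod c)\<^sup>2 * (nrm a)\<^sup>2" for t :: real
    proof -
      define b where "b = scale (of_real t * c) a"
      have bR: "b \<in> R" unfolding b_def by (rule subspace_scale[OF R(1) a])
      then have bH: "b \<in> H" using R(2) by auto
      have "\<delta> \<le> (nrm (z - b))\<^sup>2"
      proof (rule LIMSEQ_le_const)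
        have "(\<lambda>n. nrm ((g n - b) - (z - b))) \<longlonglongrightarrow> 0" using z(2) by simp
        then show "(\<lambda>n. (nrm (g n - b))\<^sup>2) \<longlonglongrightarrow> (nrm (z - b))\<^sup>2"
          by (intro tendsto_power nrm_tendsto) (use gH z bH in auto)
        have "\<delta> \<le> (nrm (g n - b))\<^sup>2" for n
          using \<delta>_le[OF subspace_add[OF R(1) r(1) bR], of n] by (simp add: g_def algebra_simps)
        then show "\<exists>N. \<forall>n\<ge>N. \<delta> \<le> (nrm (g n - b))\<^sup>2" by blast
      qed
      also have "(nrm (z - b))\<^sup>2 = (nrm z)\<^sup>2 - 2 * Re (ip z b) + (nrm b)\<^sup>2"
        using z bH by (simp add: nrm_sq ip_diff ip_diff_right ip_sym[of z b])
      also have "Re (ip z b) = t * (cmod c)\<^sup>2"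
      proof -
        have "ip z b = of_real t * (c * cnj c)" using z aH by (simp add: b_def ip_scale_right c_def)
        also have "\<dots> = of_real (t * (cmod c)\<^sup>2)" unfolding complex_norm_square[symmetric] by simp
        finally show ?thesis by simp
      qed
      also have "(nrm b)\<^sup>2 = t\<^sup>2 * (cmod c)\<^sup>2 * (nrm a)\<^sup>2"
        using aH by (simp add: b_def nrm_scale norm_mult power_mult_distrib)
      finally show ?thesis using z\<delta> by linarith
    qed
    have "c = 0"
    proof (rule ccontr)
      assume "c \<noteq> 0"
      then have c2: "0 < (cmod c)\<^sup>2" by simp
      \<comment> \<open>Small enough for the linear term to outweigh the quadratic one; the summand
        1 covers an \<open>a\<close> of length 0.\<close>
      define t where "t = 1 / ((nrm a)\<^sup>2 + 1)"
      have n1: "0 < (nrm a)\<^sup>2 + 1" by (rule add_nonneg_pos) auto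
      then have t: "0 < t" by (simp add: t_def)
      have t1: "t * (nrm a)\<^sup>2 < 1" using n1 by (simp add: t_def)
      have "- 2 * t * (cmod c)\<^sup>2 + t\<^sup>2 * (cmod c)\<^sup>2 * (nrm a)\<^sup>2 = (t * (cmod c)\<^sup>2) * (t * (nrm a)\<^sup>2 - 2)"
        by (simp add: power2_eq_square algebra_simps)
      also have "\<dots> < 0" using t c2 t1 by (intro mult_pos_neg) auto
      finally show False using key[of t] by simp
    qed
    then show ?thesis by (simp add: c_def)
  qed
  have "ip z z = 0" by (rule trivial[OF z(1) orth])
  then have "(nrm z)\<^sup>2 = 0" using z(1) by (simp add: nrm_sq)
  then have "(\<lambda>n. nrm (g n)) \<longlonglongrightarrow> 0" using nrm_tendsto[OF gH z] by simp
  then obtain n where "nrm (g n) < \<epsilon>" using order_tendstoD(2)[OF _ \<open>0 < \<epsilon>\<close>] eventually_sequentially by (metis order_refl)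
  then show ?thesis using r(1) by (auto simp: g_def)
qed

lemma restr_restr: "restr K (restr K f) = restr K f"
  by (simp add: restr_def fun_eq_iff)

lemma AE_lebesgue_neq: "AE x in lebesgue. x \<noteq> (c::real)"
  by (rule AE_I'[of "{c}"]) (auto intro: null_sets_completionI finite_imp_null_set_lborel)

context boundary_setting
begin

lemma bracket_diff_zero:
  assumes y: "y \<in> D" and z: "z \<in> {\<phi>1, \<phi>2, \<psi>1, \<psi>2}" and cd: "c \<le> d" "c \<in> S" "d \<in> S"
    and ae: "AE x in lebesgue. x \<in> S \<longrightarrow> c < x \<longrightarrow> x < d \<longrightarrow> lop y x = 0"
  shows "bracket (Q y) (Q z) c = bracket (Q y) (Q z) d"
proof -
  have rL: "restr {c..d} (lop y) \<in> L2w w S" by (rule W.restr_in_L2w[OF DD(3)[OF y]]) simp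
  have "inner_w w S (restr {c..d} (lop y)) z = inner_w w S 0 z"
  proof (rule W.inner_w_AE[OF rL W.L2.H_zero solD(2)[OF z] solD(2)[OF z]])
    show "AE x in lebesgue. x \<in> S \<longrightarrow> restr {c..d} (lop y) x = 0 x"
      using ae AE_lebesgue_neq[of c] AE_lebesgue_neq[of d] by eventually_elim (auto simp: restr_def)
  qed auto
  also have "\<dots> = 0" using solD(2)[OF z] by simp
  finally show ?thesis
    using inner_restr_integral[OF DD(3)[OF y] solD(2)[OF z] interval_subset[OF cd(2,3)] bracket_increment[OF DD(1)[OF y] z cd]] by simp
qed

lemma bracket_zero_left:
  assumes y: "y \<in> D" and z: "z \<in> {\<phi>1, \<phi>2}" and c: "c \<in> S"
    and ae: "AE x in lebesgue. x \<in> S \<longrightarrow> x < c \<longrightarrow> lop y x = 0"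
  shows "bracket (Q y) (Q z) c = 0"
proof -
  have "cmod (bracket (Q y) (Q z) c) \<le> 0 + \<epsilon>" if \<epsilon>: "0 < \<epsilon>" for \<epsilon>
  proof -
    obtain \<alpha> where \<alpha>: "\<alpha> \<in> S" "\<alpha> < c" "cmod (bracket (Q y) (Q z) \<alpha>) < \<epsilon>" using left_bc[OF y c \<epsilon> z] by blast
    have "bracket (Q y) (Q z) \<alpha> = bracket (Q y) (Q z) c"
      by (rule bracket_diff_zero[OF y _ _ \<alpha>(1) c]) (use z \<alpha> ae in \<open>auto elim: eventually_mono\<close>)
    then show ?thesis using \<alpha>(3) by simp
  qed
  then have "cmod (bracket (Q y) (Q z) c) \<le> 0" by (rule field_le_epsilon)
  then show ?thesis by simp
qed

lemma bracket_zero_right: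
  assumes y: "y \<in> D" and z: "z \<in> {\<psi>1, \<psi>2}" and d: "d \<in> S"
    and ae: "AE x in lebesgue. x \<in> S \<longrightarrow> d < x \<longrightarrow> lop y x = 0"
  shows "bracket (Q y) (Q z) d = 0"
proof -
  have "cmod (bracket (Q y) (Q z) d) \<le> 0 + \<epsilon>" if \<epsilon>: "0 < \<epsilon>" for \<epsilon>
  proof -
    obtain \<beta> where \<beta>: "\<beta> \<in> S" "d < \<beta>" "cmod (bracket (Q y) (Q z) \<beta>) < \<epsilon>" using right_bc[OF y d \<epsilon> z] by blast
    have "bracket (Q y) (Q z) d = bracket (Q y) (Q z) \<beta>"
      by (rule bracket_diff_zero[OF y _ _ d \<beta>(1)]) (use z \<beta> ae in \<open>auto elim: eventually_mono\<close>)
    then show ?thesis using \<beta>(3) by simp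
  qed
  then have "cmod (bracket (Q y) (Q z) d) \<le> 0" by (rule field_le_epsilon)
  then show ?thesis by simp
qed

lemma proj_restr:
  assumes "K \<in> sets lebesgue"
  shows "T.proj (restr K)"
  unfolding T.proj_def
proof (intro conjI ballI allI)
  fix f g assume f: "f \<in> L2w w S" and g: "g \<in> L2w w S"
  note rf = W.restr_in_L2w[OF f assms] and rg = W.restr_in_L2w[OF g assms]
  have "(\<lambda>x. restr K f x * cnj (g x) * complex_of_real (W.wt x)) = (\<lambda>x. f x * cnj (restr K g x) * complex_of_real (W.wt x))"
    by (auto simp: restr_def)
  then show "inner_w w S (restr K f) g = inner_w w S f (restr K g)"
    using W.inner_w_eq[OF W.L2wD(2)[OF rf] W.L2wD(2)[OF g]] W.inner_w_eq[OF W.L2wD(2)[OF f] W.L2wD(2)[OF rg]]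
      W.L2wD(1)[OF rf] W.L2wD(1)[OF f] by simp
qed (auto simp: restr_def fun_eq_iff intro: W.restr_in_L2w[OF _ assms, unfolded restr_def])

end

section \<open>The operator on a compact subinterval\<close>

locale truncated_setting = boundary_setting p s q w S D \<phi>1 \<phi>2 \<psi>1 \<psi>2
  for p s q w :: "real \<Rightarrow> real" and S :: "real set" and D :: "(real \<Rightarrow> complex) set"
    and \<phi>1 \<phi>2 \<psi>1 \<psi>2 :: "real \<Rightarrow> complex" +
  fixes c d :: real and DK :: "(real \<Rightarrow> complex) set"
  assumes cd: "c < d" "{c..d} \<subseteq> S"
    and DK: "DK = {y \<in> D_max p s q w {c..d}.
      bracket (qd p s {c..d} y) (qd p s S \<phi>1) c = 0 \<and> bracket (qd p s {c..d} y) (qd p s S \<phi>2) c = 0 \<and>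
      bracket (qd p s {c..d} y) (qd p s S \<psi>1) d = 0 \<and> bracket (qd p s {c..d} y) (qd p s S \<psi>2) d = 0}"
begin

sublocale K: quasi_coeffs p s q w "{c..d}"
  by (rule coeffs_subinterval[OF cd])

sublocale KW: weight w "{c..d}"
  by (rule W.weight_subset[OF _ cd(2)]) simp

abbreviation QK :: "(real \<Rightarrow> complex) \<Rightarrow> nat \<Rightarrow> real \<Rightarrow> complex" where "QK \<equiv> qd p s {c..d}"
abbreviation lopK :: "(real \<Rightarrow> complex) \<Rightarrow> real \<Rightarrow> complex" where "lopK \<equiv> ell p s q w {c..d}"
abbreviation P :: "(real \<Rightarrow> complex) \<Rightarrow> real \<Rightarrow> complex" where "P \<equiv> restr {c..d}"

lemma K_sets: "{c..d} \<in> sets lebesgue" by simp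

lemma cd_S: "c \<in> S" "d \<in> S" using cd by auto

lemma L2wK: "L2w w {c..d} = {f \<in> L2w w S. P f = f}"
  by (rule W.L2w_subset[OF K_sets cd(2)])

lemma L2wK_sub: "f \<in> L2w w {c..d} \<Longrightarrow> f \<in> L2w w S" by (simp add: L2wK)

lemma innerK: "f \<in> L2w w {c..d} \<Longrightarrow> g \<in> L2w w {c..d} \<Longrightarrow> inner_w w {c..d} f g = inner_w w S f g"
  using W.inner_w_subset(1)[OF K_sets cd(2)] L2wK_sub by blast

sublocale TK: compact_symmetric "\<lambda>c f x. c * f x" "{f \<in> L2w w S. P f = f}" "inner_w w S" "\<lambda>f. P (T f)"
  by (rule T.compact_symmetric_compression[OF proj_restr[OF K_sets]])

lemma DKD:
  assumes "y \<in> DK"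
  shows "y \<in> D_ell p s {c..d}" "y \<in> L2w w {c..d}" "lopK y \<in> L2w w {c..d}"
    "z \<in> {\<phi>1, \<phi>2} \<Longrightarrow> bracket (QK y) (Q z) c = 0" "z \<in> {\<psi>1, \<psi>2} \<Longrightarrow> bracket (QK y) (Q z) d = 0"
  using assms unfolding DK D_max_def by auto

lemma TK_props:
  assumes f: "f \<in> L2w w {c..d}"
  shows "P (T f) \<in> DK" "AE x in lebesgue. x \<in> {c..d} \<longrightarrow> lopK (P (T f)) x = f x"
proof -
  have fS: "f \<in> L2w w S" by (rule L2wK_sub[OF f])
  note y = T_props[OF fS]
  note R = restr_D_ell[OF DD(1)[OF y(1)] cd]
  show ae: "AE x in lebesgue. x \<in> {c..d} \<longrightarrow> lopK (P (T f)) x = f x"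
    using R(3) y(2) by eventually_elim (use cd(2) in auto)
  have "P (T f) \<in> L2w w {c..d}"
    unfolding L2wK using W.restr_in_L2w[OF DD(2)[OF y(1)] K_sets] by (simp add: restr_restr)
  moreover have "lopK (P (T f)) \<in> L2w w {c..d}"
    by (rule KW.L2w_AE[OF f]) (use ae K.ell_outside in \<open>auto elim: eventually_mono\<close>)
  ultimately have "P (T f) \<in> D_max p s q w {c..d}" using R(1) by (simp add: D_max_def)
  moreover have "bracket (QK (P (T f))) (Q z) c = 0" if z: "z \<in> {\<phi>1, \<phi>2}" for z
  proof -
    have "bracket (QK (P (T f))) (Q z) c = bracket (Q (T f)) (Q z) c"
      by (rule bracket_cong) (use R(2) cd in auto)
    also have "\<dots> = 0"
    proof (rule bracket_zero_left[OF y(1) z cd_S(1)])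
      show "AE x in lebesgue. x \<in> S \<longrightarrow> x < c \<longrightarrow> lop (T f) x = 0"
        using y(2) by eventually_elim (use KW.L2wD(1)[OF f] in auto)
    qed
    finally show ?thesis .
  qed
  moreover have "bracket (QK (P (T f))) (Q z) d = 0" if z: "z \<in> {\<psi>1, \<psi>2}" for z
  proof -
    have "bracket (QK (P (T f))) (Q z) d = bracket (Q (T f)) (Q z) d"
      by (rule bracket_cong) (use R(2) cd in auto)
    also have "\<dots> = 0"
    proof (rule bracket_zero_right[OF y(1) z cd_S(2)])
      show "AE x in lebesgue. x \<in> S \<longrightarrow> d < x \<longrightarrow> lop (T f) x = 0"
        using y(2) by eventually_elim (use KW.L2wD(1)[OF f] in auto)
    qed
    finally show ?thesis .
  qed
  ultimately show "P (T f) \<in> DK" by (simp add: DK)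
qed

text \<open>All four brackets vanish at \<open>c\<close>: those with \<open>\<psi>1\<close>, \<open>\<psi>2\<close> are constant and vanish at \<open>d\<close>.\<close>

lemma DK_inj:
  assumes y: "y \<in> DK" and ae: "AE x in lebesgue. x \<in> {c..d} \<longrightarrow> lopK y x = 0"
  shows "y = 0"
proof -
  have sys: "system p s q {c..d} (QK y) (\<lambda>x. 0)"
    by (rule system_cong[OF K.qd_system[OF DKD(1)[OF y]]]) (use ae in \<open>auto elim: eventually_mono\<close>)
  have "bracket (QK y) (Q z) c = 0" if z: "z \<in> {\<phi>1, \<phi>2, \<psi>1, \<psi>2}" for z
  proof (cases "z \<in> {\<phi>1, \<phi>2}")
    case True
    then show ?thesis by (rule DKD(4)[OF y])
  next
    case False
    have "((\<lambda>x. 0 * cnj (Q z 0 x) - QK y 0 x * cnj 0) has_integral bracket (QK y) (Q z) d - bracket (QK y) (Q z) c) {c..d}"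
      by (rule lagrange_identity[OF sys system_subset[OF solD(3)[OF z] cd(2)]]) (use cd in auto)
    then have "bracket (QK y) (Q z) d - bracket (QK y) (Q z) c = 0" by (simp add: has_integral_0_eq)
    moreover have "bracket (QK y) (Q z) d = 0" using False z by (intro DKD(5)[OF y]) auto
    ultimately show ?thesis by simp
  qed
  then have "QK y k c = 0" if "k \<le> 3" for k using brackets_zero_imp_zero[OF cd_S(1) that] by blast
  then have zero: "QK y 0 x = 0" if "x \<in> {c..d}" for x
    using K.system_unique[OF sys, of c x 0] that cd(1) by auto
  have "y x = 0" for x
    using zero[of x] K.qd_props(1)[OF DKD(1)[OF y]] KW.L2wD(1)[OF DKD(2)[OF y], of x] by (cases "x \<in> {c..d}") auto
  then show ?thesis by (simp add: fun_eq_iff)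
qed

lemma DK_combination:
  assumes y: "y \<in> DK" and z: "z \<in> DK"
  shows "(\<lambda>x. a * y x + b * z x) \<in> DK"
    "AE x in lebesgue. x \<in> {c..d} \<longrightarrow> lopK (\<lambda>x. a * y x + b * z x) x = a * lopK y x + b * lopK z x"
proof -
  note comb = K.D_ell_combination[OF DKD(1)[OF y] DKD(1)[OF z], where c = a and d = b]
  show ae: "AE x in lebesgue. x \<in> {c..d} \<longrightarrow> lopK (\<lambda>x. a * y x + b * z x) x = a * lopK y x + b * lopK z x"
    by (rule comb(3))
  have L: "(\<lambda>x. a * f x + b * g x) \<in> L2w w {c..d}" if "f \<in> L2w w {c..d}" "g \<in> L2w w {c..d}" for f g
    using KW.L2w_add[OF KW.L2w_cmult[OF that(1)] KW.L2w_cmult[OF that(2)], of a b] by (simp add: plus_fun_def)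
  have "lopK (\<lambda>x. a * y x + b * z x) \<in> L2w w {c..d}"
    by (rule KW.L2w_AE[OF L[OF DKD(3)[OF y] DKD(3)[OF z]]]) (use ae K.ell_outside in \<open>auto elim: eventually_mono\<close>)
  moreover
  have lin: "bracket (QK (\<lambda>x. a * y x + b * z x)) (Q u) x = a * bracket (QK y) (Q u) x + b * bracket (QK z) (Q u) x"
    if "x \<in> {c..d}" for u x
    unfolding bracket_combination_left[symmetric] by (rule bracket_cong) (use comb(2) that in auto)
  then have "bracket (QK (\<lambda>x. a * y x + b * z x)) (Q u) c = 0" if "u \<in> {\<phi>1, \<phi>2}" for u
    using lin[of c u] DKD(4)[OF y that] DKD(4)[OF z that] cd(1) by simp
  moreover have "bracket (QK (\<lambda>x. a * y x + b * z x)) (Q u) d = 0" if "u \<in> {\<psi>1, \<psi>2}" for u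
    using lin[of d u] DKD(5)[OF y that] DKD(5)[OF z that] cd(1) by simp
  ultimately show "(\<lambda>x. a * y x + b * z x) \<in> DK"
    using comb(1) L[OF DKD(2)[OF y] DKD(2)[OF z]] by (simp add: DK D_max_def)
qed

lemma TK_unique:
  assumes y: "y \<in> DK" and f: "f \<in> L2w w {c..d}" and ae: "AE x in lebesgue. x \<in> {c..d} \<longrightarrow> lopK y x = f x"
  shows "P (T f) = y"
proof -
  note Tf = TK_props[OF f]
  note comb = DK_combination[OF Tf(1) y, of 1 "-1"]
  have "AE x in lebesgue. x \<in> {c..d} \<longrightarrow> lopK (\<lambda>x. 1 * P (T f) x + (-1) * y x) x = 0"
    using comb(2) Tf(2) ae by eventually_elim auto
  from DK_inj[OF comb(1) this] have "1 * P (T f) x + (-1) * y x = 0" for x by (metis zero_fun_apply)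
  then show ?thesis by (simp add: fun_eq_iff)
qed

lemma eig_TK:
  assumes "\<mu> \<noteq> 0"
  shows "cfun.eig (\<lambda>f. P (T f)) {f \<in> L2w w S. P f = f} \<mu> = eigenspace p s q w {c..d} DK \<mu>"
proof (intro set_eqI iffI)
  fix y assume "y \<in> cfun.eig (\<lambda>f. P (T f)) {f \<in> L2w w S. P f = f} \<mu>"
  then have y: "y \<in> {f \<in> L2w w S. P f = f}" "(\<lambda>x. \<mu> * P (T y) x) = y" by (auto simp: cfun.eig_def)
  have my: "(\<lambda>x. \<mu> * y x) \<in> L2w w {c..d}" using KW.L2w_cmult y(1) unfolding L2wK by blast
  have "P (T (\<lambda>x. \<mu> * y x)) = y" using TK.T_scale[OF y(1)] y(2) by simp
  then show "y \<in> eigenspace p s q w {c..d} DK \<mu>" using TK_props[OF my] by (simp add: K.eigenspace_iff)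
next
  fix y assume "y \<in> eigenspace p s q w {c..d} DK \<mu>"
  then have y: "y \<in> DK" "AE x in lebesgue. x \<in> {c..d} \<longrightarrow> lopK y x = \<mu> * y x" by (auto simp: K.eigenspace_iff)
  have yL: "y \<in> L2w w {c..d}" by (rule DKD(2)[OF y(1)])
  then have yL': "y \<in> {f \<in> L2w w S. P f = f}" unfolding L2wK .
  have "P (T (\<lambda>x. \<mu> * y x)) = y" by (rule TK_unique[OF y(1) KW.L2w_cmult[OF yL] y(2)])
  then show "y \<in> cfun.eig (\<lambda>f. P (T f)) {f \<in> L2w w S. P f = f} \<mu>" using TK.T_scale[OF yL'] yL' by (simp add: cfun.eig_def)
qed

lemma DK_kernel: "eigenspace p s q w {c..d} DK 0 = {0}"
proof
  show "eigenspace p s q w {c..d} DK 0 \<subseteq> {0}" using DK_inj by (auto simp: K.eigenspace_iff)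
  have "P (T 0) \<in> DK" "AE x in lebesgue. x \<in> {c..d} \<longrightarrow> lopK (P (T 0)) x = 0 x"
    by (rule TK_props[OF KW.L2.H_zero])+
  moreover have "P (T 0) = 0" by (simp add: T.T_zero restr_def fun_eq_iff)
  ultimately show "{0} \<subseteq> eigenspace p s q w {c..d} DK 0" by (simp add: K.eigenspace_iff)
qed

lemma TK_sym:
  assumes "f \<in> L2w w {c..d}" "g \<in> L2w w {c..d}"
  shows "inner_w w {c..d} (P (T f)) g = inner_w w {c..d} f (P (T g))"
  using TK.T_sym[of f g] assms innerK DKD(2)[OF TK_props(1)] by (simp add: L2wK)

text \<open>Every element of \<open>DK\<close> is \<open>P (T f)\<close> with \<open>f\<close> its
  image under \<open>lopK\<close>, so symmetry is inherited from the compression of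
  \<open>T\<close>.\<close>

lemma DK_sym:
  assumes y: "y \<in> DK" and z: "z \<in> DK"
  shows "inner_w w {c..d} (lopK y) z = inner_w w {c..d} y (lopK z)"
proof -
  have "P (T (lopK y)) = y" "P (T (lopK z)) = z"
    by (rule TK_unique[OF y DKD(3)[OF y]], simp, rule TK_unique[OF z DKD(3)[OF z]], simp)
  then show ?thesis using TK_sym[OF DKD(3)[OF y] DKD(3)[OF z]] by simp
qed

lemma DK_subspace: "cfun.subspace DK"
proof (rule cfun.subspaceI)
  have "P (T 0) \<in> DK" by (rule TK_props(1)[OF KW.L2.H_zero])
  moreover have "P (T 0) = 0" by (simp add: T.T_zero restr_def fun_eq_iff)
  ultimately show z: "0 \<in> DK" by simp
  show "y + z \<in> DK" if "y \<in> DK" "z \<in> DK" for y z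
    using DK_combination(1)[OF that, of 1 1] by (simp add: plus_fun_def)
  show "(\<lambda>x. a * y x) \<in> DK" if "y \<in> DK" for a y
    using DK_combination(1)[OF that z, of a 1] by simp
qed

text \<open>For \<open>z\<close> orthogonal to \<open>DK\<close>, the squared length of
  \<open>P (T z)\<close> equals the inner product of \<open>z\<close> with another element of
  \<open>DK\<close>, namely the image of \<open>P (T z)\<close> under the inverse; so it is 0. As
  \<open>P (T z)\<close> is continuous on the interval it vanishes there, and so does
  \<open>z\<close> almost everywhere, being its image under \<open>lopK\<close>.\<close>

lemma DK_dense:
  assumes f: "f \<in> L2w w {c..d}" and "0 < \<epsilon>"
  shows "\<exists>y\<in>DK. norm_w w {c..d} (\<lambda>x. f x - y x) < \<epsilon>"
proof -
  have "\<exists>y\<in>DK. KW.L2.nrm (f - y) < \<epsilon>"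
  proof (rule KW.L2.dense_if_trivial_complement[OF DK_subspace _ KW.riesz_fischer _ f \<open>0 < \<epsilon>\<close>])
    show "DK \<subseteq> L2w w {c..d}" using DKD(2) by blast
    fix z assume z: "z \<in> L2w w {c..d}" and orth: "\<And>r. r \<in> DK \<Longrightarrow> inner_w w {c..d} z r = 0"
    note Tz = TK_props[OF z]
    have "inner_w w {c..d} (P (T z)) (P (T z)) = inner_w w {c..d} z (P (T (P (T z))))"
      by (rule TK_sym[OF z DKD(2)[OF Tz(1)]])
    also have "\<dots> = 0" by (rule orth[OF TK_props(1)[OF DKD(2)[OF Tz(1)]]])
    finally have "AE x in lebesgue. P (T z) x = 0" by (rule KW.inner_zero_imp_AE[OF DKD(2)[OF Tz(1)]])
    then have ae0: "AE x in lebesgue. x \<in> {c..d} \<longrightarrow> QK (P (T z)) 0 x = 0"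
      by eventually_elim (simp add: K.qd_props(1)[OF DKD(1)[OF Tz(1)]])
    note sys = K.qd_system[OF DKD(1)[OF Tz(1)]]
    have "QK (P (T z)) 0 x = 0" if "x \<in> {c..d}" for x
      by (rule K.continuous_AE_zero[OF _ ae0 that]) (use system_continuous[OF sys] in auto)
    then have "AE x in lebesgue. x \<in> {c..d} \<longrightarrow> of_real (w x) * lopK (P (T z)) x = (0::complex)"
      using K.system_zero_function(2)[OF sys _, of c 0] cd(1) by auto
    then have "AE x in lebesgue. x \<in> {c..d} \<longrightarrow> z x = 0"
      using Tz(2) K.w_pos by eventually_elim auto
    then have "inner_w w {c..d} z z = inner_w w {c..d} 0 z"
      by (intro KW.inner_w_AE) (use z in auto)
    then show "inner_w w {c..d} z z = 0" using z by simp
  qed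
  then obtain y where y: "y \<in> DK" "KW.L2.nrm (f - y) < \<epsilon>" by blast
  have "norm_w w {c..d} (\<lambda>x. f x - y x) = KW.L2.nrm (f - y)"
    using KW.nrm_eq_norm_w[OF KW.L2.H_diff[OF f DKD(2)[OF y(1)]]] by (simp add: fun_diff_def)
  then show ?thesis using y by (intro bexI[of _ y]) simp_all
qed

text \<open>Given a pair \<open>(g, h)\<close> in the adjoint graph, the candidate is
  \<open>y = P (T h)\<close>. Every \<open>u\<close> in the space is \<open>lopK (P (T u))\<close>,
  so symmetry of the inverse shows that \<open>g - y\<close> is orthogonal to everything, itself
  included.\<close>

lemma DK_self_adjoint: "self_adjoint p s q w {c..d} DK"
  unfolding self_adjoint_def
proof (intro conjI ballI allI impI)
  show "DK \<subseteq> D_max p s q w {c..d}" by (auto simp: DK)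
  show "cfun.subspace DK" by (rule DK_subspace)
  show "\<exists>y\<in>DK. norm_w w {c..d} (\<lambda>x. f x - y x) < \<epsilon>" if "f \<in> L2w w {c..d}" "0 < \<epsilon>" for f \<epsilon>
    by (rule DK_dense[OF that])
  fix g h assume g: "g \<in> L2w w {c..d}" and h: "h \<in> L2w w {c..d}"
  show "(\<forall>f\<in>DK. inner_w w {c..d} (lopK f) g = inner_w w {c..d} f h) \<longleftrightarrow>
        (\<exists>y\<in>DK. (AE x in lebesgue_on {c..d}. g x = y x) \<and> (AE x in lebesgue_on {c..d}. h x = lopK y x))"
    unfolding K.AE_on_iff
  proof
    assume adj: "\<forall>f\<in>DK. inner_w w {c..d} (lopK f) g = inner_w w {c..d} f h"
    define y where "y = P (T h)"
    have y: "y \<in> DK" "AE x in lebesgue. x \<in> {c..d} \<longrightarrow> lopK y x = h x"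
      unfolding y_def by (rule TK_props[OF h])+
    have gy: "g - y \<in> L2w w {c..d}" by (rule KW.L2.H_diff[OF g DKD(2)[OF y(1)]])
    have "inner_w w {c..d} u (g - y) = 0" if u: "u \<in> L2w w {c..d}" for u
    proof -
      note Tu = TK_props[OF u]
      have "inner_w w {c..d} u g = inner_w w {c..d} (lopK (P (T u))) g"
        by (rule KW.inner_w_AE) (use u g DKD(3)[OF Tu(1)] Tu(2) in \<open>auto elim: eventually_mono\<close>)
      also have "\<dots> = inner_w w {c..d} (P (T u)) h" using adj Tu(1) by blast
      also have "\<dots> = inner_w w {c..d} u y" unfolding y_def by (rule TK_sym[OF u h])
      finally show ?thesis using KW.L2.ip_diff_right[OF u g DKD(2)[OF y(1)]] by simp
    qed
    from KW.inner_zero_imp_AE[OF gy this[OF gy]]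
    have "AE x in lebesgue. x \<in> {c..d} \<longrightarrow> g x = y x" by eventually_elim simp
    moreover have "AE x in lebesgue. x \<in> {c..d} \<longrightarrow> h x = lopK y x" using y(2) by eventually_elim simp
    ultimately show "\<exists>y\<in>DK. (AE x in lebesgue. x \<in> {c..d} \<longrightarrow> g x = y x) \<and> (AE x in lebesgue. x \<in> {c..d} \<longrightarrow> h x = lopK y x)"
      using y(1) by blast
  next
    assume "\<exists>y\<in>DK. (AE x in lebesgue. x \<in> {c..d} \<longrightarrow> g x = y x) \<and> (AE x in lebesgue. x \<in> {c..d} \<longrightarrow> h x = lopK y x)"
    then obtain y where y: "y \<in> DK" "AE x in lebesgue. x \<in> {c..d} \<longrightarrow> g x = y x"
      "AE x in lebesgue. x \<in> {c..d} \<longrightarrow> h x = lopK y x" by blast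
    show "\<forall>f\<in>DK. inner_w w {c..d} (lopK f) g = inner_w w {c..d} f h"
    proof
      fix f assume f: "f \<in> DK"
      have "inner_w w {c..d} (lopK f) g = inner_w w {c..d} (lopK f) y"
        by (rule KW.inner_w_AE[OF DKD(3)[OF f] DKD(3)[OF f] g DKD(2)[OF y(1)] _ y(2)]) simp
      also have "\<dots> = inner_w w {c..d} f (lopK y)" by (rule DK_sym[OF f y(1)])
      also have "\<dots> = inner_w w {c..d} f h"
        by (rule KW.inner_w_AE[OF DKD(2)[OF f] DKD(2)[OF f] DKD(3)[OF y(1)] h]) (simp, use y(3) in eventually_elim, simp)
      finally show "inner_w w {c..d} (lopK f) g = inner_w w {c..d} f h" .
    qed
  qed
qed

end

section \<open>Positivity of the quadratic form on short intervals\<close>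

lemma fun_sum_apply: "(\<Sum>i\<in>A. F i) x = (\<Sum>i\<in>A. F i x)"
  by (induction A rule: infinite_finite_induct) auto

text \<open>Cauchy-Schwarz for a weighted integral, in the form of a quadratic polynomial without
  negative values; \<open>t = J / R\<close> is its minimum.\<close>

lemma nonneg_quadratic_discriminant:
  fixes A J R :: real
  assumes "\<And>t. 0 \<le> A - 2 * t * J + t\<^sup>2 * R" and "0 \<le> R"
  shows "J\<^sup>2 \<le> A * R"
proof (cases "R = 0")
  case True
  have "J = 0"
  proof (rule ccontr)
    assume "J \<noteq> 0"
    then have "2 * ((A + 1) / (2 * J)) * J = A + 1" by simp
    with assms(1)[of "(A + 1) / (2 * J)"] True show False by simp
  qed
  then show ?thesis using True by simp
next
  case False
  then have "0 < R" using assms(2) by simp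
  have "A - 2 * (J / R) * J + (J / R)\<^sup>2 * R = A - J\<^sup>2 / R"
    using False by (simp add: power2_eq_square field_simps)
  then have "J\<^sup>2 / R \<le> A" using assms(1)[of "J / R"] by simp
  then show ?thesis using \<open>0 < R\<close> by (simp add: divide_le_eq)
qed

lemma continuous_mult_absolutely_integrable:
  fixes f h :: "real \<Rightarrow> real"
  assumes f: "continuous_on {a..b} f" and h: "h absolutely_integrable_on {a..b}"
  shows "(\<lambda>x. f x * h x) absolutely_integrable_on {a..b}"
proof (rule absolutely_integrable_bounded_measurable_product_real[OF _ _ _ h])
  show "f \<in> borel_measurable (lebesgue_on {a..b})"
    by (rule continuous_imp_measurable_on_sets_lebesgue[OF f]) simp
  show "bounded (f ` {a..b})" by (intro compact_imp_bounded compact_continuous_image f) simp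
qed simp

context quasi_coeffs
begin

text \<open>On a short interval the quadratic form \<open>\<integral> |Y\<^sub>2|\<^sup>2 / p + s |Y\<^sub>1|\<^sup>2 + q |Y\<^sub>0|\<^sup>2\<close> of a solution with
  vanishing boundary values is dominated by its leading term.\<close>

lemma energy_positive:
  assumes Y: "system p s q S Y g" and ce: "c < e" "{c..e} \<subseteq> S" and small: "integral {c..e} majorant < 1/2"
    and Yc: "\<And>k. k \<le> 3 \<Longrightarrow> Y k c = 0" and Ye: "\<And>k. k \<le> 3 \<Longrightarrow> Y k e = 0"
    and g: "\<not> (AE x in lebesgue. x \<in> {c..e} \<longrightarrow> g x = 0)"
  shows "\<exists>I>0. ((\<lambda>x. Y 0 x * cnj (g x)) has_integral complex_of_real I) {c..e}"
proof -
  define r where "r x = \<bar>1 / p x\<bar>" for x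
  define n where "n k x = (cmod (Y k x))\<^sup>2" for k x
  have cont: "continuous_on {c..e} (Y k)" if "k \<le> 3" for k by (rule system_continuous[OF Y that ce(2)])
  have cn: "continuous_on {c..e} (n k)" if "k \<le> 3" for k
    unfolding n_def by (intro continuous_intros cont that)
  have ai: "r absolutely_integrable_on {c..e}" "s absolutely_integrable_on {c..e}" "q absolutely_integrable_on {c..e}"
  proof -
    have "(\<lambda>x. 1 / p x) absolutely_integrable_on {c..e}" using ce(2) p_loc unfolding L1_loc_def by blast
    then have "norm \<circ> (\<lambda>x. 1 / p x) absolutely_integrable_on {c..e}" by (rule absolutely_integrable_norm)
    moreover have "norm \<circ> (\<lambda>x. 1 / p x) = r" by (simp add: r_def fun_eq_iff)
    ultimately show "r absolutely_integrable_on {c..e}" by simp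
  qed (use ce(2) s_loc q_loc in \<open>simp_all add: L1_loc_def\<close>)
  note mult = continuous_mult_absolutely_integrable
  have int: "(\<lambda>x. n 2 x * r x) integrable_on {c..e}" "(\<lambda>x. n 1 x * s x) integrable_on {c..e}" "(\<lambda>x. n 0 x * q x) integrable_on {c..e}"
    using mult[OF cn ai(1), of 2] mult[OF cn ai(2), of 1] mult[OF cn ai(3), of 0]
    by (auto dest: set_lebesgue_integral_eq_integral(1))
  define A where "A = integral {c..e} (\<lambda>x. n 2 x * r x)"
  define I where "I = A + integral {c..e} (\<lambda>x. n 1 x * s x) + integral {c..e} (\<lambda>x. n 0 x * q x)"
  define E where "E x = n 2 x * r x + n 1 x * s x + n 0 x * q x" for x
  have EI: "(E has_integral I) {c..e}"
    unfolding E_def I_def A_def by (intro has_integral_add integrable_integral int)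
  \<comment> \<open>Integration by parts: \<open>F\<close> is the boundary term, with derivative
    \<open>E - Y 0 * cnj g\<close>. It vanishes at both ends, so the pairing of \<open>Y 0\<close>
    with \<open>g\<close> equals the energy \<open>I\<close>.\<close>
  define F where "F x = Y 0 x * cnj (Y 3 x) + Y 1 x * cnj (Y 2 x)" for x
  have FI: "((\<lambda>x. of_real (E x) - Y 0 x * cnj (g x)) has_integral F e - F c) {c..e}"
  proof (rule fundamental_theorem_abs_cont)
    note ac = loc_abs_contD[OF systemD(1)[OF Y] ce(2)]
    show "abs_cont_on c e F"
      unfolding F_def by (intro abs_cont_on_add abs_cont_on_mult abs_cont_on_cnj ac) auto
    have Y': "system p s q {c..e} Y g" by (rule system_subset[OF Y ce(2)])
    show "AE x in lebesgue. x \<in> {c..e} \<longrightarrow> (F has_vector_derivative of_real (E x) - Y 0 x * cnj (g x)) (at x within {c..e})"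
      using systemD(3)[OF Y'] p_pos
    proof eventually_elim
      case (elim x)
      show ?case
      proof
        assume x: "x \<in> {c..e}"
        let ?at = "at x within {c..e}"
        have d: "(Y 0 has_vector_derivative Y 1 x) ?at" "(Y 1 has_vector_derivative Y 2 x / of_real (p x)) ?at"
          "(Y 2 has_vector_derivative - Y 3 x + of_real (s x) * Y 1 x) ?at"
          "(Y 3 has_vector_derivative of_real (q x) * Y 0 x - g x) ?at"
          using elim(1) systemD(2)[OF Y'] x by auto
        have "(F has_vector_derivative
          (Y 0 x * cnj (of_real (q x) * Y 0 x - g x) + Y 1 x * cnj (Y 3 x))
          + (Y 1 x * cnj (- Y 3 x + of_real (s x) * Y 1 x) + Y 2 x / of_real (p x) * cnj (Y 2 x))) ?at"
          unfolding F_def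
          by (intro has_vector_derivative_add has_vector_derivative_mult has_vector_derivative_cnj d)
        moreover have nk: "complex_of_real (n k x) = Y k x * cnj (Y k x)" for k
          unfolding n_def complex_norm_square ..
        moreover have "p x > 0" using elim(2) x ce(2) by auto
        then have rx: "complex_of_real (r x) = 1 / of_real (p x)" by (simp add: r_def)
        ultimately show "(F has_vector_derivative of_real (E x) - Y 0 x * cnj (g x)) ?at"
          by (elim back_subst[of "\<lambda>l. (F has_vector_derivative l) ?at"])
             (simp add: E_def nk rx algebra_simps del: of_real_power)
      qed
    qed
  qed (use ce in simp)
  have "F e - F c = 0" using Yc Ye by (simp add: F_def)
  then have "((\<lambda>x. of_real (E x) - (of_real (E x) - Y 0 x * cnj (g x))) has_integral complex_of_real I - 0) {c..e}"
    using FI by (intro has_integral_diff has_integral_of_real EI) simp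
  then have main: "((\<lambda>x. Y 0 x * cnj (g x)) has_integral complex_of_real I) {c..e}" by simp
  define \<eta> where "\<eta> = integral {c..e} majorant"
  note hi = majorant_integrable[OF ce(2)]
  have r0: "0 \<le> r x" for x by (simp add: r_def)
  have ri: "r integrable_on {c..e}" using hi(2) unfolding r_def .
  define R where "R = integral {c..e} r"
  have R: "0 \<le> R" "R \<le> \<eta>"
    unfolding R_def \<eta>_def using ri hi(1) by (auto intro!: integral_nonneg integral_le simp: r_def majorant_def)
  have sb: "integral {c..e} (\<lambda>x. \<bar>s x\<bar>) \<le> \<eta>" "integral {c..e} (\<lambda>x. \<bar>q x\<bar>) \<le> \<eta>"
    unfolding \<eta>_def using hi by (auto intro!: integral_le simp: majorant_def)
  have len: "e - c \<le> \<eta>"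
  proof -
    have "integral {c..e} (\<lambda>x. 1 :: real) \<le> \<eta>"
      unfolding \<eta>_def using hi(1) by (intro integral_le) (auto simp: majorant_def)
    then show ?thesis using ce(1) by simp
  qed
  have \<eta>: "0 \<le> \<eta>" "\<eta> < 1/2" using R small by (auto simp: \<eta>_def)
  have A0: "0 \<le> A" unfolding A_def by (intro integral_nonneg int) (auto simp: n_def r0)
  \<comment> \<open>A common bound for \<open>Y 1\<close> and \<open>Y 0\<close>. By Cauchy-Schwarz
    with weight \<open>r\<close>, its square is at most the leading term \<open>A\<close> times the
    small number \<open>R\<close>.\<close>
  define J where "J = integral {c..e} (\<lambda>x. cmod (Y 2 x) * r x)"
  have Ji: "(\<lambda>x. cmod (Y 2 x) * r x) integrable_on {c..e}"
    using mult[OF continuous_on_norm[OF cont] ai(1), of 2] by (auto dest: set_lebesgue_integral_eq_integral(1))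
  have "J\<^sup>2 \<le> A * R"
  proof (rule nonneg_quadratic_discriminant[OF _ R(1)])
    fix t :: real
    have "((\<lambda>x. n 2 x * r x - 2 * t * (cmod (Y 2 x) * r x) + t\<^sup>2 * r x) has_integral A - 2 * t * J + t\<^sup>2 * R) {c..e}"
      unfolding A_def J_def R_def
      by (intro has_integral_add has_integral_diff has_integral_mult_right integrable_integral int ri Ji)
    moreover have "n 2 x * r x - 2 * t * (cmod (Y 2 x) * r x) + t\<^sup>2 * r x = (cmod (Y 2 x) - t)\<^sup>2 * r x" for x
      by (simp add: n_def power2_eq_square algebra_simps)
    ultimately show "0 \<le> A - 2 * t * J + t\<^sup>2 * R"
      by (elim has_integral_nonneg) (simp add: r0)
  qed
  \<comment> \<open>\<open>Y 1\<close> starts from 0 at \<open>c\<close> and is the integral of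
    \<open>Y 2 / p\<close>. Then \<open>Y 0\<close>, also starting from 0, is at most
    \<open>J\<close> times the length, which is below 1.\<close>
  have Y1: "cmod (Y 1 x) \<le> J" if x: "x \<in> {c..e}" for x
  proof -
    have sub: "{c..x} \<subseteq> {c..e}" using x by auto
    have "((\<lambda>x. Y 2 x / of_real (p x)) has_integral Y 1 x - Y 1 c) {c..x}"
      using system_integrals(2)[OF Y, of c x] x ce(2) sub by (meson atLeastAtMost_iff subset_trans)
    then have i: "((\<lambda>x. Y 2 x / of_real (p x)) has_integral Y 1 x) {c..x}" using Yc[of 1] by simp
    have "cmod (integral {c..x} (\<lambda>x. Y 2 x / of_real (p x))) \<le> integral {c..x} (\<lambda>x. cmod (Y 2 x) * r x)"
      by (rule integral_norm_bound_integral)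
         (use i integrable_on_subinterval[OF Ji sub] in \<open>auto simp: norm_divide r_def\<close>)
    also have "\<dots> \<le> J"
      unfolding J_def by (rule integral_subset_le[OF sub integrable_on_subinterval[OF Ji sub] Ji]) (auto simp: r0)
    finally show ?thesis using i by (simp add: integral_unique)
  qed
  have J0: "0 \<le> J" using Y1[of c] ce(1) order_trans[OF norm_ge_zero] by fastforce
  have Y0: "cmod (Y 0 x) \<le> J" if x: "x \<in> {c..e}" for x
  proof -
    have sub: "{c..x} \<subseteq> {c..e}" using x by auto
    have i: "(Y 1 has_integral Y 0 x - Y 0 c) (cbox c x)"
      using system_integrals(1)[OF Y, of c x] x ce(2) sub unfolding box_real by (meson atLeastAtMost_iff subset_trans)
    have "cmod (Y 0 x - Y 0 c) \<le> J * measure lborel (cbox c x)"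
      by (rule has_integral_bound[OF J0 i]) (use Y1 sub in auto)
    also have "\<dots> \<le> J * 1" using x len \<eta> J0 by (intro mult_left_mono) auto
    finally show ?thesis using Yc[of 0] by simp
  qed
  have lower: "- (A * R) * \<eta> \<le> integral {c..e} (\<lambda>x. n k x * h x)"
    if h: "(\<lambda>x. n k x * h x) integrable_on {c..e}" "(\<lambda>x. \<bar>h x\<bar>) integrable_on {c..e}" "integral {c..e} (\<lambda>x. \<bar>h x\<bar>) \<le> \<eta>"
      and b: "\<And>x. x \<in> {c..e} \<Longrightarrow> cmod (Y k x) \<le> J" for k h
  proof -
    have "- (A * R) * \<eta> \<le> - (A * R) * integral {c..e} (\<lambda>x. \<bar>h x\<bar>)"
      using h(3) A0 R by (intro mult_left_mono_neg) auto
    also have "\<dots> = integral {c..e} (\<lambda>x. - (A * R) * \<bar>h x\<bar>)" by simp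
    also have "\<dots> \<le> integral {c..e} (\<lambda>x. n k x * h x)"
    proof (rule integral_le[OF _ h(1)])
      show "(\<lambda>x. - (A * R) * \<bar>h x\<bar>) integrable_on {c..e}" by (intro integrable_on_mult_right h(2))
      fix x assume x: "x \<in> {c..e}"
      have "n k x \<le> J\<^sup>2" unfolding n_def using b[OF x] by (intro power_mono) auto
      then have "n k x \<le> A * R" using \<open>J\<^sup>2 \<le> A * R\<close> by simp
      moreover have "0 \<le> n k x" by (simp add: n_def)
      ultimately have "n k x * \<bar>h x\<bar> \<le> (A * R) * \<bar>h x\<bar>" by (intro mult_right_mono) auto
      moreover have "- (n k x * \<bar>h x\<bar>) \<le> n k x * h x"
      proof -
        have "n k x * (- \<bar>h x\<bar>) \<le> n k x * h x" using \<open>0 \<le> n k x\<close> by (intro mult_left_mono) auto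
        then show ?thesis by simp
      qed
      ultimately show "- (A * R) * \<bar>h x\<bar> \<le> n k x * h x" by simp
    qed
    finally show ?thesis .
  qed
  have "I \<ge> A + - (A * R) * \<eta> + - (A * R) * \<eta>"
    unfolding I_def using lower[OF int(2) hi(3) sb(1) Y1] lower[OF int(3) hi(4) sb(2) Y0] by simp
  \<comment> \<open>Here the smallness 1/2 is used: \<open>R\<close> and \<open>\<eta>\<close> are
    both at most 1/2, so each of the two lower order terms costs at most a quarter of
    \<open>A\<close>, and half of \<open>A\<close> remains.\<close>
  moreover have "A * (R * \<eta>) \<le> A * (1/4)"
  proof (rule mult_left_mono[OF _ A0])
    have "R * \<eta> \<le> (1/2) * (1/2)" using R \<eta> by (intro mult_mono) auto
    then show "R * \<eta> \<le> 1/4" by simp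
  qed
  ultimately have IA: "A / 2 \<le> I" by (simp add: algebra_simps)
  \<comment> \<open>If the leading term vanished, so would \<open>J\<close>, hence
    \<open>Y 0\<close> and then the right-hand side \<open>g\<close>.\<close>
  have "A \<noteq> 0"
  proof
    assume "A = 0"
    then have "J = 0" using \<open>J\<^sup>2 \<le> A * R\<close> by simp
    then have z: "Y 0 x = 0" if "x \<in> {c..e}" for x using Y0[OF that] by simp
    interpret K: quasi_coeffs p s q w "{c..e}" by (rule coeffs_subinterval[OF ce])
    have "AE x in lebesgue. x \<in> {c..e} \<longrightarrow> g x = 0"
      by (rule K.system_zero_function(2)[OF system_subset[OF Y ce(2)] z, of c 0]) (use ce in auto)
    then show False using g by simp
  qed
  then have "0 < I" using IA A0 by simp
  then show ?thesis using main by blast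
qed

end

context truncated_setting
begin

text \<open>On a short interval at the left end, \<open>v\<close> is a step function orthogonal to
  \<open>G\<close> and to the four solutions of the homogeneous equation. The latter forces all
  quasi-derivatives of \<open>T v\<close> to vanish at both ends of the short interval, where
  \<open>energy_positive\<close> then applies.\<close>

lemma positive_test_function:
  assumes G: "finite G" "G \<subseteq> {f \<in> L2w w S. P f = f}"
  shows "\<exists>v\<in>{f \<in> L2w w S. P f = f}. (\<forall>g\<in>G. inner_w w S v g = 0) \<and> 0 < Re (inner_w w S (P (T v)) v)"
proof -
  obtain \<delta> where \<delta>: "0 < \<delta>" "\<And>x y. c \<le> x \<Longrightarrow> x \<le> y \<Longrightarrow> y \<le> d \<Longrightarrow> y - x < \<delta> \<Longrightarrow> integral {x..y} majorant < 1/2"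
    using small_integral[OF majorant_integrable(1)[OF cd(2)], of "1/2"] by auto
  define e where "e = min d (c + \<delta> / 2)"
  have ce: "c < e" "e \<le> d" "e - c < \<delta>" using cd(1) \<delta>(1) by (auto simp: e_def)
  have small: "integral {c..e} majorant < 1/2" using \<delta>(2)[of c e] ce by simp
  have ceS: "{c..e} \<subseteq> S" using cd(2) ce by auto
  have eS: "e \<in> S" using ceS ce(1) by auto
  \<comment> \<open>Orthogonality to the four solutions means that the bracket of \<open>T v\<close>
    with each of them has the same value at \<open>c\<close> and at \<open>e\<close>.\<close>
  define G' where "G' = G \<union> {\<phi>1, \<phi>2, \<psi>1, \<psi>2}"
  have G': "finite G'" "G' \<subseteq> L2w w S" using G solD(2) by (auto simp: G'_def)
  \<comment> \<open>One step more than there are constraints, so that a nontrivial step function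
    satisfies them all.\<close>
  define n where "n = Suc (card G')"
  define h where "h = (e - c) / n"
  have h: "0 < h" using ce by (simp add: h_def n_def)
  have nh: "c + real n * h = e" by (simp add: h_def n_def)
  define J where "J i = {c + real i * h ..< c + real (Suc i) * h}" for i
  have J_sub: "J i \<subseteq> {c..e}" if "i < n" for i
  proof -
    have "c + real (Suc i) * h \<le> e"
      unfolding nh[symmetric] using that h by (intro add_left_mono mult_right_mono) auto
    moreover have "c \<le> c + real i * h" using h by simp
    ultimately show ?thesis by (auto simp: J_def)
  qed
  have J_disj: "i = j" if "x \<in> J i" "x \<in> J j" for i j x
  proof -
    have "real i * h < real (Suc j) * h" "real j * h < real (Suc i) * h" using that by (auto simp: J_def)
    then have "i < Suc j" "j < Suc i" using h by (simp_all add: mult_less_cancel_right)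
    then show ?thesis by simp
  qed
  define f where "f i = restr (J i) (\<lambda>x. 1)" for i :: nat
  have fL: "f i \<in> L2w w S" if "i < n" for i
  proof -
    have "w absolutely_integrable_on {c..d}" using w_loc cd(2) by (simp add: L1_loc_def)
    then have "integrable (lebesgue_on {c..d}) w" by (simp add: absolutely_integrable_imp_integrable)
    then have one: "restr {c..d} (\<lambda>x. 1) \<in> L2w w {c..d}"
    proof -
      assume wi: "integrable (lebesgue_on {c..d}) w"
      have eq: "integrable (lebesgue_on {c..d}) (\<lambda>x. (cmod (restr {c..d} (\<lambda>x. 1) x))\<^sup>2 * w x)"
        using wi by (subst Bochner_Integration.integrable_cong[OF refl, of _ _ w]) (auto simp: restr_def)
      have "restr {c..d} (\<lambda>x. 1) \<in> borel_measurable lebesgue" unfolding restr_def by measurable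
      then show ?thesis using eq KW.measurable_vanishing[of "restr {c..d} (\<lambda>x. 1)"] by (simp add: L2w_def restr_def)
    qed
    have "restr (J i) (restr {c..d} (\<lambda>x. 1)) \<in> L2w w S"
      by (rule W.restr_in_L2w[OF L2wK_sub[OF one]]) (simp add: J_def)
    moreover have "restr (J i) (restr {c..d} (\<lambda>x. 1)) = f i"
      using J_sub[OF that] ce(2) by (auto simp: f_def restr_def fun_eq_iff)
    ultimately show ?thesis by simp
  qed
  obtain a where a: "\<exists>i\<in>{..<n}. a i \<noteq> 0" "\<And>g. g \<in> G' \<Longrightarrow> (\<Sum>i<n. a i * inner_w w S (f i) g) = 0"
    using homogeneous_system_nontrivial[OF G'(1), of "{..<n}" "\<lambda>i. inner_w w S (f i)"] by (auto simp: n_def)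
  define v where "v = (\<Sum>i<n. (\<lambda>x. a i * f i x))"
  have v_app: "v x = (\<Sum>i<n. a i * f i x)" for x by (simp add: v_def fun_sum_apply)
  have vL: "v \<in> L2w w S" unfolding v_def using fL by (intro W.L2.H_sum W.L2w_cmult) auto
  have vG: "inner_w w S v g = 0" if g: "g \<in> G'" for g
  proof -
    have "inner_w w S v g = (\<Sum>i<n. inner_w w S (\<lambda>x. a i * f i x) g)"
      unfolding v_def using fL G'(2) g by (intro W.L2.ip_sum W.L2w_cmult) auto
    also have "\<dots> = (\<Sum>i<n. a i * inner_w w S (f i) g)"
      using fL G'(2) g by (intro sum.cong W.L2.ip_scale) auto
    finally show ?thesis using a(2)[OF g] by simp
  qed
  have v_out: "v x = 0" if "x \<notin> {c..e}" for x
  proof -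
    have "x \<notin> J i" if "i < n" for i using J_sub[OF that] \<open>x \<notin> {c..e}\<close> by blast
    then show ?thesis unfolding v_app by (intro sum.neutral) (auto simp: f_def restr_def)
  qed
  have v_notAE: "\<not> (AE x in lebesgue. x \<in> {c..e} \<longrightarrow> v x = 0)"
  proof
    assume ae: "AE x in lebesgue. x \<in> {c..e} \<longrightarrow> v x = 0"
    obtain i where i: "i < n" "a i \<noteq> 0" using a(1) by auto
    have vi: "v x = a i" if "x \<in> J i" for x
    proof -
      have "v x = (\<Sum>j<n. if j = i then a i else 0)"
        unfolding v_app using that J_disj by (intro sum.cong) (auto simp: f_def restr_def)
      then show ?thesis using i(1) by simp
    qed
    have "AE x in lebesgue. x \<notin> J i"
      using ae by eventually_elim (use vi J_sub[OF i(1)] i(2) in auto)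
    then have "J i \<in> null_sets lebesgue"
      using AE_iff_null_sets[of "J i" lebesgue] by (simp add: J_def)
    then have "emeasure lebesgue (J i) = 0" by auto
    then show False using h by (simp add: J_def algebra_simps)
  qed
  note Tv = T_props[OF vL]
  define y where "y = T v"
  have yD: "y \<in> D" and y_ae: "AE x in lebesgue. x \<in> S \<longrightarrow> lop y x = v x" unfolding y_def by (rule Tv)+
  have rv: "restr {c..e} v = v" using v_out by (auto simp: restr_def fun_eq_iff)
  have rlop: "restr {c..e} (lop y) \<in> L2w w S" by (rule W.restr_in_L2w[OF DD(3)[OF yD]]) simp
  have rlop_ae: "AE x in lebesgue. x \<in> S \<longrightarrow> restr {c..e} (lop y) x = v x"
    using y_ae by eventually_elim (use v_out in \<open>auto simp: restr_def\<close>)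
  \<comment> \<open>Brackets with the \<phi>s vanish at \<open>c\<close> because \<open>v\<close>
    vanishes to its left, those with the \<psi>s vanish at \<open>e\<close> because \<open>v\<close>
    vanishes to its right; the orthogonality carries each to the other end.\<close>
  have br: "bracket (Q y) (Q z) c = 0 \<and> bracket (Q y) (Q z) e = 0" if z: "z \<in> {\<phi>1, \<phi>2, \<psi>1, \<psi>2}" for z
  proof -
    have "bracket (Q y) (Q z) e - bracket (Q y) (Q z) c = inner_w w S (restr {c..e} (lop y)) z"
      using inner_restr_integral[OF DD(3)[OF yD] solD(2)[OF z] ceS bracket_increment[OF DD(1)[OF yD] z]] ce(1) cd_S eS by simp
    also have "\<dots> = inner_w w S v z"
      by (rule W.inner_w_AE[OF rlop vL solD(2)[OF z] solD(2)[OF z] rlop_ae]) simp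
    also have "\<dots> = 0" by (rule vG) (use z in \<open>auto simp: G'_def\<close>)
    finally have eq: "bracket (Q y) (Q z) e = bracket (Q y) (Q z) c" by simp
    show ?thesis
    proof (cases "z \<in> {\<phi>1, \<phi>2}")
      case True
      have "bracket (Q y) (Q z) c = 0"
        by (rule bracket_zero_left[OF yD True cd_S(1)], use y_ae in eventually_elim) (use v_out in auto)
      then show ?thesis using eq by simp
    next
      case False
      then have "z \<in> {\<psi>1, \<psi>2}" using z by auto
      then have "bracket (Q y) (Q z) e = 0"
        by (rule bracket_zero_right[OF yD _ eS], use y_ae in eventually_elim) (use v_out in auto)
      then show ?thesis using eq by simp
    qed
  qed
  have Yc: "Q y k c = 0" if "k \<le> 3" for k using brackets_zero_imp_zero[OF cd_S(1) that] br by blast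
  have Ye: "Q y k e = 0" if "k \<le> 3" for k using brackets_zero_imp_zero[OF eS that] br by blast
  have notAE: "\<not> (AE x in lebesgue. x \<in> {c..e} \<longrightarrow> of_real (w x) * lop y x = 0)"
  proof
    assume "AE x in lebesgue. x \<in> {c..e} \<longrightarrow> of_real (w x) * lop y x = 0"
    then have "AE x in lebesgue. x \<in> {c..e} \<longrightarrow> v x = 0"
      using y_ae w_pos by eventually_elim (use ceS in auto)
    then show False using v_notAE by simp
  qed
  obtain I where I: "0 < I" "((\<lambda>x. Q y 0 x * cnj (of_real (w x) * lop y x)) has_integral complex_of_real I) {c..e}"
    using energy_positive[OF qd_system[OF DD(1)[OF yD]] ce(1) ceS small Yc Ye notAE] by blast
  have "((\<lambda>x. of_real (w x) * y x * cnj (lop y x)) has_integral complex_of_real I) {c..e}"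
    using I(2) by (simp add: qd_props(1)[OF DD(1)[OF yD]] mult_ac)
  then have "inner_w w S (restr {c..e} y) (lop y) = complex_of_real I"
    by (rule inner_restr_integral[OF DD(2)[OF yD] DD(3)[OF yD] ceS])
  moreover have "inner_w w S (restr {c..e} y) (lop y) = inner_w w S (restr {c..e} y) v"
    using W.restr_in_L2w[OF DD(2)[OF yD], of "{c..e}"] by (intro W.inner_w_AE[OF _ _ DD(3)[OF yD] vL _ y_ae]) auto
  moreover have "inner_w w S (restr {c..e} y) v = inner_w w S y (restr {c..e} v)"
    using proj_restr[of "{c..e}"] DD(2)[OF yD] vL by (simp add: T.proj_def)
  ultimately have Tvv: "inner_w w S (T v) v = complex_of_real I" by (simp add: rv y_def)
  have Pv: "P v = v" using v_out ce(2) by (auto simp: restr_def fun_eq_iff)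
  have "inner_w w S (P (T v)) v = inner_w w S (T v) (P v)"
    using proj_restr[OF K_sets] DD(2)[OF Tv(1)] vL by (simp add: T.proj_def)
  then have "0 < Re (inner_w w S (P (T v)) v)" using Tvv I(1) by (simp add: Pv)
  moreover have "\<forall>g\<in>G. inner_w w S v g = 0" using vG by (auto simp: G'_def)
  ultimately show ?thesis using vL Pv by blast
qed

end

section \<open>Convergence of eigenvalues\<close>

lemma (in compact_symmetric) compact_symmetric_neg: "compact_symmetric scale H ip (\<lambda>f. - T f)"
proof
  fix f assume f: "f \<in> H"
  show "- T f \<in> H" using f by simp
  show "- T (scale c f) = scale c (- T f)" for c using f by (simp add: T_scale)
  show "- T f = 0" if "ip f f = 0" using T_null[OF f that] by simp
  fix g assume g: "g \<in> H"
  show "- T (f + g) = - T f + - T g" using f g by (simp add: T_add)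
  show "ip (- T f) g = ip f (- T g)" using f g T_sym[OF f g] by (simp add: ip_neg ip_neg_right)
next
  show "\<exists>C\<ge>0. \<forall>f\<in>H. nrm (- T f) \<le> C * nrm f" using T_bdd by (simp add: nrm_neg)
next
  fix fs :: "nat \<Rightarrow> 'v" and B assume fs: "\<And>n. fs n \<in> H" "\<And>n. nrm (fs n) \<le> B"
  obtain r :: "nat \<Rightarrow> nat" and z where r: "strict_mono r" "z \<in> H" "(\<lambda>n. nrm (T (fs (r n)) - z)) \<longlonglongrightarrow> 0"
    using T_compact[where fs = fs and B = B, OF fs] by metis
  have "nrm (- T (fs (r n)) - (- z)) = nrm (T (fs (r n)) - z)" for n
    using nrm_neg[of "T (fs (r n)) - z"] fs(1) r(2) by simp
  then show "\<exists>(r::nat\<Rightarrow>nat) z. strict_mono r \<and> z \<in> H \<and> (\<lambda>n. nrm (- T (fs (r n)) - z)) \<longlonglongrightarrow> 0"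
    using r by (intro exI[of _ r] exI[of _ "- z"]) simp
qed

lemma (in vector_space) eig_neg: "eig (\<lambda>f. - T f) H \<mu> = eig T H (- \<mu>)"
  by (simp add: eig_def)

lemma pos_indexing_of_eigenvalue_indexing:
  assumes idx: "eigenvalue_indexing E I lam"
    and fin: "\<And>\<mu>::real. 0 < \<mu> \<Longrightarrow> \<exists>B. finite B \<and> E (of_real \<mu>) \<subseteq> cfun.span B"
    and E': "\<And>\<mu>::real. 0 < \<mu> \<Longrightarrow> E' \<mu> = E (of_real \<mu>)"
  shows "cfun.pos_indexing E' I lam"
proof -
  have 1: "0 \<notin> I" and 2: "\<And>k m. k \<in> I \<Longrightarrow> 0 < m \<and> m \<le> k \<or> k \<le> m \<and> m < 0 \<Longrightarrow> m \<in> I"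
    and 3: "\<And>k. k \<in> I \<Longrightarrow> 0 < k \<Longrightarrow> 0 < lam k" "\<And>k. k \<in> I \<Longrightarrow> k < 0 \<Longrightarrow> lam k < 0"
    and 4: "mono_on I lam"
    and 5: "\<And>\<mu>. \<mu> \<noteq> 0 \<Longrightarrow> finite {k\<in>I. complex_of_real (lam k) = \<mu>} \<and> card {k\<in>I. complex_of_real (lam k) = \<mu>} = cfun.dim (E \<mu>)"
    using idx unfolding eigenvalue_indexing_def by blast+
  have "0 < k \<longleftrightarrow> 0 < lam k" if "k \<in> I" for k
  proof -
    have "k \<noteq> 0" using 1 that by auto
    then show ?thesis using 3[OF that] by (cases "0 < k") auto
  qed
  moreover have "finite {k\<in>I. lam k = \<mu>} \<and> card {k\<in>I. lam k = \<mu>} = cfun.dim (E' \<mu>) \<and> (\<exists>B. finite B \<and> E' \<mu> \<subseteq> cfun.span B)"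
    if "0 < \<mu>" for \<mu>
    using 5[of "complex_of_real \<mu>"] that fin[OF that] E'[OF that] by simp
  ultimately show ?thesis unfolding cfun.pos_indexing_def using 2 4 by blast
qed

text \<open>Reflecting indices and eigenvalues turns the negative eigenvalues of \<open>L\<close>
  into the positive ones of \<open>- L\<close>, so only positive indices need a convergence
  proof.\<close>

lemma eigenvalue_indexing_neg:
  assumes idx: "eigenvalue_indexing E I lam"
  shows "eigenvalue_indexing (\<lambda>\<mu>. E (- \<mu>)) (uminus ` I) (\<lambda>k. - lam (- k))"
proof -
  have 1: "0 \<notin> I" and 2: "\<And>k m. k \<in> I \<Longrightarrow> 0 < m \<and> m \<le> k \<or> k \<le> m \<and> m < 0 \<Longrightarrow> m \<in> I"
    and 3: "\<And>k. k \<in> I \<Longrightarrow> 0 < k \<Longrightarrow> 0 < lam k" "\<And>k. k \<in> I \<Longrightarrow> k < 0 \<Longrightarrow> lam k < 0"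
    and 4: "mono_on I lam"
    and 5: "\<And>\<mu>. \<mu> \<noteq> 0 \<Longrightarrow> finite {k\<in>I. complex_of_real (lam k) = \<mu>} \<and> card {k\<in>I. complex_of_real (lam k) = \<mu>} = cfun.dim (E \<mu>)"
    using idx unfolding eigenvalue_indexing_def by blast+
  have mem: "k \<in> uminus ` I \<longleftrightarrow> - k \<in> I" for k :: int by (metis image_iff minus_minus)
  show ?thesis
    unfolding eigenvalue_indexing_def
  proof (intro conjI ballI allI impI)
    show "0 \<notin> uminus ` I" using 1 by (simp add: mem)
    show "m \<in> uminus ` I" if "k \<in> uminus ` I" "0 < m \<and> m \<le> k \<or> k \<le> m \<and> m < 0" for k m
      using 2[of "- k" "- m"] that unfolding mem by auto
    show "0 < - lam (- k)" if "k \<in> uminus ` I" "0 < k" for k using 3(2)[of "- k"] that unfolding mem by simp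
    show "- lam (- k) < 0" if "k \<in> uminus ` I" "k < 0" for k using 3(1)[of "- k"] that unfolding mem by simp
    show "mono_on (uminus ` I) (\<lambda>k. - lam (- k))"
      by (intro mono_onI) (use mono_onD[OF 4] in \<open>auto simp: mem\<close>)
    fix \<mu> :: complex assume \<mu>: "\<mu> \<noteq> 0"
    have "{k \<in> uminus ` I. complex_of_real (- lam (- k)) = \<mu>} = uminus ` {k\<in>I. complex_of_real (lam k) = - \<mu>}"
      by (auto simp: minus_equation_iff)
    then show "finite {k \<in> uminus ` I. complex_of_real (- lam (- k)) = \<mu>}"
      "card {k \<in> uminus ` I. complex_of_real (- lam (- k)) = \<mu>} = cfun.dim (E (- \<mu>))"
      using 5[of "- \<mu>"] \<mu> by (simp_all add: card_image)
  qed
qed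

lemma system_sum:
  assumes "finite F" "F \<noteq> {}" "\<And>e. e \<in> F \<Longrightarrow> system p s q S (Y e) (\<lambda>x. 0)"
  shows "system p s q S (\<lambda>k x. \<Sum>e\<in>F. c e * Y e k x) (\<lambda>x. 0)"
  using assms
proof (induction F rule: finite_ne_induct)
  case (singleton e)
  then have e: "system p s q S (Y e) (\<lambda>x. 0)" by simp
  show ?case using system_combination[OF e e, of "c e" 0] by simp
next
  case (insert e F)
  then have "system p s q S (Y e) (\<lambda>x. 0)" "system p s q S (\<lambda>k x. \<Sum>e\<in>F. c e * Y e k x) (\<lambda>x. 0)" by auto
  from system_combination[OF this, of "c e" 1] show ?case using insert.hyps by simp
qed

text \<open>An eigenfunction is determined by its four quasi-derivatives at a point. Among five
  independent ones some nontrivial combination would have zero initial values there, hence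
  vanish.\<close>

lemma (in quasi_coeffs) eigenspace_finite_dim:
  assumes E: "\<And>y. y \<in> E \<Longrightarrow> y \<in> D_ell p s S \<and> (AE x in lebesgue. x \<in> S \<longrightarrow> ell p s q w S y x = of_real \<mu> * y x)"
  shows "\<exists>B. finite B \<and> E \<subseteq> cfun.span B"
proof -
  obtain B where B: "B \<subseteq> E" "cfun.independent B" "E \<subseteq> cfun.span B" by (rule cfun.basis_exists)
  interpret M: quasi_coeffs p s "\<lambda>x. q x - \<mu> * w x" w S by (rule coeffs_shift)
  have "finite B"
  proof (rule ccontr)
    assume "infinite B"
    then obtain F where F: "finite F" "card F = 5" "F \<subseteq> B" using infinite_arbitrarily_large by blast
    obtain x0 where x0: "x0 \<in> S" using S_nontrivial by blast
    obtain c where c: "\<exists>e\<in>F. c e \<noteq> 0" "\<And>k. k \<in> {..3::nat} \<Longrightarrow> (\<Sum>e\<in>F. c e * qd p s S e k x0) = 0"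
      using homogeneous_system_nontrivial[of "{..3::nat}" F "\<lambda>e k. qd p s S e k x0"] F by auto
    have sys: "system p s (\<lambda>x. q x - \<mu> * w x) S (\<lambda>k x. \<Sum>e\<in>F. c e * qd p s S e k x) (\<lambda>x. 0)"
    proof (rule system_sum[OF F(1)])
      show "F \<noteq> {}" using F(2) by auto
      fix e assume "e \<in> F"
      then have "e \<in> E" using F(3) B(1) by auto
      then show "system p s (\<lambda>x. q x - \<mu> * w x) S (qd p s S e) (\<lambda>x. 0)"
        using E by (intro eigen_system) auto
    qed
    have "(\<Sum>e\<in>F. c e * e x) = 0" for x
    proof (cases "x \<in> S")
      case True
      have "(\<Sum>e\<in>F. c e * qd p s S e 0 x) = 0"
        by (rule M.system_unique[OF sys x0 _ True]) (use c(2) in auto)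
      moreover have "qd p s S e 0 = e" if "e \<in> F" for e using qd_props(1) E F(3) B(1) that by blast
      ultimately show ?thesis by simp
    next
      case False
      then show ?thesis using D_ell_outside E F(3) B(1) by (intro sum.neutral) fastforce
    qed
    then have "(\<Sum>e\<in>F. (\<lambda>x. c e * e x)) = 0" by (simp add: fun_eq_iff fun_sum_apply)
    then have "cfun.dependent F" using c(1) cfun.dependent_finite[OF F(1)] by blast
    then show False using B(2) F(3) cfun.independent_mono by blast
  qed
  then show ?thesis using B(3) by blast
qed

section \<open>Extended real end points\<close>

lemma einterval_mem: "x \<in> einterval a b \<longleftrightarrow> a < ereal x \<and> ereal x < b"
  by (simp add: einterval_def)

lemma is_interval_einterval: "is_interval (einterval a b)"
  unfolding is_interval_1
proof (intro ballI allI impI)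
  fix u v x assume "u \<in> einterval a b" "v \<in> einterval a b" "u \<le> x \<and> x \<le> v"
  then have "a < ereal u" "ereal u \<le> ereal x" "ereal x \<le> ereal v" "ereal v < b" by (auto simp: einterval_mem)
  then show "x \<in> einterval a b" unfolding einterval_mem by (meson less_le_trans le_less_trans)
qed

lemma between_imp_real:
  assumes "a < x" "x < b"
  shows "ereal (real_of_ereal x) = x"
  using assms by (cases x) auto

text \<open>\<open>at_right a\<close> lives on the extended reals, since \<open>a\<close> may be
  minus infinity; density yields a real point inside the neighbourhood.\<close>

lemma tendsto_at_right_ex:
  assumes "((\<lambda>x::ereal. h (real_of_ereal x) :: complex) \<longlongrightarrow> 0) (at_right a)" "x \<in> einterval a b" "0 < \<epsilon>"
  shows "\<exists>\<alpha>\<in>einterval a b. \<alpha> < x \<and> cmod (h \<alpha>) < \<epsilon>"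
proof -
  have ax: "a < ereal x" "ereal x < b" using assms(2) by (auto simp: einterval_mem)
  have "\<forall>\<^sub>F x in at_right a. cmod (h (real_of_ereal x)) < \<epsilon>"
    using tendstoD[OF assms(1,3)] by simp
  then obtain b' where b': "a < b'" "\<And>y. a < y \<Longrightarrow> y < b' \<Longrightarrow> cmod (h (real_of_ereal y)) < \<epsilon>"
    unfolding eventually_at_right[OF ax(1)] by blast
  obtain \<alpha> where \<alpha>: "a < ereal \<alpha>" "ereal \<alpha> < min b' (ereal x)"
    using ereal_dense2[of a "min b' (ereal x)"] b'(1) ax(1) by auto
  then have "cmod (h \<alpha>) < \<epsilon>" using b'(2)[of "ereal \<alpha>"] by simp
  moreover have "ereal \<alpha> < b" using \<alpha>(2) ax(2) by (meson less_trans min_less_iff_conj)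
  ultimately show ?thesis using \<alpha> by (intro bexI[of _ \<alpha>]) (auto simp: einterval_mem)
qed

lemma tendsto_at_left_ex:
  assumes "((\<lambda>x::ereal. h (real_of_ereal x) :: complex) \<longlongrightarrow> 0) (at_left b)" "x \<in> einterval a b" "0 < \<epsilon>"
  shows "\<exists>\<beta>\<in>einterval a b. x < \<beta> \<and> cmod (h \<beta>) < \<epsilon>"
proof -
  have ax: "a < ereal x" "ereal x < b" using assms(2) by (auto simp: einterval_mem)
  have "\<forall>\<^sub>F x in at_left b. cmod (h (real_of_ereal x)) < \<epsilon>"
    using tendstoD[OF assms(1,3)] by simp
  then obtain a' where a': "a' < b" "\<And>y. a' < y \<Longrightarrow> y < b \<Longrightarrow> cmod (h (real_of_ereal y)) < \<epsilon>"
    unfolding eventually_at_left[OF ax(2)] by blast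
  obtain \<beta> where \<beta>: "max a' (ereal x) < ereal \<beta>" "ereal \<beta> < b"
    using ereal_dense2[of "max a' (ereal x)" b] a'(1) ax(2) by auto
  then have "cmod (h \<beta>) < \<epsilon>" using a'(2)[of "ereal \<beta>"] by simp
  moreover have "a < ereal \<beta>" using \<beta>(1) ax(1) by (meson less_trans max_less_iff_conj)
  ultimately show ?thesis using \<beta> by (intro bexI[of _ \<beta>]) (auto simp: einterval_mem)
qed

lemma tendsto_zero_on_einterval:
  assumes "\<And>x. x \<in> einterval a b \<Longrightarrow> h x = (0::complex)" "a < b"
  shows "((\<lambda>x::ereal. h (real_of_ereal x)) \<longlongrightarrow> 0) (at_right a)" "((\<lambda>x::ereal. h (real_of_ereal x)) \<longlongrightarrow> 0) (at_left b)"
proof -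
  have h0: "h (real_of_ereal x) = 0" if "a < x" "x < b" for x
    using assms(1)[of "real_of_ereal x"] between_imp_real[OF that] that by (simp add: einterval_mem)
  have "\<forall>\<^sub>F x in at_right a. h (real_of_ereal x) = 0"
    unfolding eventually_at_right[OF assms(2)] using h0 assms(2) by blast
  then show "((\<lambda>x::ereal. h (real_of_ereal x)) \<longlongrightarrow> 0) (at_right a)" by (rule tendsto_eventually)
  have "\<forall>\<^sub>F x in at_left b. h (real_of_ereal x) = 0"
    unfolding eventually_at_left[OF assms(2)] using h0 assms(2) by blast
  then show "((\<lambda>x::ereal. h (real_of_ereal x)) \<longlongrightarrow> 0) (at_left b)" by (rule tendsto_eventually)
qed

text \<open>Local integrability gives measurability only on compact subintervals; the truncated
  functions converge pointwise along the exhaustion.\<close>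

lemma measurable_on_exhaustion:
  fixes w :: "real \<Rightarrow> real"
  assumes S: "S \<in> sets lebesgue" and w: "L1_loc S w" and sub: "\<And>j::nat. {aa j..bb j} \<subseteq> S"
    and ev: "\<And>x. x \<in> S \<Longrightarrow> \<forall>\<^sub>F j in sequentially. x \<in> {aa j..bb j}"
  shows "w \<in> borel_measurable (lebesgue_on S)"
proof -
  have m: "(\<lambda>x. indicator {aa j..bb j} x *\<^sub>R w x) \<in> borel_measurable lebesgue" for j
  proof -
    have "w absolutely_integrable_on {aa j..bb j}" using w sub by (simp add: L1_loc_def)
    then have "integrable (lebesgue_on {aa j..bb j}) w" by (simp add: absolutely_integrable_imp_integrable)
    then have "w \<in> borel_measurable (lebesgue_on {aa j..bb j})" by (rule borel_measurable_integrable)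
    then show ?thesis by (subst (asm) borel_measurable_restrict_space_iff) auto
  qed
  have lim: "(\<lambda>j. indicator {aa j..bb j} x *\<^sub>R w x) \<longlonglongrightarrow> indicator S x *\<^sub>R w x" for x
  proof (cases "x \<in> S")
    case True
    then show ?thesis
      by (intro tendsto_eventually, use ev[OF True] in eventually_elim) (auto simp: indicator_def)
  next
    case False
    then have "indicator {aa j..bb j} x = (0::real)" for j using subsetD[OF sub[of j], of x] False by (auto simp: indicator_def)
    then show ?thesis using False by simp
  qed
  have "(\<lambda>x. indicator S x *\<^sub>R w x) \<in> borel_measurable lebesgue"
    by (rule borel_measurable_LIMSEQ_real[OF lim m])
  then show ?thesis using S by (subst borel_measurable_restrict_space_iff) auto
qed

theorem theorem3:
  fixes a b :: ereal
    and p s q w :: "real \<Rightarrow> real"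
    and \<phi>\<^sub>1 \<phi>\<^sub>2 \<psi>\<^sub>1 \<psi>\<^sub>2 :: "real \<Rightarrow> complex"
    and D :: "(real \<Rightarrow> complex) set"
    and aa bb :: "nat \<Rightarrow> real"
    and I :: "int set" and lam :: "int \<Rightarrow> real"
    and J :: "nat \<Rightarrow> int set" and lamj :: "nat \<Rightarrow> int \<Rightarrow> real"
  defines "S \<equiv> einterval a b"
    and "Dj \<equiv> (\<lambda>j. reg_domain p s q w a b \<phi>\<^sub>1 \<phi>\<^sub>2 \<psi>\<^sub>1 \<psi>\<^sub>2 (aa j) (bb j))"
  assumes "a < b"
    and "L1_loc S (\<lambda>x. 1 / p x)" and "L1_loc S s" and "L1_loc S q" and "L1_loc S w"
    and "AE x in lebesgue_on S. 0 < p x" and "AE x in lebesgue_on S. 0 < w x"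
    and "lim_type_left p s q w S 4" and "lim_type_right p s q w S 4"
    and "{\<phi>\<^sub>1, \<phi>\<^sub>2, \<psi>\<^sub>1, \<psi>\<^sub>2} \<subseteq> solutions p s q w S 0 \<inter> L2w w S"
    and "\<phi>\<^sub>1 \<noteq> \<phi>\<^sub>2" and "cfun.independent {\<phi>\<^sub>1, \<phi>\<^sub>2}"
    and "\<psi>\<^sub>1 \<noteq> \<psi>\<^sub>2" and "cfun.independent {\<psi>\<^sub>1, \<psi>\<^sub>2}"
    and "\<And>x. x \<in> S \<Longrightarrow> bracket (qd p s S \<phi>\<^sub>1) (qd p s S \<phi>\<^sub>1) x = 0"
    and "\<And>x. x \<in> S \<Longrightarrow> bracket (qd p s S \<phi>\<^sub>1) (qd p s S \<phi>\<^sub>2) x = 0"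
    and "\<And>x. x \<in> S \<Longrightarrow> bracket (qd p s S \<phi>\<^sub>2) (qd p s S \<phi>\<^sub>2) x = 0"
    and "\<And>x. x \<in> S \<Longrightarrow> bracket (qd p s S \<psi>\<^sub>1) (qd p s S \<psi>\<^sub>1) x = 0"
    and "\<And>x. x \<in> S \<Longrightarrow> bracket (qd p s S \<psi>\<^sub>1) (qd p s S \<psi>\<^sub>2) x = 0"
    and "\<And>x. x \<in> S \<Longrightarrow> bracket (qd p s S \<psi>\<^sub>2) (qd p s S \<psi>\<^sub>2) x = 0"
    and "D_min p s q w S \<subseteq> D" and "self_adjoint p s q w S D"
    and "purely_discrete_spectrum p s q w S D"
    and "D = sep_domain p s q w a b \<phi>\<^sub>1 \<phi>\<^sub>2 \<psi>\<^sub>1 \<psi>\<^sub>2"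
    and "eigenspace p s q w S D 0 = {0}"
    and "\<And>j. a < ereal (aa j)" and "\<And>j. aa j < bb j" and "\<And>j. ereal (bb j) < b"
    and "decseq aa" and "(\<lambda>j. ereal (aa j)) \<longlonglongrightarrow> a"
    and "incseq bb" and "(\<lambda>j. ereal (bb j)) \<longlonglongrightarrow> b"
    and "eigenvalue_indexing (eigenspace p s q w S D) I lam"
    and "\<And>j. eigenvalue_indexing (eigenspace p s q w {aa j..bb j} (Dj j)) (J j) (lamj j)"
  shows "(\<forall>j. self_adjoint p s q w {aa j..bb j} (Dj j) \<and>
              eigenspace p s q w {aa j..bb j} (Dj j) 0 = {0})
    \<and> (\<forall>k>0. k \<in> I \<and> (\<forall>j. k \<in> J j) \<and> (\<lambda>j. lamj j k) \<longlonglongrightarrow> lam k)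
    \<and> (\<forall>k>0. - k \<in> I \<longrightarrow>
          (\<forall>\<^sub>F j in sequentially. - k \<in> J j) \<and> (\<lambda>j. lamj j (- k)) \<longlonglongrightarrow> lam (- k))"
proof -
  note a_b = assms(3) and D_eq = assms(26)
  have sub: "{aa j..bb j} \<subseteq> S" for j
  proof
    fix x assume "x \<in> {aa j..bb j}"
    then have "ereal (aa j) \<le> ereal x" "ereal x \<le> ereal (bb j)" by auto
    then show "x \<in> S" unfolding S_def einterval_mem
      using assms(28)[of j] assms(30)[of j] less_le_trans le_less_trans by blast
  qed
  have ev: "\<forall>\<^sub>F j in sequentially. x \<in> {aa j..bb j}" if "x \<in> S" for x
  proof -
    have x: "a < ereal x" "ereal x < b" using that by (auto simp: S_def einterval_mem)
    show ?thesis using order_tendstoD(2)[OF assms(32) x(1)] order_tendstoD(1)[OF assms(34) x(2)]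
      by eventually_elim auto
  qed
  have S_sets: "S \<in> sets lebesgue" unfolding S_def by simp
  have AEr: "(AE x in lebesgue_on S. R x) \<longleftrightarrow> (AE x in lebesgue. x \<in> S \<longrightarrow> R x)" for R
    using S_sets by (subst AE_restrict_space_iff) auto
  have quasi_coeffs: "quasi_coeffs p s q w S"
  proof
    show "is_interval S" unfolding S_def by (rule is_interval_einterval)
    show "\<exists>u\<in>S. \<exists>v\<in>S. u < v"
      using sub[of 0] assms(29)[of 0] by (intro bexI[of _ "aa 0"] bexI[of _ "bb 0"]) auto
    show "AE x in lebesgue. x \<in> S \<longrightarrow> 0 < p x" "AE x in lebesgue. x \<in> S \<longrightarrow> 0 < w x"
      using assms(8,9) unfolding AEr by auto
  qed (rule S_sets assms(4-7))+
  have weight: "weight w S"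
  proof
    show "w \<in> borel_measurable (lebesgue_on S)" by (rule measurable_on_exhaustion[OF S_sets assms(7) sub ev])
    show "AE x in lebesgue. x \<in> S \<longrightarrow> 0 < w x" using assms(9) unfolding AEr .
  qed (rule S_sets)
  interpret C: quasi_coeffs p s q w S by (rule quasi_coeffs)
  interpret W: weight w S by (rule weight)
  note sa = assms(24)[unfolded self_adjoint_def]
  have D_max: "D \<subseteq> D_max p s q w S" and D_sub: "cfun.subspace D" using sa by auto
  have adj: "(\<forall>f\<in>D. inner_w w S (ell p s q w S f) g = inner_w w S f h) \<longleftrightarrow>
      (\<exists>y\<in>D. (AE x in lebesgue_on S. g x = y x) \<and> (AE x in lebesgue_on S. h x = ell p s q w S y x))"
    if "g \<in> L2w w S" "h \<in> L2w w S" for g h using sa that by blast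
  \<comment> \<open>With a purely discrete spectrum a point outside the resolvent set is an
    eigenvalue, which 0 is not.\<close>
  have res: "0 \<in> resolvent_set p s q w S D"
    using assms(25,27) unfolding purely_discrete_spectrum_def by blast
  have sep: "y \<in> D \<longleftrightarrow> y \<in> D_max p s q w S \<and>
     ((\<lambda>x. bracket (qd p s S y) (qd p s S \<phi>\<^sub>1) (real_of_ereal x)) \<longlongrightarrow> 0) (at_right a) \<and>
     ((\<lambda>x. bracket (qd p s S y) (qd p s S \<phi>\<^sub>2) (real_of_ereal x)) \<longlongrightarrow> 0) (at_right a) \<and>
     ((\<lambda>x. bracket (qd p s S y) (qd p s S \<psi>\<^sub>1) (real_of_ereal x)) \<longlongrightarrow> 0) (at_left b) \<and>
     ((\<lambda>x. bracket (qd p s S y) (qd p s S \<psi>\<^sub>2) (real_of_ereal x)) \<longlongrightarrow> 0) (at_left b)" for y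
    unfolding D_eq sep_domain_def Let_def S_def by blast
  interpret boundary_setting p s q w S D \<phi>\<^sub>1 \<phi>\<^sub>2 \<psi>\<^sub>1 \<psi>\<^sub>2
  proof (intro boundary_setting.intro boundary_setting_axioms.intro)
    show "quasi_coeffs p s q w S" "weight w S" by (rule quasi_coeffs, rule weight)
    show "open S" unfolding S_def by simp
    show "D \<subseteq> D_max p s q w S" "cfun.subspace D" by (rule D_max, rule D_sub)
    show "{\<phi>\<^sub>1, \<phi>\<^sub>2, \<psi>\<^sub>1, \<psi>\<^sub>2} \<subseteq> solutions p s q w S 0 \<inter> L2w w S" by (rule assms(12))
    show "k = 0 \<and> l = 0" if "\<And>x. k * \<psi>\<^sub>1 x + l * \<psi>\<^sub>2 x = 0" for k l
    proof (rule ccontr)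
      assume kl: "\<not> (k = 0 \<and> l = 0)"
      define u where "u v = (if v = \<psi>\<^sub>1 then k else l)" for v
      have ne: "\<psi>\<^sub>1 \<notin> {\<psi>\<^sub>2}" "\<psi>\<^sub>2 \<noteq> \<psi>\<^sub>1" using assms(15) by blast+
      have u: "u \<psi>\<^sub>1 = k" "u \<psi>\<^sub>2 = l"
        unfolding u_def by (rule if_P[OF refl], rule if_not_P[OF ne(2)])
      have "(\<Sum>v\<in>{\<psi>\<^sub>1, \<psi>\<^sub>2}. (\<lambda>x. u v * v x)) = (\<lambda>x. u \<psi>\<^sub>1 * \<psi>\<^sub>1 x) + (\<lambda>x. u \<psi>\<^sub>2 * \<psi>\<^sub>2 x)"
        by (subst sum.insert[OF _ ne(1)]) simp_all
      also have "\<dots> = 0" using that by (simp add: u fun_eq_iff)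
      finally have "(\<Sum>v\<in>{\<psi>\<^sub>1, \<psi>\<^sub>2}. (\<lambda>x. u v * v x)) = 0" .
      moreover have "\<exists>v\<in>{\<psi>\<^sub>1, \<psi>\<^sub>2}. u v \<noteq> 0" using kl u by blast
      ultimately have "cfun.dependent {\<psi>\<^sub>1, \<psi>\<^sub>2}" using cfun.dependent_finite[of "{\<psi>\<^sub>1, \<psi>\<^sub>2}"] by blast
      then show False using assms(16) by simp
    qed
    show "\<exists>\<alpha>\<in>S. \<alpha> < x \<and> cmod (bracket (qd p s S y) (qd p s S \<phi>) \<alpha>) < \<epsilon>"
      if "y \<in> D" "x \<in> S" "0 < \<epsilon>" "\<phi> \<in> {\<phi>\<^sub>1, \<phi>\<^sub>2}" for y x \<epsilon> \<phi>
    proof -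
      have "((\<lambda>x. bracket (qd p s S y) (qd p s S \<phi>) (real_of_ereal x)) \<longlongrightarrow> 0) (at_right a)"
        using that(1,4) sep[of y] by auto
      from tendsto_at_right_ex[OF this that(2)[unfolded S_def] that(3)] show ?thesis by (simp only: S_def)
    qed
    show "\<exists>\<beta>\<in>S. x < \<beta> \<and> cmod (bracket (qd p s S y) (qd p s S \<psi>) \<beta>) < \<epsilon>"
      if "y \<in> D" "x \<in> S" "0 < \<epsilon>" "\<psi> \<in> {\<psi>\<^sub>1, \<psi>\<^sub>2}" for y x \<epsilon> \<psi>
    proof -
      have "((\<lambda>x. bracket (qd p s S y) (qd p s S \<psi>) (real_of_ereal x)) \<longlongrightarrow> 0) (at_left b)"
        using that(1,4) sep[of y] by auto
      from tendsto_at_left_ex[OF this that(2)[unfolded S_def] that(3)] show ?thesis by (simp only: S_def)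
    qed
    show "y \<in> D" if y: "y \<in> D_max p s q w S"
      and z: "\<And>x z. x \<in> S \<Longrightarrow> z \<in> {\<phi>\<^sub>1, \<phi>\<^sub>2, \<psi>\<^sub>1, \<psi>\<^sub>2} \<Longrightarrow> bracket (qd p s S y) (qd p s S z) x = 0" for y
      unfolding sep using y z by (auto intro!: tendsto_zero_on_einterval a_b simp: S_def)
    show "\<exists>y\<in>D. AE x in lebesgue. x \<in> S \<longrightarrow> ell p s q w S y x = f x" if "f \<in> L2w w S" for f
      using res that unfolding resolvent_set_def AEr by simp
    show "y = 0" if "y \<in> D" "AE x in lebesgue. x \<in> S \<longrightarrow> ell p s q w S y x = 0" for y
    proof -
      have "y \<in> eigenspace p s q w S D 0" using that by (simp add: C.eigenspace_iff)
      then show ?thesis using assms(27) by auto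
    qed
    show "inner_w w S (ell p s q w S y) z = inner_w w S y (ell p s q w S z)" if y: "y \<in> D" and z: "z \<in> D" for y z
    proof -
      have "z \<in> L2w w S" "ell p s q w S z \<in> L2w w S" using z D_max by (auto simp: D_max_def)
      from adj[OF this] y z show ?thesis by auto
    qed
    show "\<exists>C. \<forall>y\<in>D. norm_w w S y \<le> C * norm_w w S (ell p s q w S y)"
      using res by (simp add: resolvent_set_def)
  qed (rule assms(17-22), assumption)+
  have truncated_setting: "truncated_setting p s q w S D \<phi>\<^sub>1 \<phi>\<^sub>2 \<psi>\<^sub>1 \<psi>\<^sub>2 (aa j) (bb j) (Dj j)" for j
  proof (intro truncated_setting.intro truncated_setting_axioms.intro)
    show "Dj j = {y \<in> D_max p s q w {aa j..bb j}.
      bracket (qd p s {aa j..bb j} y) (qd p s S \<phi>\<^sub>1) (aa j) = 0 \<and> bracket (qd p s {aa j..bb j} y) (qd p s S \<phi>\<^sub>2) (aa j) = 0 \<and>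
      bracket (qd p s {aa j..bb j} y) (qd p s S \<psi>\<^sub>1) (bb j) = 0 \<and> bracket (qd p s {aa j..bb j} y) (qd p s S \<psi>\<^sub>2) (bb j) = 0}"
      by (simp add: Dj_def reg_domain_def S_def Let_def)
  qed (rule boundary_setting_axioms assms(29) sub)+
  let ?H = "L2w w S"
  let ?P = "\<lambda>j. restr {aa j..bb j}"
  let ?Hj = "\<lambda>j. {f \<in> L2w w S. restr {aa j..bb j} f = f}"
  have idx: "cfun.pos_indexing (\<lambda>\<mu>. cfun.eig T ?H (of_real \<mu>)) I lam"
  proof (rule pos_indexing_of_eigenvalue_indexing[OF assms(35)])
    show "\<exists>B. finite B \<and> eigenspace p s q w S D (of_real \<mu>) \<subseteq> cfun.span B" for \<mu> :: real
      by (rule C.eigenspace_finite_dim) (auto simp: C.eigenspace_iff DD(1))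
  qed (simp add: eig_T)
  have idx_neg: "cfun.pos_indexing (\<lambda>\<mu>. cfun.eig (\<lambda>f. - T f) ?H (of_real \<mu>)) (uminus ` I) (\<lambda>k. - lam (- k))"
  proof (rule pos_indexing_of_eigenvalue_indexing[OF eigenvalue_indexing_neg[OF assms(35)]])
    show "\<exists>B. finite B \<and> eigenspace p s q w S D (- of_real \<mu>) \<subseteq> cfun.span B" for \<mu> :: real
      by (rule C.eigenspace_finite_dim[where \<mu> = "- \<mu>"]) (auto simp: C.eigenspace_iff DD(1))
  qed (simp add: cfun.eig_neg eig_T)
  have idxj: "cfun.pos_indexing (\<lambda>\<mu>. cfun.eig (\<lambda>f. ?P j (T f)) (?Hj j) (of_real \<mu>)) (J j) (lamj j)"
    and idxj_neg: "cfun.pos_indexing (\<lambda>\<mu>. cfun.eig (\<lambda>f. ?P j (- T f)) (?Hj j) (of_real \<mu>)) (uminus ` J j) (\<lambda>k. - lamj j (- k))"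
    for j
  proof -
    interpret K: truncated_setting p s q w S D \<phi>\<^sub>1 \<phi>\<^sub>2 \<psi>\<^sub>1 \<psi>\<^sub>2 "aa j" "bb j" "Dj j" by (rule truncated_setting)
    have fin: "\<exists>B. finite B \<and> eigenspace p s q w {aa j..bb j} (Dj j) (of_real \<mu>) \<subseteq> cfun.span B" for \<mu> :: real
      by (rule K.K.eigenspace_finite_dim) (auto simp: K.K.eigenspace_iff K.DKD(1))
    show "cfun.pos_indexing (\<lambda>\<mu>. cfun.eig (\<lambda>f. ?P j (T f)) (?Hj j) (of_real \<mu>)) (J j) (lamj j)"
      by (rule pos_indexing_of_eigenvalue_indexing[OF assms(36) fin]) (simp add: K.eig_TK)
    have neg: "(\<lambda>f. ?P j (- T f)) = (\<lambda>f. - ?P j (T f))" by (simp add: restr_def fun_eq_iff)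
    show "cfun.pos_indexing (\<lambda>\<mu>. cfun.eig (\<lambda>f. ?P j (- T f)) (?Hj j) (of_real \<mu>)) (uminus ` J j) (\<lambda>k. - lamj j (- k))"
      unfolding neg cfun.eig_neg
      by (rule pos_indexing_of_eigenvalue_indexing[OF eigenvalue_indexing_neg[OF assms(36)]])
         (use fin[of "- _"] in \<open>auto simp: K.eig_TK\<close>)
  qed
  have proj: "T.proj (?P j)" for j by (rule proj_restr) simp
  have conv: "(\<lambda>j. W.L2.nrm (f - ?P j f)) \<longlonglongrightarrow> 0" if "f \<in> ?H" for f
    by (rule W.restr_tendsto[OF that _ ev]) simp
  interpret N: compact_symmetric "\<lambda>c f x. c * f x" ?H "inner_w w S" "\<lambda>f. - T f"
    by (rule T.compact_symmetric_neg)
  have pos: "k \<in> J j" if k: "0 < k" for k j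
  proof -
    interpret K: truncated_setting p s q w S D \<phi>\<^sub>1 \<phi>\<^sub>2 \<psi>\<^sub>1 \<psi>\<^sub>2 "aa j" "bb j" "Dj j" by (rule truncated_setting)
    \<comment> \<open>The max-min principle with bound 0: a positive form on every complement of
      fewer than \<open>k\<close> vectors already yields the index \<open>k\<close>.\<close>
    have "k \<in> J j \<and> 0 * lamj j k \<le> 1"
    proof (rule K.TK.courant_fischer_upper[OF idxj k order_refl])
      fix G assume "finite G" "G \<subseteq> ?Hj j"
      from K.positive_test_function[OF this] obtain v where "v \<in> ?Hj j" "\<forall>g\<in>G. inner_w w S v g = 0"
        "0 < Re (inner_w w S (?P j (T v)) v)" by blast
      then show "\<exists>v\<in>?Hj j. (\<forall>g\<in>G. inner_w w S v g = 0) \<and> 0 < Re (inner_w w S (?P j (T v)) v) \<and>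
          0 * (W.L2.nrm v)\<^sup>2 \<le> Re (inner_w w S (?P j (T v)) v)"
        by (intro bexI[of _ v]) simp_all
    qed
    then show ?thesis by simp
  qed
  show ?thesis
  proof (intro conjI allI impI)
    fix j
    interpret K: truncated_setting p s q w S D \<phi>\<^sub>1 \<phi>\<^sub>2 \<psi>\<^sub>1 \<psi>\<^sub>2 "aa j" "bb j" "Dj j" by (rule truncated_setting)
    show "self_adjoint p s q w {aa j..bb j} (Dj j)" by (rule K.DK_self_adjoint)
    show "eigenspace p s q w {aa j..bb j} (Dj j) 0 = {0}" by (rule K.DK_kernel)
  next
    fix k :: int assume k: "0 < k"
    \<comment> \<open>Any single truncation, here the first, has a \<open>k\<close>-th positive
      eigenvalue, and an index of a compression is one of \<open>T\<close> as well.\<close>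
    show kI: "k \<in> I" using T.compression_eigenvalue_ge[OF proj idx idxj k pos[OF k], of 0] by simp
    show "k \<in> J j" for j by (rule pos[OF k])
    show "(\<lambda>j. lamj j k) \<longlonglongrightarrow> lam k"
      using T.compression_eigenvalue_tendsto[OF proj conv idx idxj k kI] by blast
  next
    fix k :: int assume k: "0 < k" and kI: "- k \<in> I"
    have "k \<in> uminus ` I" using kI by (metis image_eqI minus_minus)
    from N.compression_eigenvalue_tendsto[OF proj conv idx_neg idxj_neg k this]
    have ev: "\<forall>\<^sub>F j in sequentially. k \<in> uminus ` J j" and lim: "(\<lambda>j. - lamj j (- k)) \<longlonglongrightarrow> - lam (- k)" by auto
    show "\<forall>\<^sub>F j in sequentially. - k \<in> J j" using ev by eventually_elim (auto simp: minus_equation_iff)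
    show "(\<lambda>j. lamj j (- k)) \<longlonglongrightarrow> lam (- k)" using tendsto_minus[OF lim] by simp
  qed
qed

end
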